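(* The braiding $\mathcal{S}(z)$ of $V(R^{\pm})$ satisfies $$\mathcal{S}(z)\big(L^{\pm}_{(n)}(u)\otimes L^{\pm}_{(m)}(v)\big)=L^{\pm}_{(n)}(u)\otimes L^{\pm}_{(m)}(v)\qquad\text{for all } m,n=1,\ldots,N,$$ where the same sign ($+$ or $-$) is taken throughout, and $$L_{(n)}^{\pm}(u)=\mathrm{tr}_{1,\ldots,n}\,L_1^+(u)\,L_2^+(u\pm h)\cdots L_n^+(u\pm(n-1)h)\,\mathbf{1}\in V(R^{\pm})[[u]].$$
   Context: Fix an integer $N\geq 2$ and a formal parameter $h$. Tensor products over $\mathbb{C}[[h]]$ are $h$-adically completed. Expansion convention: $(a_1u_1+\cdots+a_nu_n)^r$ with $r<0$, nonzero $a_i\in\mathbb{C}$, is expanded in nonnegative powers of $u_2,\ldots,u_n$ (the same if the last variable is replaced by $h$). $R$-matrices: $R(u)=I-Phu^{-1}$, with $I$ the identity and $P$ the permutation operator on $\mathbb{C}^N\otimes\mathbb{C}^N$; $R^{\pm}(u)=u(u\mp h)^{-1}R(u)\in\mathrm{End}\,\mathbb{C}^N\otimes\mathrm{End}\,\mathbb{C}^N[[h/u]]$; $\overline{R}(u)$ denotes either one of $R^{\pm}(u)$. Subscripts indicate tensor factors. For $u=(u_1,\ldots,u_n)$, $v=(v_1,\ldots,v_m)$ and $\overline{R}_{ij}=\overline{R}_{ij}(z+u_i-v_{j-n})$ put $$\overline{R}_{nm}^{12}(z+u-v)=\prod_{i=1,\ldots,n}^{\longrightarrow}\ \prod_{j=n+1,\ldots,n+m}^{\longleftarrow}\overline{R}_{ij},\qquad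 \overline{R}_{nm}^{\bar1\bar2}(z+u-v)=\prod_{i=1,\ldots,n}^{\longleftarrow}\ \prod_{j=n+1,\ldots,n+m}^{\longrightarrow}\overline{R}_{ij},$$ where $\longrightarrow$ (resp. $\longleftarrow$) means factors are written from left to right in increasing (resp. decreasing) order of the index. $A(\overline{R})$ is the topologically free associative algebra over $\mathbb{C}[[h]]$ generated by $l_{ij}^{(-r)}$, $r\ge1$, $i,j=1,\ldots,N$, subject to $\overline{R}(-u+v)L_1^+(u)L_2^+(v)=L_2^+(v)L_1^+(u)\overline{R}(u-v)$, where $L^+(u)=\sum_{i,j}e_{ij}\otimes l_{ij}^+(u)$, $l_{ij}^+(u)=\sum_{r\geq1}l_{ij}^{(-r)}u^{r-1}$, $e_{ij}$ matrix units; $L_k^+$ is the copy whose matrix part acts on the $k$-th factor. Let $\mathbf{1}$ be the unit of $A(\overline{R})$ and $L^+_{[n]}(u)=L^+_1(u_1)\cdots L^+_n(u_n)$. $V(\overline{R})$ is the quantum vertex algebra on the $\mathbb{C}[[h]]$-module $A(\overline{R})$ with vacuum $\mathbf{1}$ whose braiding is the $\mathbb{C}[[h]]$-module map $\mathcal{S}(z)\colon V(\overline{R})\otimes V(\overline{R})\to V(\overline{R})\otimes V(\overline{R})\otimes\mathbb{C}((z))[[h]]$ given by $$\mathcal{S}(z)\big(L_{[n]}^{+13}(u)L_{[m]}^{+24}(v)(\mathbf{1}\otimes\mathbf{1})\big)=\overline{R}_{nm}^{\bar1\bar2}(z+u-v)L_{[n]}^{+13}(u)L_{[m]}^{+24}(v)\overline{R}_{nm}^{12}(z+u-v)^{-1}(\mathbf{1}\otimes\mathbf{1}),$$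 where the superscripts $1,2,3,4$ refer to the factors of $(\mathrm{End}\,\mathbb{C}^N)^{\otimes n}\otimes(\mathrm{End}\,\mathbb{C}^N)^{\otimes m}\otimes V(\overline{R})\otimes V(\overline{R})$. $V(R^{\pm})$ is the case $\overline{R}=R^{\pm}$. $\mathrm{tr}_{1,\ldots,n}$ is the trace over the $n$ tensor factors $\mathrm{End}\,\mathbb{C}^N$, and $\mathcal{S}(z)$ is applied coefficientwise in $u,v$. *)

theory Defs
  imports
    "HOL-Library.Poly_Mapping"
    "HOL-Library.Product_Plus"
    "HOL-Library.Set_Algebras"
    "HOL-Library.FuncSet"
    "HOL-Library.Multiset"
    "HOL-Library.Cardinality"
    "HOL-Combinatorics.Transposition"
    "HOL-Computational_Algebra.Formal_Laurent_Series"
begin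

section \<open>Power series in arbitrarily many commuting variables\<close>

text \<open>The variables are indexed by natural numbers, a monomial is the multiset of its variables,
  and the variables commute with the (possibly noncommutative) coefficients.\<close>

typedef 'a mps = "UNIV :: (nat multiset \<Rightarrow> 'a) set"
  morphisms mps_nth Abs_mps by simp

lemma mps_nth_Abs_mps [simp]: "mps_nth (Abs_mps f) e = f e"
  by (simp add: Abs_mps_inverse)

lemma mps_eqI: "(\<And>e. mps_nth f e = mps_nth g e) \<Longrightarrow> f = g"
  by (simp add: mps_nth_inject [symmetric] fun_eq_iff)

lemma finite_submsets [simp]: "finite {A. A \<subseteq># (e :: 'v multiset)}"
proof (induction e)
  case (add x e)
  have "{A. A \<subseteq># add_mset x e} \<subseteq> {A. A \<subseteq># e} \<union> add_mset x ` {A. A \<subseteq># e}"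
  proof
    fix A assume "A \<in> {A. A \<subseteq># add_mset x e}"
    then have A: "A \<subseteq># add_mset x e" by simp
    show "A \<in> {A. A \<subseteq># e} \<union> add_mset x ` {A. A \<subseteq># e}"
    proof (cases "x \<in># A")
      case True
      then obtain B where "A = add_mset x B" by (metis insert_DiffM)
      with A show ?thesis by auto
    next
      case False
      with A have "A \<subseteq># e"
        by (metis count_add_mset count_eq_zero_iff le0 mset_subset_eq_count mset_subset_eqI)
      then show ?thesis by simp
    qed
  qed
  with add show ?case by (meson finite_UnI finite_imageI finite_subset)
qed simp

instantiation mps :: (ring_1) ring_1
begin

definition zero_mps :: "'a mps" where "0 = Abs_mps (\<lambda>_. 0)"
definition one_mps :: "'a mps" where "1 = Abs_mps (\<lambda>e. if e = {#} then 1 else 0)"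
definition plus_mps :: "'a mps \<Rightarrow> 'a mps \<Rightarrow> 'a mps"
  where "f + g = Abs_mps (\<lambda>e. mps_nth f e + mps_nth g e)"
definition minus_mps :: "'a mps \<Rightarrow> 'a mps \<Rightarrow> 'a mps"
  where "f - g = Abs_mps (\<lambda>e. mps_nth f e - mps_nth g e)"
definition uminus_mps :: "'a mps \<Rightarrow> 'a mps"
  where "- f = Abs_mps (\<lambda>e. - mps_nth f e)"
definition times_mps :: "'a mps \<Rightarrow> 'a mps \<Rightarrow> 'a mps"
  where "f * g = Abs_mps (\<lambda>e. \<Sum>A | A \<subseteq># e. mps_nth f A * mps_nth g (e - A))"

instance
proof
  fix f g k :: "'a mps"
  show "f * g * k = f * (g * k)"
  proof (rule mps_eqI)
    fix e
    have "mps_nth (f * g * k) e =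
        (\<Sum>(A, B)\<in>Sigma {A. A \<subseteq># e} (\<lambda>A. {B. B \<subseteq># A}).
          mps_nth f B * mps_nth g (A - B) * mps_nth k (e - A))"
      by (simp add: times_mps_def sum_distrib_right sum.Sigma split_def)
    also have "\<dots> = (\<Sum>(B, C)\<in>Sigma {B. B \<subseteq># e} (\<lambda>B. {C. C \<subseteq># e - B}).
          mps_nth f B * mps_nth g C * mps_nth k (e - B - C))"
    proof (rule sum.reindex_bij_witness
        [where i = "\<lambda>(B, C). (B + C, B)" and j = "\<lambda>(A, B). (B, A - B)"], goal_cases)
      case (1 a) then show ?case by auto
    next
      case (2 a) then show ?case
        by (auto simp: subset_mset.le_diff_conv2 subset_mset.diff_add
            intro: subset_mset.trans)
    next
      case (3 b) then show ?case by auto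
    next
      case (4 b) then show ?case
        by (auto simp: subset_mset.le_diff_conv2 add.commute)
    next
      case (5 a) then show ?case by (auto simp: subset_mset.diff_add)
    qed
    also have "\<dots> = mps_nth (f * (g * k)) e"
      by (simp add: times_mps_def sum_distrib_left sum.Sigma mult.assoc split_def)
    finally show "mps_nth (f * g * k) e = mps_nth (f * (g * k)) e" .
  qed
  show "1 * f = f"
  proof (rule mps_eqI)
    fix e
    have "mps_nth (1 * f) e = (\<Sum>A | A \<subseteq># e. if A = {#} then mps_nth f (e - A) else 0)"
      unfolding times_mps_def one_mps_def mps_nth_Abs_mps by (rule sum.cong) auto
    then show "mps_nth (1 * f) e = mps_nth f e"
      by (simp add: sum.delta')
  qed
  show "f * 1 = f"
  proof (rule mps_eqI)
    fix e
    have "mps_nth (f * 1) e = (\<Sum>A | A \<subseteq># e. if A = e then mps_nth f A else 0)"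
      unfolding times_mps_def one_mps_def mps_nth_Abs_mps
      by (rule sum.cong) (auto simp: Diff_eq_empty_iff_mset subset_mset.antisym)
    then show "mps_nth (f * 1) e = mps_nth f e"
      by (simp add: sum.delta')
  qed
  show "(f + g) * k = f * k + g * k"
    by (rule mps_eqI) (simp add: times_mps_def plus_mps_def distrib_right sum.distrib)
  show "f * (g + k) = f * g + f * k"
    by (rule mps_eqI) (simp add: times_mps_def plus_mps_def distrib_left sum.distrib)
  have "mps_nth (0 :: 'a mps) {#} \<noteq> mps_nth 1 {#}"
    by (simp add: zero_mps_def one_mps_def)
  then show "(0 :: 'a mps) \<noteq> 1" by metis
qed (auto intro!: mps_eqI simp: plus_mps_def zero_mps_def uminus_mps_def minus_mps_def add.assoc
      add.commute)

end

definition mps_const :: "'a::ring_1 \<Rightarrow> 'a mps"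
  where "mps_const c = Abs_mps (\<lambda>e. if e = {#} then c else 0)"

text \<open>The one-variable series $\sum_d f_d\, x_p^d$.\<close>

definition mps_series :: "nat \<Rightarrow> (nat \<Rightarrow> 'a::ring_1) \<Rightarrow> 'a mps"
  where "mps_series p f = Abs_mps (\<lambda>e. if e = replicate_mset (size e) p then f (size e) else 0)"

definition mps_var :: "nat \<Rightarrow> 'a::ring_1 mps"
  where "mps_var p = Abs_mps (\<lambda>e. if e = {#p#} then 1 else 0)"


section \<open>Matrices over tensor powers of \<open>\<complex>\<^sup>N\<close>\<close>

text \<open>The dimension $N$ is \<open>CARD('n)\<close>. An element of
  $(\mathrm{End}\,\mathbb{C}^N)^{\otimes k}\otimes B$ is a matrix over the ring $B$ whose rows and
  columns are indexed by \<open>midx k\<close>, the tensor factors being numbered \<open>1, \<dots>, k\<close>. Only the entries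
  with both indices in \<open>midx k\<close> are meaningful.\<close>

type_synonym ('n, 'b) tmat = "(nat \<Rightarrow> 'n) \<Rightarrow> (nat \<Rightarrow> 'n) \<Rightarrow> 'b"

definition midx :: "nat \<Rightarrow> (nat \<Rightarrow> 'n) set"
  where "midx k = {1..k} \<rightarrow>\<^sub>E UNIV"

definition tone :: "('n, 'b::ring_1) tmat"
  where "tone I J = (if I = J then 1 else 0)"

definition tmul :: "nat \<Rightarrow> ('n, 'b::ring_1) tmat \<Rightarrow> ('n, 'b) tmat \<Rightarrow> ('n, 'b) tmat"
  where "tmul k A B = (\<lambda>I J. \<Sum>K\<in>midx k. A I K * B K J)"

definition tprod :: "nat \<Rightarrow> ('n, 'b::ring_1) tmat list \<Rightarrow> ('n, 'b) tmat"
  where "tprod k As = foldr (tmul k) As tone"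

definition ttrace :: "nat \<Rightarrow> ('n, 'b::ring_1) tmat \<Rightarrow> 'b"
  where "ttrace k A = (\<Sum>I\<in>midx k. A I I)"

definition tinv :: "nat \<Rightarrow> ('n, 'b::ring_1) tmat \<Rightarrow> ('n, 'b) tmat"
  where "tinv k A = (THE B.
    (\<forall>I J. \<not> (I \<in> midx k \<and> J \<in> midx k) \<longrightarrow> B I J = 0) \<and>
    (\<forall>I\<in>midx k. \<forall>J\<in>midx k. tmul k A B I J = tone I J \<and> tmul k B A I J = tone I J))"

text \<open>\<open>tfactor p l\<close> is $\sum_{i,j} 1^{\otimes(p-1)}\otimes e_{ij}\otimes 1^{\otimes(k-p)}\otimes l_{ij}$
  and \<open>tperm i j\<close> is the permutation operator of the factors \<open>i\<close> and \<open>j\<close>.\<close>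

definition tfactor :: "nat \<Rightarrow> ('n \<Rightarrow> 'n \<Rightarrow> 'b::ring_1) \<Rightarrow> ('n, 'b) tmat"
  where "tfactor p l I J = (if \<forall>q. q \<noteq> p \<longrightarrow> I q = J q then l (I p) (J p) else 0)"

definition tperm :: "nat \<Rightarrow> nat \<Rightarrow> ('n, 'b::ring_1) tmat"
  where "tperm i j I J = (if J = I \<circ> transpose i j then 1 else 0)"


section \<open>The rational R-matrix\<close>

text \<open>Negative powers are inverses in the ring of formal series in which the formula is read.
  As inverses are unique, the choice of the ring determines the expansion.\<close>

definition ring_inv :: "'b::ring_1 \<Rightarrow> 'b"
  where "ring_inv x = (THE y. x * y = 1 \<and> y * x = 1)"

lemma ring_inv_eq: "x * y = 1 \<Longrightarrow> y * x = 1 \<Longrightarrow> ring_inv x = y"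
  unfolding ring_inv_def by (rule the_equality) (auto, metis mult.assoc mult_1 mult_1_right)

definition R_mat :: "nat \<Rightarrow> nat \<Rightarrow> 'b \<Rightarrow> 'b \<Rightarrow> ('n, 'b::ring_1) tmat"
  where "R_mat i j h x = (\<lambda>I J. tone I J - tperm i j I J * h * ring_inv x)"

text \<open>\<open>Rbar s\<close> is $R^{+}$ for \<open>s = 1\<close> and $R^{-}$ for \<open>s = -1\<close>.\<close>

definition Rbar :: "int \<Rightarrow> nat \<Rightarrow> nat \<Rightarrow> 'b \<Rightarrow> 'b \<Rightarrow> ('n, 'b::ring_1) tmat"
  where "Rbar s i j h x = (\<lambda>I J. x * ring_inv (x - of_int s * h) * R_mat i j h x I J)"


section \<open>The algebra \<open>A(R)\<close>\<close>

instantiation list :: (type) monoid_add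
begin
definition zero_list :: "'a list" where "0 = []"
definition plus_list :: "'a list \<Rightarrow> 'a list \<Rightarrow> 'a list" where "xs + ys = xs @ ys"
instance by standard (auto simp: zero_list_def plus_list_def)
end

text \<open>The triple \<open>(i, j, d)\<close> stands for $l_{ij}^{(-d-1)}$, the coefficient of $u^d$ in
  $l_{ij}^+(u)$. With words as a monoid, finitely supported functions under convolution form the free
  associative algebra over $\mathbb{C}$; power series in $h$ over it form the $h$-adically completed
  free algebra over $\mathbb{C}[[h]]$. The metric topology on \<^typ>\<open>'a fps\<close> is the $h$-adic one.\<close>

type_synonym 'n word = "('n \<times> 'n \<times> nat) list"
type_synonym 'n free_alg = "'n word \<Rightarrow>\<^sub>0 complex"

definition lgen :: "'n \<Rightarrow> 'n \<Rightarrow> nat \<Rightarrow> 'n free_alg"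
  where "lgen i j d = Poly_Mapping.single [(i, j, d)] 1"

definition two_sided_ideal :: "'a::ring_1 set \<Rightarrow> bool"
  where "two_sided_ideal J \<longleftrightarrow>
    0 \<in> J \<and> (\<forall>x\<in>J. \<forall>y\<in>J. x + y \<in> J) \<and> (\<forall>x\<in>J. \<forall>a b. a * x * b \<in> J)"

text \<open>The smallest ideal containing \<open>X\<close> whose quotient is topologically free: such a quotient is
  separated and complete iff the ideal is closed, and it has no \<open>h\<close>-torsion iff \<open>h x \<in> J\<close> implies
  \<open>x \<in> J\<close>.\<close>

definition top_free_ideal :: "'a::ring_1 fps set \<Rightarrow> 'a fps set"
  where "top_free_ideal X = \<Inter>{J. X \<subseteq> J \<and> two_sided_ideal J \<and> closed J \<and>
    (\<forall>x. fps_X * x \<in> J \<longrightarrow> x \<in> J)}"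

text \<open>The defining relation is read in $F((u))[[v]][[h]]$ with $F$ the free algebra over
  $\mathbb{C}$, so that negative powers of $\pm(u-v)$ and of $\pm(u-v)\mp h$ are expanded in
  nonnegative powers of $v$ and $h$.\<close>

type_synonym 'n rel_ring = "'n free_alg fls fps fps"

definition rel_u :: "'n rel_ring" where "rel_u = fps_const (fps_const fls_X)"
definition rel_v :: "'n rel_ring" where "rel_v = fps_const fps_X"

definition rel_L1 :: "('n, 'n rel_ring) tmat"
  where "rel_L1 = tfactor 1 (\<lambda>i j. fps_const (fps_const (fps_to_fls (Abs_fps (lgen i j)))))"

definition rel_L2 :: "('n, 'n rel_ring) tmat"
  where "rel_L2 = tfactor 2 (\<lambda>i j. fps_const (Abs_fps (\<lambda>d. fls_const (lgen i j d))))"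

definition rel_diff :: "int \<Rightarrow> ('n, 'n rel_ring) tmat"
  where "rel_diff s = (\<lambda>I J.
    tprod 2 [Rbar s 1 2 fps_X (- rel_u + rel_v), rel_L1, rel_L2] I J -
    tprod 2 [rel_L2, rel_L1, Rbar s 1 2 fps_X (rel_u - rel_v)] I J)"

text \<open>The coefficients of $u^a v^b$ in all entries of the relation.\<close>

definition A_rels :: "int \<Rightarrow> 'n free_alg fps set"
  where "A_rels s = {Abs_fps (\<lambda>k. fls_nth (fps_nth (fps_nth (rel_diff s I J) k) b) a) | I J a b.
    I \<in> midx 2 \<and> J \<in> midx 2}"

text \<open>$A(\overline R)$, and hence the $\mathbb{C}[[h]]$-module $V(\overline R)$, is the quotient of
  \<^typ>\<open>'n free_alg fps\<close> by \<open>A_ideal s\<close>.\<close>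

definition A_ideal :: "int \<Rightarrow> 'n free_alg fps set"
  where "A_ideal s = top_free_ideal (A_rels s)"


section \<open>Completed tensor squares\<close>

text \<open>For \<open>'c = complex\<close> this is the completed tensor square of the free algebra; for
  \<open>'c = complex fls\<close> it is its completed tensor product with $\mathbb{C}((z))[[h]]$.\<close>

type_synonym ('n, 'c) free_alg2 = "(('n word \<times> 'n word) \<Rightarrow>\<^sub>0 'c) fps"

definition push_words :: "('w \<Rightarrow> 'x) \<Rightarrow> ('w \<Rightarrow>\<^sub>0 'c::comm_ring_1) \<Rightarrow> ('x \<Rightarrow>\<^sub>0 'c)"
  where "push_words f p =
    (\<Sum>w\<in>Poly_Mapping.keys p. Poly_Mapping.single (f w) (Poly_Mapping.lookup p w))"

definition tensor_left :: "'n free_alg fps \<Rightarrow> ('n, complex) free_alg2"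
  where "tensor_left x = Abs_fps (\<lambda>k. push_words (\<lambda>w. (w, [])) (fps_nth x k))"

definition tensor_right :: "'n free_alg fps \<Rightarrow> ('n, complex) free_alg2"
  where "tensor_right x = Abs_fps (\<lambda>k. push_words (\<lambda>w. ([], w)) (fps_nth x k))"

definition tensor :: "'n free_alg fps \<Rightarrow> 'n free_alg fps \<Rightarrow> ('n, complex) free_alg2"
  where "tensor x y = tensor_left x * tensor_right y"

definition extend_z :: "('n, complex) free_alg2 \<Rightarrow> ('n, complex fls) free_alg2"
  where "extend_z x = Abs_fps (\<lambda>k. Poly_Mapping.map fls_const (fps_nth x k))"

text \<open>The kernels of the projections onto $V\otimes V$ and $V\otimes V\otimes\mathbb{C}((z))[[h]]$.
  For algebras the kernel of a tensor product of projections is generated, as a closed ideal, by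
  $J\otimes 1$ and $1\otimes J$. As these tensor products are again topologically free, the torsion
  condition in \<^const>\<open>top_free_ideal\<close> adds nothing here.\<close>

definition VV_kernel :: "int \<Rightarrow> ('n, complex) free_alg2 set"
  where "VV_kernel s = top_free_ideal (tensor_left ` A_ideal s \<union> tensor_right ` A_ideal s)"

definition VVz_kernel :: "int \<Rightarrow> ('n, complex fls) free_alg2 set"
  where "VVz_kernel s = top_free_ideal (extend_z ` VV_kernel s)"

text \<open>Elements of $V\otimes V$ and of $V\otimes V\otimes\mathbb{C}((z))[[h]]$ as cosets.\<close>

definition VV_class :: "int \<Rightarrow> ('n, complex) free_alg2 \<Rightarrow> ('n, complex) free_alg2 set"
  where "VV_class s x = x +o VV_kernel s"

definition VVz_class :: "int \<Rightarrow> ('n, complex fls) free_alg2 \<Rightarrow> ('n, complex fls) free_alg2 set"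
  where "VVz_class s x = x +o VVz_kernel s"

definition h_scalar :: "complex fps \<Rightarrow> ('n, complex) free_alg2"
  where "h_scalar c = Abs_fps (\<lambda>k. Poly_Mapping.single 0 (fps_nth c k))"

definition VV_module_map ::
    "int \<Rightarrow> (('n, complex) free_alg2 set \<Rightarrow> ('n, complex fls) free_alg2 set) \<Rightarrow> bool"
  where "VV_module_map s S \<longleftrightarrow>
    (\<forall>x. \<exists>y. S (VV_class s x) = VVz_class s y) \<and>
    (\<forall>x y. S (VV_class s (x + y)) = S (VV_class s x) + S (VV_class s y)) \<and>
    (\<forall>c x y. S (VV_class s x) = VVz_class s y \<longrightarrow>
      S (VV_class s (h_scalar c * x)) = VVz_class s (extend_z (h_scalar c) * y))"


section \<open>The braiding\<close>

text \<open>The formula for the braiding is read in power series over \<open>('n, complex fls) free_alg2\<close> in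
  variables numbered like the tensor factors: $u_i$ is variable \<open>i\<close> and $v_j$ is variable \<open>n + j\<close>.\<close>

definition R_factor :: "int \<Rightarrow> nat \<Rightarrow> nat \<Rightarrow> ('n, ('n, complex fls) free_alg2 mps) tmat"
  where "R_factor s i j = Rbar s i j (mps_const fps_X)
    (mps_const (fps_const (Poly_Mapping.single 0 fls_X)) + mps_var i - mps_var j)"

definition R_nm :: "int \<Rightarrow> nat \<Rightarrow> nat \<Rightarrow> ('n, ('n, complex fls) free_alg2 mps) tmat"
  where "R_nm s n m = tprod (n + m)
    [R_factor s i j. i \<leftarrow> [1..<n + 1], j \<leftarrow> rev [n + 1..<n + m + 1]]"

definition R_nm_bar :: "int \<Rightarrow> nat \<Rightarrow> nat \<Rightarrow> ('n, ('n, complex fls) free_alg2 mps) tmat"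
  where "R_nm_bar s n m = tprod (n + m)
    [R_factor s i j. i \<leftarrow> rev [1..<n + 1], j \<leftarrow> [n + 1..<n + m + 1]]"

text \<open>$L_{[n]}^{+13}(u)\,L_{[m]}^{+24}(v)$, over $V\otimes V$ or over
  $V\otimes V\otimes\mathbb{C}((z))[[h]]$.\<close>

definition LL :: "nat \<Rightarrow> nat \<Rightarrow> ('n, ('n, 'c::comm_ring_1) free_alg2 mps) tmat"
  where "LL n m = tprod (n + m)
    (map (\<lambda>p. tfactor p (\<lambda>i j. mps_series p
        (\<lambda>d. fps_const (Poly_Mapping.single ([(i, j, d)], []) 1)))) [1..<n + 1] @
     map (\<lambda>p. tfactor p (\<lambda>i j. mps_series p
        (\<lambda>d. fps_const (Poly_Mapping.single ([], [(i, j, d)]) 1)))) [n + 1..<n + m + 1])"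

text \<open>The coefficients of the entries of \<open>LL n m\<close>, over all \<open>n, m \<ge> 0\<close>, span a dense submodule of
  $V\otimes V$, so there is only one such map.\<close>

definition is_braiding ::
    "int \<Rightarrow> (('n, complex) free_alg2 set \<Rightarrow> ('n, complex fls) free_alg2 set) \<Rightarrow> bool"
  where "is_braiding s S \<longleftrightarrow> VV_module_map s S \<and>
    (\<forall>n m. \<forall>I\<in>midx (n + m). \<forall>J\<in>midx (n + m). \<forall>e.
      S (VV_class s (mps_nth (LL n m I J) e)) =
      VVz_class s (mps_nth
        (tprod (n + m) [R_nm_bar s n m, LL n m, tinv (n + m) (R_nm s n m)] I J) e))"


section \<open>The series \<open>L\<^sub>(\<^sub>n\<^sub>)(u)\<close>\<close>

text \<open>\<open>L_shift c i j\<close> is $l_{ij}^+(u + c h)$ as a power series in $u$; the coefficient of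
  $u^a h^t$ comes from expanding $l_{ij}^{(-d-1)} (u + c h)^d$ with $d = a + t$.\<close>

definition L_shift :: "complex \<Rightarrow> 'n \<Rightarrow> 'n \<Rightarrow> 'n free_alg fps fps"
  where "L_shift c i j = Abs_fps (\<lambda>a. Abs_fps (\<lambda>t.
    Poly_Mapping.single [(i, j, a + t)] (of_nat ((a + t) choose a) * c ^ t)))"

definition L_trace :: "int \<Rightarrow> nat \<Rightarrow> 'n free_alg fps fps"
  where "L_trace s n = ttrace n (tprod n
    (map (\<lambda>p. tfactor p (L_shift (of_int s * of_nat (p - 1)))) [1..<n + 1]))"

end

theory Submission
  imports Defs "HOL-Combinatorics.Permutations" "HOL-Combinatorics.Perm"
begin

text \<open>The parameters of the fused product $L_1^+(u)L_2^+(u\pm h)\cdots L_n^+(u\pm(n-1)h)$ are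
  chosen so that neighbouring ones differ by the value at which the R-matrix degenerates to a
  multiple of $1\pm P$. Clear the denominators of the defining relation and substitute $v=u\pm h$:
  one side vanishes, and after division by $2h^2$, which is possible because the quotient has no
  \<open>h\<close>-torsion, the other side says that two neighbouring factors absorb \<open>P\<close> up to the sign \<open>s\<close>,
  from the left as well as from the right (\<open>fused_exchange\<close>). Modulo the relations, the fused
  product in $V\otimes V$ is therefore symmetric (\<open>s = 1\<close>) or skew-symmetric (\<open>s = -1\<close>) under
  $S_n\times S_m$ on both sides (\<open>LL_fused_symmetric\<close>).

  Let \<open>R\<close> and \<open>R'\<close> be the specializations of the products $\overline R_{nm}^{12}$ and
  $\overline R_{nm}^{\bar1\bar2}$, and let \<open>A\<close> be the sum of the elements of $S_n\times S_m$, with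
  signs if \<open>s = -1\<close>. By cyclicity and the symmetry of the fused product \<open>L\<close>, the trace of
  $R'LR^{-1}$ only depends on $A R^{-1}R'A$. If $R'A=AR$, then also $AR^{-1}=R'^{-1}A$, whence
  $AR^{-1}R'A=R'^{-1}A A R=|S_n\times S_m|\,A$, and the trace is that of \<open>L\<close>
  (\<open>symmetrized_R_quotient\<close>, \<open>tf_eq_ttrace\<close>).

  For $R'A=AR$ it is enough to work in the group algebra of $S_{n+m}$. The Yang--Baxter equation
  at the degenerate value of the parameter shows that $R'A$ absorbs adjacent transpositions from
  the left, so that $R'A$ is proportional to $AR'A$. Inverting permutations is an
  anti-automorphism that exchanges \<open>R\<close> and \<open>R'\<close> and fixes \<open>A\<close>, so that $AR$ is proportional to
  $ARA$ with the same factor. Finally $AR'A=ARA$ since $S_n\times S_m\subset S_{n+m}$ is a Gelfand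
  pair: a permutation and its inverse lie in the same double coset (\<open>young_sym_adjoint\<close>).

  The braiding is prescribed on products with independent variables. The passage to
  $u_i=u\pm(i-1)h$, $v_j=v\pm(j-1)h$ is a ring homomorphism \<open>lin_subst\<close> whose coefficients are
  \<open>h\<close>-adically convergent sums; the braiding commutes with it because a module map into a
  separated module is continuous (\<open>maps_to_lin_subst\<close>).\<close>

abbreviation single :: "'k \<Rightarrow> 'a::zero \<Rightarrow> ('k \<Rightarrow>\<^sub>0 'a)" where "single \<equiv> Poly_Mapping.single"
abbreviation lookup :: "('k \<Rightarrow>\<^sub>0 'a::zero) \<Rightarrow> 'k \<Rightarrow> 'a" where "lookup \<equiv> Poly_Mapping.lookup"
abbreviation keys :: "('k \<Rightarrow>\<^sub>0 'a::zero) \<Rightarrow> 'k set" where "keys \<equiv> Poly_Mapping.keys"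

section \<open>Centres, units and closed ideals\<close>

definition central :: "'a::ring_1 \<Rightarrow> bool"
  where "central x \<longleftrightarrow> (\<forall>y. x * y = y * x)"

lemma centralD: "central x \<Longrightarrow> x * y = y * x"
  by (simp add: central_def)

lemma central_left_commute: "central x \<Longrightarrow> y * (x * z) = x * (y * z)"
  by (metis central_def mult.assoc)

lemma central_0 [simp]: "central 0" and central_1 [simp]: "central 1"
  by (simp_all add: central_def)

lemma central_add [simp]: "central x \<Longrightarrow> central y \<Longrightarrow> central (x + y)"
  and central_diff [simp]: "central x \<Longrightarrow> central y \<Longrightarrow> central (x - y)"
  and central_uminus [simp]: "central x \<Longrightarrow> central (- x)"
  by (simp_all add: central_def algebra_simps)

lemma central_mult [simp]: "central x \<Longrightarrow> central y \<Longrightarrow> central (x * y)"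
  unfolding central_def by (metis mult.assoc)

lemma central_of_nat [simp]: "central (of_nat k)"
  by (simp add: central_def mult_of_nat_commute)

lemma central_of_int [simp]: "central (of_int k)"
  by (simp add: central_def mult_of_int_commute)

lemma central_sum: "(\<And>i. i \<in> I \<Longrightarrow> central (f i)) \<Longrightarrow> central (sum f I)"
  by (simp add: central_def sum_distrib_left sum_distrib_right)

definition unit_el :: "'a::ring_1 \<Rightarrow> bool"
  where "unit_el x \<longleftrightarrow> (\<exists>y. x * y = 1 \<and> y * x = 1)"

lemma unit_elI: "x * y = 1 \<Longrightarrow> y * x = 1 \<Longrightarrow> unit_el x"
  by (auto simp: unit_el_def)

lemma unit_el_ring_inv: "unit_el x \<Longrightarrow> x * ring_inv x = 1" "unit_el x \<Longrightarrow> ring_inv x * x = 1"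
  unfolding unit_el_def by (auto simp: ring_inv_eq)

lemma unit_el_mult: "unit_el x \<Longrightarrow> unit_el y \<Longrightarrow> unit_el (x * y)"
  unfolding unit_el_def by (metis mult.assoc mult_1_left)

lemma unit_el_uminus: "unit_el x \<Longrightarrow> unit_el (- x)"
  unfolding unit_el_def by (metis minus_mult_minus)

lemma central_ring_inv [simp]:
  assumes "central x" "unit_el x"
  shows "central (ring_inv x)"
  unfolding central_def
proof
  fix y
  have "ring_inv x * y = ring_inv x * (y * x) * ring_inv x"
    by (simp add: mult.assoc unit_el_ring_inv assms)
  also have "\<dots> = ring_inv x * x * y * ring_inv x"
    by (metis assms(1) centralD mult.assoc)
  finally show "ring_inv x * y = y * ring_inv x"
    by (simp add: unit_el_ring_inv assms)
qed

lemma central_fps_X [simp]: "central (fps_X :: 'a::ring_1 fps)"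
  by (simp add: central_def fps_mult_fps_X_commute)

lemma central_fps_const [simp]: "central c \<Longrightarrow> central (fps_const c)"
  by (simp add: central_def fps_eq_iff)

lemma two_sided_idealD:
  assumes "two_sided_ideal J"
  shows "0 \<in> J" "x \<in> J \<Longrightarrow> y \<in> J \<Longrightarrow> x + y \<in> J" "x \<in> J \<Longrightarrow> a * x \<in> J" "x \<in> J \<Longrightarrow> x * b \<in> J"
    "x \<in> J \<Longrightarrow> - x \<in> J" "x \<in> J \<Longrightarrow> y \<in> J \<Longrightarrow> x - y \<in> J"
proof -
  have *: "a * x * b \<in> J" if "x \<in> J" for a b x
    using assms that by (auto simp: two_sided_ideal_def)
  show "0 \<in> J" and add: "x \<in> J \<Longrightarrow> y \<in> J \<Longrightarrow> x + y \<in> J" for x y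
    using assms by (auto simp: two_sided_ideal_def)
  show "x \<in> J \<Longrightarrow> a * x \<in> J" using *[of x a 1] by simp
  show "x \<in> J \<Longrightarrow> x * b \<in> J" using *[of x 1 b] by simp
  show minus: "x \<in> J \<Longrightarrow> - x \<in> J" for x using *[of x "-1" 1] by simp
  show "x \<in> J \<Longrightarrow> y \<in> J \<Longrightarrow> x - y \<in> J" using add[of x "- y"] minus[of y] by simp
qed

lemma two_sided_ideal_sum:
  "two_sided_ideal J \<Longrightarrow> (\<And>i. i \<in> I \<Longrightarrow> f i \<in> J) \<Longrightarrow> sum f I \<in> J"
  by (induction I rule: infinite_finite_induct) (auto intro: two_sided_idealD)

text \<open>The ideals with topologically free quotient, as they occur in \<^const>\<open>top_free_ideal\<close>.\<close>

definition closed_ideal :: "'a::ring_1 fps set \<Rightarrow> bool"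
  where "closed_ideal J \<longleftrightarrow>
    two_sided_ideal J \<and> closed J \<and> (\<forall>x. fps_X * x \<in> J \<longrightarrow> x \<in> J)"

lemma closed_ideal_two_sided: "closed_ideal J \<Longrightarrow> two_sided_ideal J"
  by (simp add: closed_ideal_def)

lemma closed_ideal_closed: "closed_ideal J \<Longrightarrow> closed J"
  by (simp add: closed_ideal_def)

lemma closed_ideal_top_free_ideal: "closed_ideal (top_free_ideal X)"
  unfolding closed_ideal_def two_sided_ideal_def top_free_ideal_def
  by (intro conjI closed_Inter) auto

lemma top_free_ideal_superset: "X \<subseteq> top_free_ideal X"
  by (auto simp: top_free_ideal_def)

text \<open>Closedness in the \<open>h\<close>-adic metric says that membership can be tested modulo all powers of
  \<open>h\<close>.\<close>

lemma closed_fps_approx: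
  fixes J :: "'a::ring_1 fps set"
  assumes "closed J"
    and approx: "\<And>K. \<exists>y\<in>J. \<forall>k<K. fps_nth y k = fps_nth x k"
  shows "x \<in> J"
proof (rule ccontr)
  assume "x \<notin> J"
  then have "x \<in> - J" "open (- J)"
    using \<open>closed J\<close> by auto
  then obtain e where e: "e > 0" "\<And>y. dist y x < e \<Longrightarrow> y \<notin> J"
    unfolding open_dist by (metis ComplD)
  obtain K where K: "(1 / 2 :: real) ^ K < e"
    using real_arch_pow_inv[OF e(1), of "1/2"] by auto
  obtain y where y: "y \<in> J" "\<And>k. k < K \<Longrightarrow> fps_nth y k = fps_nth x k"
    using approx by blast
  have "dist y x < e"
  proof (cases "y = x")
    case True
    then show ?thesis using e by simp
  next
    case False
    then have "K \<le> subdegree (y - x)"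
      using y(2) by (intro subdegree_geI) auto
    then have "(1 / 2 :: real) ^ subdegree (y - x) \<le> (1 / 2) ^ K"
      by (intro power_decreasing) auto
    with False K show ?thesis
      by (simp add: dist_fps_def power_one_over inverse_eq_divide)
  qed
  with e y show False by blast
qed


section \<open>Arithmetic of power series in several variables\<close>

lemma mps_nth_0 [simp]: "mps_nth 0 e = 0"
  and mps_nth_1: "mps_nth 1 e = (if e = {#} then 1 else 0)"
  and mps_nth_add [simp]: "mps_nth (f + g) e = mps_nth f e + mps_nth g e"
  and mps_nth_diff [simp]: "mps_nth (f - g) e = mps_nth f e - mps_nth g e"
  and mps_nth_uminus [simp]: "mps_nth (- f) e = - mps_nth f e"
  and mps_nth_mult: "mps_nth (f * g) e = (\<Sum>A | A \<subseteq># e. mps_nth f A * mps_nth g (e - A))"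
  and mps_nth_const: "mps_nth (mps_const c) e = (if e = {#} then c else 0)"
  and mps_nth_var: "mps_nth (mps_var p) e = (if e = {#p#} then 1 else 0)"
  by (simp_all add: zero_mps_def one_mps_def plus_mps_def minus_mps_def uminus_mps_def
      times_mps_def mps_const_def mps_var_def)

lemma mps_nth_sum [simp]: "mps_nth (sum f I) e = (\<Sum>i\<in>I. mps_nth (f i) e)"
  by (induction I rule: infinite_finite_induct) auto

lemma mps_nth_const_mult [simp]: "mps_nth (mps_const c * f) e = c * mps_nth f e"
proof -
  have "mps_nth (mps_const c * f) e =
      (\<Sum>A | A \<subseteq># e. if A = {#} then c * mps_nth f e else 0)"
    unfolding mps_nth_mult by (rule sum.cong) (auto simp: mps_nth_const)
  then show ?thesis by (simp add: sum.delta')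
qed

lemma mps_nth_mult_const [simp]: "mps_nth (f * mps_const c) e = mps_nth f e * c"
proof -
  have "mps_nth (f * mps_const c) e =
      (\<Sum>A | A \<subseteq># e. if A = e then mps_nth f e * c else 0)"
    unfolding mps_nth_mult
    by (rule sum.cong) (auto simp: mps_nth_const Diff_eq_empty_iff_mset subset_mset.antisym)
  then show ?thesis by (simp add: sum.delta')
qed

lemma mps_nth_var_mult:
  "mps_nth (mps_var p * f) e = (if p \<in># e then mps_nth f (e - {#p#}) else 0)"
proof -
  have "mps_nth (mps_var p * f) e =
      (\<Sum>A | A \<subseteq># e. if A = {#p#} then mps_nth f (e - {#p#}) else 0)"
    unfolding mps_nth_mult by (rule sum.cong) (auto simp: mps_nth_var)
  then show ?thesis by (simp add: sum.delta')
qed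

lemma mps_nth_mult_var:
  "mps_nth (f * mps_var p) e = (if p \<in># e then mps_nth f (e - {#p#}) else 0)"
proof -
  have "mps_nth (f * mps_var p) e =
      (\<Sum>A | A \<subseteq># e. if A = e - {#p#} \<and> p \<in># e then mps_nth f (e - {#p#}) else 0)"
    unfolding mps_nth_mult
  proof (rule sum.cong, simp, goal_cases)
    case (1 A)
    then obtain B where e: "e = A + B" by (auto simp: subset_mset.le_iff_add)
    have "B = {#p#}" if "A = A + B - {#p#}" "p \<in># A + B"
      using insert_DiffM2[OF that(2)] that(1) by (metis add_left_imp_eq)
    note B = this
    show ?case
    proof (cases "B = {#p#}")
      case False
      with B have "\<not> (A = e - {#p#} \<and> p \<in># e)" unfolding e by blast
      then show ?thesis
        using False by (simp only: if_False) (simp add: e mps_nth_var)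
    qed (simp add: e mps_nth_var)
  qed
  then show ?thesis by (auto simp: sum.delta')
qed

lemma central_mps_const [simp]: "central c \<Longrightarrow> central (mps_const c)"
  unfolding central_def by (auto intro!: mps_eqI)

lemma central_mps_var [simp]: "central (mps_var p)"
  unfolding central_def by (auto intro!: mps_eqI simp: mps_nth_var_mult mps_nth_mult_var)

lemma mps_const_0 [simp]: "mps_const 0 = 0" and mps_const_1 [simp]: "mps_const 1 = 1"
  and mps_const_add: "mps_const (a + b) = mps_const a + mps_const b"
  and mps_const_uminus: "mps_const (- a) = - mps_const a"
  and mps_const_mult: "mps_const (a * b) = mps_const a * mps_const b"
  by (rule mps_eqI; simp add: mps_nth_const mps_nth_1)+

lemma mps_const_sum: "mps_const (sum f I) = (\<Sum>i\<in>I. mps_const (f i))"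
  by (induction I rule: infinite_finite_induct) (simp_all add: mps_const_add)

lemma mps_const_of_nat: "mps_const (of_nat k) = of_nat k"
  by (induction k) (simp_all add: mps_const_add)

lemma mps_const_of_int: "mps_const (of_int k) = of_int k"
  by (cases k) (simp_all add: mps_const_of_nat mps_const_uminus mps_const_add del: of_nat_Suc)

lemma mps_nth_power_eq_0:
  assumes "mps_nth g {#} = 0" "size e < k"
  shows "mps_nth (g ^ k) e = 0"
  using assms(2)
proof (induction k arbitrary: e)
  case (Suc k)
  have "mps_nth g A * mps_nth (g ^ k) (e - A) = 0" if "A \<subseteq># e" for A
  proof (cases "A = {#}")
    case False
    then have "size (e - A) < k"
      using that Suc.prems size_Diff_submset[OF that] size_mset_mono[OF that]
        nonempty_has_size[of A] by simp
    then show ?thesis using Suc.IH by simp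
  qed (simp add: assms(1))
  then show ?case by (simp add: mps_nth_mult)
qed simp

text \<open>The geometric series inverts \<open>1 - g\<close> when \<open>g\<close> has no constant term.\<close>

lemma unit_el_mps_one_minus:
  assumes "mps_nth g {#} = 0"
  shows "unit_el (1 - g)"
proof -
  define G where "G = Abs_mps (\<lambda>e. \<Sum>k\<le>size e. mps_nth (g ^ k) e)"
  have G: "mps_nth G e = mps_nth (\<Sum>k\<le>D. g ^ k) e" if "size e \<le> D" for e D
    unfolding G_def mps_nth_Abs_mps mps_nth_sum
    by (rule sum.mono_neutral_left) (use that in \<open>auto intro: mps_nth_power_eq_0[OF assms]\<close>)
  have geo: "(1 - g) * (\<Sum>k\<le>D. g ^ k) = 1 - g ^ Suc D"
    "(\<Sum>k\<le>D. g ^ k) * (1 - g) = 1 - g ^ Suc D" for D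
  proof (induction D)
    case (Suc D)
    have "(1 - g) * g ^ Suc D = g ^ Suc D - g ^ Suc (Suc D)"
      "g ^ Suc D * (1 - g) = g ^ Suc D - g ^ Suc (Suc D)"
      by (simp add: left_diff_distrib)
        (simp only: right_diff_distrib mult_1_right power_Suc2[of g "Suc D"])
    then show "(1 - g) * (\<Sum>k\<le>Suc D. g ^ k) = 1 - g ^ Suc (Suc D)"
      "(\<Sum>k\<le>Suc D. g ^ k) * (1 - g) = 1 - g ^ Suc (Suc D)"
      by (simp_all add: distrib_left distrib_right Suc.IH del: power_Suc)
  qed simp_all
  have "mps_nth ((1 - g) * G) e = mps_nth ((1 - g) * (\<Sum>k\<le>size e. g ^ k)) e" for e
    unfolding mps_nth_mult
    by (intro sum.cong refl arg_cong2[of _ _ _ _ "(*)"] G)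
      (auto simp: size_Diff_submset)
  then have "(1 - g) * G = 1"
    by (intro mps_eqI) (simp only: geo, simp add: mps_nth_power_eq_0[OF assms] del: power_Suc)
  moreover have "mps_nth (G * (1 - g)) e = mps_nth ((\<Sum>k\<le>size e. g ^ k) * (1 - g)) e" for e
    unfolding mps_nth_mult
    by (intro sum.cong refl arg_cong2[of _ _ _ _ "(*)"] G)
      (auto simp: size_mset_mono)
  then have "G * (1 - g) = 1"
    by (intro mps_eqI) (simp only: geo, simp add: mps_nth_power_eq_0[OF assms] del: power_Suc)
  ultimately show ?thesis by (rule unit_elI)
qed

lemma unit_el_mps:
  assumes "unit_el (mps_nth f {#})"
  shows "unit_el f"
proof -
  obtain d where d: "mps_nth f {#} * d = 1" "d * mps_nth f {#} = 1"
    using assms by (auto simp: unit_el_def)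
  define g where "g = 1 - mps_const d * f"
  have "unit_el (1 - g)"
    by (rule unit_el_mps_one_minus) (simp add: g_def mps_nth_1 d)
  moreover have "f = mps_const (mps_nth f {#}) * (1 - g)"
    by (rule mps_eqI) (simp add: g_def d mult.assoc[symmetric] mps_const_mult[symmetric])
  moreover have "unit_el (mps_const (mps_nth f {#}))"
    by (rule unit_elI[of _ "mps_const d"]) (simp_all add: d mps_const_mult[symmetric])
  ultimately show ?thesis using unit_el_mult by metis
qed


section \<open>Linear substitutions\<close>

text \<open>The filtration by total degree, the variables and \<open>h\<close> having degree one.\<close>

definition deg_ge :: "nat \<Rightarrow> 'q::ring_1 fps mps set"
  where "deg_ge D = {f. \<forall>e k. size e + k < D \<longrightarrow> fps_nth (mps_nth f e) k = 0}"

lemma deg_ge_0 [simp]: "f \<in> deg_ge 0"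
  and zero_in_deg_ge [simp]: "0 \<in> deg_ge D"
  and deg_ge_add: "f \<in> deg_ge D \<Longrightarrow> g \<in> deg_ge D \<Longrightarrow> f + g \<in> deg_ge D"
  and deg_ge_diff: "f \<in> deg_ge D \<Longrightarrow> g \<in> deg_ge D \<Longrightarrow> f - g \<in> deg_ge D"
  and deg_ge_mono: "f \<in> deg_ge D \<Longrightarrow> D' \<le> D \<Longrightarrow> f \<in> deg_ge D'"
  by (auto simp: deg_ge_def)

lemma deg_ge_sum: "(\<And>i. i \<in> I \<Longrightarrow> f i \<in> deg_ge D) \<Longrightarrow> sum f I \<in> deg_ge D"
  by (induction I rule: infinite_finite_induct) (auto intro: deg_ge_add)

lemma deg_ge_mult:
  assumes "f \<in> deg_ge D" "g \<in> deg_ge D'"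
  shows "f * g \<in> deg_ge (D + D')"
  unfolding deg_ge_def
proof clarify
  fix e :: "nat multiset" and k assume ek: "size e + k < D + D'"
  have "fps_nth (mps_nth f A) i * fps_nth (mps_nth g (e - A)) (k - i) = 0"
    if "A \<subseteq># e" "i \<le> k" for A i
  proof -
    have "size e = size A + size (e - A)"
      using that(1) by (simp add: size_Diff_submset size_mset_mono)
    with ek that(2) have "size A + i < D \<or> size (e - A) + (k - i) < D'" by linarith
    then show ?thesis using assms by (auto simp: deg_ge_def)
  qed
  then show "fps_nth (mps_nth (f * g) e) k = 0"
    by (simp add: mps_nth_mult fps_sum_nth fps_mult_nth)
qed

lemma deg_ge_eqI:
  assumes "\<And>D. f - g \<in> deg_ge D"
  shows "f = g"
proof (rule mps_eqI, rule fps_ext)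
  fix e k
  show "fps_nth (mps_nth f e) k = fps_nth (mps_nth g e) k"
    using assms[of "Suc (size e + k)"] by (auto simp: deg_ge_def)
qed

definition lin_form :: "(nat \<Rightarrow> nat) \<Rightarrow> (nat \<Rightarrow> int) \<Rightarrow> nat \<Rightarrow> 'q::ring_1 fps mps"
  where "lin_form \<tau> c p = mps_var (\<tau> p) + of_int (c p) * mps_const fps_X"

definition lin_monom :: "(nat \<Rightarrow> nat) \<Rightarrow> (nat \<Rightarrow> int) \<Rightarrow> nat multiset \<Rightarrow> 'q::ring_1 fps mps"
  where "lin_monom \<tau> c e = fold_mset (\<lambda>p y. lin_form \<tau> c p * y) 1 e"

definition msets_le :: "nat set \<Rightarrow> nat \<Rightarrow> nat multiset set"
  where "msets_le V D = {e. set_mset e \<subseteq> V \<and> size e \<le> D}"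

definition subst_sum ::
    "nat set \<Rightarrow> (nat \<Rightarrow> nat) \<Rightarrow> (nat \<Rightarrow> int) \<Rightarrow> nat \<Rightarrow> 'q::ring_1 fps mps \<Rightarrow> 'q fps mps"
  where "subst_sum V \<tau> c D f = (\<Sum>e\<in>msets_le V D. mps_const (mps_nth f e) * lin_monom \<tau> c e)"

text \<open>The substitution $x_p \mapsto x_{\tau(p)} + c_p h$ for $p\in V$ and $x_p\mapsto 0$ for
  $p\notin V$. Each \<^const>\<open>lin_form\<close> is homogeneous of degree one in the variables and \<open>h\<close> together, so
  only the monomials of degree at most \<open>size e + k\<close> contribute to the coefficient of $x^e h^k$.\<close>

definition lin_subst ::
    "nat set \<Rightarrow> (nat \<Rightarrow> nat) \<Rightarrow> (nat \<Rightarrow> int) \<Rightarrow> 'q::ring_1 fps mps \<Rightarrow> 'q fps mps"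
  where "lin_subst V \<tau> c f =
    Abs_mps (\<lambda>e. Abs_fps (\<lambda>k. fps_nth (mps_nth (subst_sum V \<tau> c (size e + k) f) e) k))"

lemma central_lin_form [simp]: "central (lin_form \<tau> c p)"
  by (simp add: lin_form_def)

lemma lin_monom_empty [simp]: "lin_monom \<tau> c {#} = 1"
  by (simp add: lin_monom_def)

lemma lin_monom_add_mset:
  "lin_monom \<tau> c (add_mset p e) = lin_form \<tau> c p * lin_monom \<tau> c e"
proof -
  interpret comp_fun_commute "\<lambda>p y. lin_form \<tau> c p * y :: 'a fps mps"
    by unfold_locales (auto simp: fun_eq_iff intro: central_left_commute)
  show ?thesis by (simp add: lin_monom_def)
qed

lemma central_lin_monom [simp]: "central (lin_monom \<tau> c e)"
  by (induction e) (simp_all add: lin_monom_add_mset)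

lemma lin_monom_add: "lin_monom \<tau> c (A + B) = lin_monom \<tau> c A * lin_monom \<tau> c B"
  by (induction A) (simp_all add: lin_monom_add_mset mult.assoc)

lemma lin_form_deg: "lin_form \<tau> c p \<in> deg_ge 1"
  by (auto simp: deg_ge_def lin_form_def mps_nth_var mps_const_of_int[symmetric] mps_nth_const)

lemma lin_monom_deg: "lin_monom \<tau> c e \<in> deg_ge (size e)"
proof (induction e)
  case (add p e)
  then show ?case
    using deg_ge_mult[OF lin_form_deg add.IH, of \<tau> c p] by (simp add: lin_monom_add_mset)
qed simp

lemma finite_msets_le [simp]: "finite V \<Longrightarrow> finite (msets_le V D)"
proof -
  assume V: "finite V"
  have "msets_le V D \<subseteq> mset ` {xs. set xs \<subseteq> V \<and> length xs \<le> D}"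
  proof
    fix e assume "e \<in> msets_le V D"
    moreover obtain xs where "e = mset xs" using ex_mset[of e] by metis
    ultimately show "e \<in> mset ` {xs. set xs \<subseteq> V \<and> length xs \<le> D}"
      by (auto simp: msets_le_def)
  qed
  then show ?thesis
    using finite_lists_length_le[OF V] finite_surj by blast
qed

lemma subst_sum_term_deg: "mps_const a * lin_monom \<tau> c e \<in> deg_ge (size e)"
  using deg_ge_mult[OF deg_ge_0 lin_monom_deg] by simp

lemma subst_sum_diff_deg:
  assumes "finite V" "D' \<ge> D"
  shows "subst_sum V \<tau> c D' f - subst_sum V \<tau> c D f \<in> deg_ge (Suc D)"
proof -
  have "msets_le V D \<subseteq> msets_le V D'"
    using assms(2) by (auto simp: msets_le_def)
  then have "subst_sum V \<tau> c D' f - subst_sum V \<tau> c D f =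
      (\<Sum>e\<in>msets_le V D' - msets_le V D. mps_const (mps_nth f e) * lin_monom \<tau> c e)"
    unfolding subst_sum_def by (simp add: sum_diff assms(1))
  also have "\<dots> \<in> deg_ge (Suc D)"
    by (intro deg_ge_sum deg_ge_mono[OF subst_sum_term_deg]) (auto simp: msets_le_def)
  finally show ?thesis .
qed

text \<open>Up to any given degree the substitution is a finite sum, for which identities can be checked
  in the ring; since the filtration is separated, they then hold for the substitution itself.\<close>

lemma lin_subst_approx:
  assumes "finite V"
  shows "lin_subst V \<tau> c f - subst_sum V \<tau> c D f \<in> deg_ge (Suc D)"
  unfolding deg_ge_def
proof clarify
  fix e :: "nat multiset" and k assume *: "size e + k < Suc D"
  have "fps_nth (mps_nth (subst_sum V \<tau> c D f - subst_sum V \<tau> c (size e + k) f) e) k = 0"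
    using subst_sum_diff_deg[OF assms, of "size e + k" D \<tau> c f] *
    unfolding deg_ge_def by auto
  then show "fps_nth (mps_nth (lin_subst V \<tau> c f - subst_sum V \<tau> c D f) e) k = 0"
    by (simp add: lin_subst_def)
qed

lemma lin_subst_nth:
  assumes "finite V" "k \<le> D"
  shows "fps_nth (mps_nth (lin_subst V \<tau> c f) e) k =
      fps_nth (mps_nth (subst_sum V \<tau> c (size e + D) f) e) k"
  using lin_subst_approx[OF assms(1), of \<tau> c f "size e + D"] assms(2) by (auto simp: deg_ge_def)

lemma subst_sum_add: "subst_sum V \<tau> c D (f + g) = subst_sum V \<tau> c D f + subst_sum V \<tau> c D g"
  by (simp add: subst_sum_def mps_const_add distrib_right sum.distrib)

lemma lin_subst_add: "lin_subst V \<tau> c (f + g) = lin_subst V \<tau> c f + lin_subst V \<tau> c g"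
  by (auto intro!: mps_eqI fps_ext simp: lin_subst_def subst_sum_add)

lemma lin_subst_0 [simp]: "lin_subst V \<tau> c 0 = 0"
  using lin_subst_add[of V \<tau> c 0 0] by simp

lemma lin_subst_uminus: "lin_subst V \<tau> c (- f) = - lin_subst V \<tau> c f"
  using lin_subst_add[of V \<tau> c f "- f"] by (simp add: eq_neg_iff_add_eq_0 add.commute)

lemma lin_subst_diff: "lin_subst V \<tau> c (f - g) = lin_subst V \<tau> c f - lin_subst V \<tau> c g"
  using lin_subst_add[of V \<tau> c f "- g"] by (simp add: lin_subst_uminus)

text \<open>The product of the truncations only has extra terms that belong to pairs of monomials of
  total degree greater than \<open>D\<close>.\<close>

lemma subst_sum_mult_deg:
  fixes f g :: "'q::ring_1 fps mps"
  assumes V: "finite V"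
  shows "subst_sum V \<tau> c D f * subst_sum V \<tau> c D g - subst_sum V \<tau> c D (f * g) \<in> deg_ge (Suc D)"
proof -
  define t :: "nat multiset \<times> nat multiset \<Rightarrow> 'q fps mps" where
    "t = (\<lambda>(A, B). mps_const (mps_nth f A * mps_nth g B) * lin_monom \<tau> c (A + B))"
  define E where "E = msets_le V D \<times> msets_le V D"
  define E' where "E' = {(A, B) \<in> E. size (A + B) \<le> D}"
  have fin: "finite E" by (simp add: E_def V)
  have comm: "lin_monom \<tau> c A * (mps_const b * y) = mps_const b * (lin_monom \<tau> c A * y)"
    for A :: "nat multiset" and b :: "'q fps" and y
    by (metis central_left_commute central_lin_monom)
  have "subst_sum V \<tau> c D f * subst_sum V \<tau> c D g = sum t E"
    unfolding subst_sum_def sum_product sum.cartesian_product E_def t_def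
    by (intro sum.cong refl) (clarsimp simp: mps_const_mult lin_monom_add mult.assoc comm)
  moreover have "subst_sum V \<tau> c D (f * g) =
      (\<Sum>e\<in>msets_le V D. \<Sum>A | A \<subseteq># e. t (A, e - A))"
    unfolding subst_sum_def t_def
    by (intro sum.cong refl) (auto simp: mps_nth_mult mps_const_sum sum_distrib_right)
  moreover have "\<dots> = (\<Sum>(e, A)\<in>Sigma (msets_le V D) (\<lambda>e. {A. A \<subseteq># e}). t (A, e - A))"
    by (simp add: sum.Sigma V)
  moreover have "\<dots> = sum t E'"
    by (rule sum.reindex_bij_witness[where j = "\<lambda>(e, A). (A, e - A)" and i = "\<lambda>(A, B). (A + B, A)"])
      (auto simp: E'_def E_def msets_le_def size_Diff_submset
        size_mset_mono[THEN le_add_diff_inverse]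
        dest: mset_subset_eqD in_diffD intro: order.trans[OF size_mset_mono])
  ultimately have "subst_sum V \<tau> c D f * subst_sum V \<tau> c D g - subst_sum V \<tau> c D (f * g) =
      sum t (E - E')"
    by (subst sum_diff) (auto simp: fin E'_def)
  also have "\<dots> \<in> deg_ge (Suc D)"
    by (intro deg_ge_sum) (auto simp: E'_def t_def intro!: deg_ge_mono[OF subst_sum_term_deg])
  finally show ?thesis .
qed

lemma lin_subst_mult:
  fixes f g :: "'q::ring_1 fps mps"
  assumes V: "finite V"
  shows "lin_subst V \<tau> c (f * g) = lin_subst V \<tau> c f * lin_subst V \<tau> c g"
proof (rule deg_ge_eqI)
  fix D
  let ?L = "lin_subst V \<tau> c" and ?S = "subst_sum V \<tau> c D"
  have "?L (f * g) - ?L f * ?L g = (?L (f * g) - ?S (f * g)) - (?S f * ?S g - ?S (f * g))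
      - (?L f - ?S f) * ?S g - ?L f * (?L g - ?S g)"
    by (simp add: algebra_simps)
  also have "\<dots> \<in> deg_ge (Suc D)"
    using deg_ge_mult[OF lin_subst_approx[OF V] deg_ge_0, of \<tau> c f D "?S g"]
      deg_ge_mult[OF deg_ge_0 lin_subst_approx[OF V], of "?L f" \<tau> c g D]
    by (intro deg_ge_diff lin_subst_approx V subst_sum_mult_deg) simp_all
  finally show "?L (f * g) - ?L f * ?L g \<in> deg_ge D"
    by (rule deg_ge_mono) simp
qed

lemma lin_subst_finite_support:
  assumes V: "finite V" and supp: "\<And>e. e \<notin> E \<Longrightarrow> mps_nth f e = 0"
    and E: "finite E" "\<And>e. e \<in> E \<Longrightarrow> set_mset e \<subseteq> V"
  shows "lin_subst V \<tau> c f = (\<Sum>e\<in>E. mps_const (mps_nth f e) * lin_monom \<tau> c e)"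
proof (rule deg_ge_eqI)
  fix D
  define D' where "D' = max D (Max (insert 0 (size ` E)))"
  have "size e \<le> D'" if "e \<in> E" for e
    using that E(1) by (simp add: D'_def le_max_iff_disj)
  then have "E \<subseteq> msets_le V D'"
    using E by (auto simp: msets_le_def)
  then have "subst_sum V \<tau> c D' f = (\<Sum>e\<in>E. mps_const (mps_nth f e) * lin_monom \<tau> c e)"
    unfolding subst_sum_def by (intro sum.mono_neutral_right) (use V supp in auto)
  with lin_subst_approx[OF V, of \<tau> c f D']
  show "lin_subst V \<tau> c f - (\<Sum>e\<in>E. mps_const (mps_nth f e) * lin_monom \<tau> c e) \<in> deg_ge D"
    by (auto intro: deg_ge_mono simp: D'_def)
qed

lemma lin_subst_const [simp]: "finite V \<Longrightarrow> lin_subst V \<tau> c (mps_const a) = mps_const a"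
  by (subst lin_subst_finite_support[where E = "{{#}}"]) (auto simp: mps_nth_const)

lemma lin_subst_1 [simp]: "finite V \<Longrightarrow> lin_subst V \<tau> c 1 = 1"
  using lin_subst_const[of V \<tau> c 1] by simp

lemma lin_subst_of_int [simp]: "finite V \<Longrightarrow> lin_subst V \<tau> c (of_int k) = of_int k"
  using lin_subst_const[of V \<tau> c "of_int k"] by (simp add: mps_const_of_int)

lemma lin_subst_var: "finite V \<Longrightarrow> p \<in> V \<Longrightarrow> lin_subst V \<tau> c (mps_var p) = lin_form \<tau> c p"
  by (subst lin_subst_finite_support[where E = "{{#p#}}"])
    (auto simp: mps_nth_var lin_monom_add_mset)

text \<open>The coefficients of the substituted series are \<open>h\<close>-adic limits of combinations of those of
  \<open>f\<close>, and the ideal is closed.\<close>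

lemma lin_subst_in_ideal:
  assumes V: "finite V" and J: "closed_ideal J"
    and f: "\<And>e. set_mset e \<subseteq> V \<Longrightarrow> mps_nth f e \<in> J"
  shows "mps_nth (lin_subst V \<tau> c f) e \<in> J"
proof (rule closed_fps_approx)
  show "closed J" using J by (simp add: closed_ideal_def)
  have J: "two_sided_ideal J" using J by (simp add: closed_ideal_def)
  fix K
  have "mps_nth (subst_sum V \<tau> c (size e + K) f) e \<in> J"
    unfolding subst_sum_def mps_nth_sum mps_nth_const_mult
    by (intro two_sided_ideal_sum[OF J] two_sided_idealD(4)[OF J] f) (auto simp: msets_le_def)
  moreover have "fps_nth (mps_nth (subst_sum V \<tau> c (size e + K) f) e) k =
      fps_nth (mps_nth (lin_subst V \<tau> c f) e) k" if "k < K" for k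
    using lin_subst_approx[OF V, of \<tau> c f "size e + K"] that by (auto simp: deg_ge_def)
  ultimately show "\<exists>y\<in>J. \<forall>k<K. fps_nth y k = fps_nth (mps_nth (lin_subst V \<tau> c f) e) k"
    by blast
qed

section \<open>One-variable series and shifts of the argument\<close>

lemma mps_nth_series:
  "mps_nth (mps_series p f) e = (if e = replicate_mset (size e) p then f (size e) else 0)"
  by (simp add: mps_series_def)

lemma mps_nth_series_replicate [simp]: "mps_nth (mps_series p f) (replicate_mset d p) = f d"
  by (simp add: mps_nth_series)

lemma replicate_mset_eq_iff_set_mset: "e = replicate_mset (size e) p \<longleftrightarrow> set_mset e \<subseteq> {p}"
proof
  assume "set_mset e \<subseteq> {p}"
  then show "e = replicate_mset (size e) p"
    by (induction e) auto
qed (metis set_mset_replicate_mset_subset subset_singleton_iff order_refl empty_subsetI)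

lemma mps_series_mult:
  "mps_series p (fps_nth (f * g)) = mps_series p (fps_nth f) * mps_series p (fps_nth g)"
proof (rule mps_eqI)
  fix e :: "nat multiset"
  show "mps_nth (mps_series p (fps_nth (f * g))) e =
      mps_nth (mps_series p (fps_nth f) * mps_series p (fps_nth g)) e"
  proof (cases "set_mset e \<subseteq> {p}")
    case True
    then have e: "e = replicate_mset (size e) p"
      by (simp add: replicate_mset_eq_iff_set_mset)
    have "mps_nth (mps_series p (fps_nth f) * mps_series p (fps_nth g)) e =
        (\<Sum>A | A \<subseteq># e. fps_nth f (size A) * fps_nth g (size e - size A))"
      unfolding mps_nth_mult
    proof (intro sum.cong refl)
      fix A assume "A \<in> {A. A \<subseteq># e}"
      then have A: "A \<subseteq># e" by simp
      then have "set_mset A \<subseteq> {p}" "set_mset (e - A) \<subseteq> {p}"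
        using True by (auto dest: mset_subset_eqD in_diffD)
      then show "mps_nth (mps_series p (fps_nth f)) A * mps_nth (mps_series p (fps_nth g)) (e - A) =
          fps_nth f (size A) * fps_nth g (size e - size A)"
        using A unfolding mps_nth_series replicate_mset_eq_iff_set_mset
        by (simp add: size_Diff_submset)
    qed
    also have "\<dots> = (\<Sum>i=0..size e. fps_nth f i * fps_nth g (size e - i))"
    proof (rule sum.reindex_bij_witness[where i = "\<lambda>i. replicate_mset i p" and j = size])
      fix A assume "A \<in> {A. A \<subseteq># e}"
      then have A: "A \<subseteq># e" by simp
      then have "set_mset A \<subseteq> {p}"
        using True by (auto dest: mset_subset_eqD)
      then show "replicate_mset (size A) p = A"
        using replicate_mset_eq_iff_set_mset by metis
      show "size A \<in> {0..size e}" using A by (simp add: size_mset_mono)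
    next
      fix i assume "i \<in> {0..size e}"
      then show "replicate_mset i p \<in> {A. A \<subseteq># e}"
        by (subst e) (auto intro!: mset_subset_eqI)
    qed auto
    also have "\<dots> = mps_nth (mps_series p (fps_nth (f * g))) e"
      using e by (simp add: mps_nth_series fps_mult_nth)
    finally show ?thesis ..
  next
    case False
    have "mps_nth (mps_series p (fps_nth f)) A * mps_nth (mps_series p (fps_nth g)) (e - A) = 0"
      if "A \<subseteq># e" for A
    proof -
      have "set_mset e \<subseteq> set_mset A \<union> set_mset (e - A)"
        using that by (metis set_mset_union subset_mset.add_diff_inverse order_refl)
      with False have "\<not> set_mset A \<subseteq> {p} \<or> \<not> set_mset (e - A) \<subseteq> {p}" by blast
      then show ?thesis
        unfolding mps_nth_series replicate_mset_eq_iff_set_mset by auto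
    qed
    with False show ?thesis
      by (simp add: mps_nth_mult) (simp add: mps_nth_series replicate_mset_eq_iff_set_mset)
  qed
qed

lemma mps_nth_series_mult_series:
  assumes "p \<noteq> q"
  shows "mps_nth (mps_series p f * mps_series q g) (replicate_mset a p + replicate_mset b q) =
    f a * g b"
proof -
  let ?e = "replicate_mset a p + replicate_mset b q"
  have "mps_nth (mps_series p f) A * mps_nth (mps_series q g) (?e - A) =
      (if A = replicate_mset a p then f a * g b else 0)" if "A \<subseteq># ?e" for A
  proof (cases "A = replicate_mset a p")
    case False
    have "\<not> (set_mset A \<subseteq> {p} \<and> set_mset (?e - A) \<subseteq> {q})"
    proof
      assume *: "set_mset A \<subseteq> {p} \<and> set_mset (?e - A) \<subseteq> {q}"
      have "count ?e p = count A p + count (?e - A) p"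
        using that by (metis count_union subset_mset.add_diff_inverse)
      moreover have "count (?e - A) p = 0"
        using * assms by (auto simp: count_eq_zero_iff simp del: count_diff)
      ultimately have "count A p = a"
        using assms by (simp del: count_diff)
      moreover have "count A x = 0" if "x \<noteq> p" for x
        using * that by (auto simp: count_eq_zero_iff)
      ultimately have "count A x = count (replicate_mset a p) x" for x
        by (cases "x = p") auto
      then have "A = replicate_mset a p" by (rule multiset_eqI)
      with False show False ..
    qed
    then show ?thesis
      using False unfolding mps_nth_series replicate_mset_eq_iff_set_mset by auto
  qed simp
  then have "mps_nth (mps_series p f * mps_series q g) ?e =
      (\<Sum>A | A \<subseteq># ?e. if A = replicate_mset a p then f a * g b else 0)"
    unfolding mps_nth_mult by (intro sum.cong) auto
  then show ?thesis by (simp add: sum.delta')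
qed

text \<open>The binomial expansion of $(x_{\tau(p)} + c_p h)^d$.\<close>

lemma lin_monom_replicate_mset:
  "fps_nth (mps_nth (lin_monom \<tau> c (replicate_mset d p)) e) t =
    (if e = replicate_mset (size e) (\<tau> p) \<and> size e + t = d
     then of_nat (d choose size e) * of_int (c p) ^ t else 0)"
proof (induction d arbitrary: e t)
  case 0
  then show ?case by (auto simp: mps_nth_1)
next
  case (Suc d)
  have *: "fps_nth (mps_nth (lin_monom \<tau> c (replicate_mset (Suc d) p)) e) t =
      (if \<tau> p \<in># e then fps_nth (mps_nth (lin_monom \<tau> c (replicate_mset d p)) (e - {#\<tau> p#})) t
          else 0)
      + (if t = 0 then 0 else of_int (c p) *
        fps_nth (mps_nth (lin_monom \<tau> c (replicate_mset d p)) e) (t - 1))"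
    by (simp add: lin_monom_add_mset lin_form_def distrib_right mps_nth_var_mult
        mps_const_of_int[symmetric] mult.assoc fps_of_int[symmetric])
  show ?case
  proof (cases "set_mset e \<subseteq> {\<tau> p}")
    case False
    then have "\<not> set_mset (e - {#\<tau> p#}) \<subseteq> {\<tau> p}"
      by (metis insert_Diff_single insert_subset set_mset_add_mset_insert insert_DiffM
          diff_single_trivial insertI1)
    with False show ?thesis
      unfolding * Suc.IH unfolding replicate_mset_eq_iff_set_mset by simp
  next
    case True
    define a where "a = size e"
    have e: "e = replicate_mset a (\<tau> p)"
      unfolding a_def using True by (simp add: replicate_mset_eq_iff_set_mset)
    show ?thesis
    proof (cases a)
      case 0
      then show ?thesis unfolding * Suc.IH unfolding e by (cases t) auto
    next
      case (Suc a')
      have c: "of_int (c p) * (of_nat k * of_int (c p) ^ j) =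
          (of_nat k * (of_int (c p) * of_int (c p) ^ j) :: 'a)" for k j
        by (metis mult.assoc mult_of_nat_commute)
      show ?thesis
        unfolding * Suc.IH unfolding e Suc
        by (cases t) (auto simp: distrib_right c)
    qed
  qed
qed

lemma lin_subst_series:
  assumes V: "finite V" "p \<in> V"
  shows "lin_subst V \<tau> c (mps_series p (\<lambda>d. fps_const (g d))) =
    mps_series (\<tau> p) (\<lambda>a. Abs_fps (\<lambda>t. of_nat ((a + t) choose a) * of_int (c p) ^ t * g (a + t)))"
proof (rule mps_eqI, rule fps_ext)
  fix e :: "nat multiset" and t
  let ?D = "size e + t" and ?f = "mps_series p (\<lambda>d. fps_const (g d))"
  let ?r = "replicate_mset ?D p"
  have r: "?r \<in> msets_le V ?D" using V by (auto simp: msets_le_def)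
  let ?h = "\<lambda>e'. fps_nth (mps_nth (mps_const (mps_nth ?f e') * lin_monom \<tau> c e') e) t"
  have "fps_nth (mps_nth (lin_subst V \<tau> c ?f) e) t = (\<Sum>e'\<in>msets_le V ?D. ?h e')"
    by (simp add: lin_subst_def subst_sum_def fps_sum_nth)
  also have "\<dots> = (\<Sum>e'\<in>{?r}. ?h e')"
  proof (rule sum.mono_neutral_right)
    show "\<forall>e'\<in>msets_le V ?D - {?r}. ?h e' = 0"
    proof
      fix e' assume e': "e' \<in> msets_le V ?D - {?r}"
      show "?h e' = 0"
      proof (cases "e' = replicate_mset (size e') p")
        case True
        define d where "d = size e'"
        have d: "e' = replicate_mset d p" "d \<noteq> ?D" using True e' by (auto simp: d_def)
        show ?thesis unfolding d(1) using d(2) by (simp add: lin_monom_replicate_mset)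
      next
        case False
        then have "mps_nth ?f e' = 0" unfolding mps_nth_series by (rule if_not_P)
        then show ?thesis by simp
      qed
    qed
  qed (use r V in auto)
  also have "\<dots> = g ?D * (if e = replicate_mset (size e) (\<tau> p)
      then of_nat (?D choose size e) * of_int (c p) ^ t else 0)"
    by (simp add: lin_monom_replicate_mset)
  also have "\<dots> = fps_nth (mps_nth (mps_series (\<tau> p) (\<lambda>a. Abs_fps (\<lambda>t.
      of_nat ((a + t) choose a) * of_int (c p) ^ t * g (a + t)))) e) t"
  proof -
    have "central (of_nat (?D choose size e) * of_int (c p) ^ t :: 'a)"
      by (metis central_mult central_of_int central_of_nat of_int_power)
    then show ?thesis by (simp add: mps_nth_series centralD)
  qed
  finally show "fps_nth (mps_nth (lin_subst V \<tau> c ?f) e) t = \<dots>" .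
qed


section \<open>Matrices over tensor powers\<close>

lemma finite_midx [simp]: "finite (midx k :: (nat \<Rightarrow> 'n::finite) set)"
  by (auto simp: midx_def intro: finite_PiE)

lemma midx_upd: "I \<in> midx k \<Longrightarrow> p \<in> {1..k} \<Longrightarrow> I(p := x) \<in> midx k"
  by (auto simp: midx_def PiE_iff extensional_def)

lemma midx_comp: "I \<in> midx k \<Longrightarrow> f permutes {1..k} \<Longrightarrow> I \<circ> f \<in> midx k"
  by (auto simp: midx_def PiE_iff extensional_def permutes_def)

lemma tmul_tone_right: "J \<in> midx k \<Longrightarrow> tmul k A tone I J = A I (J :: nat \<Rightarrow> 'n::finite)"
  by (simp add: tmul_def tone_def if_distrib sum.delta cong: if_cong)

lemma tmul_tone_left: "I \<in> midx k \<Longrightarrow> tmul k tone A I J = A (I :: nat \<Rightarrow> 'n::finite) J"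
proof -
  assume "I \<in> midx k"
  moreover have "tmul k tone A I J = (\<Sum>K\<in>midx k. if K = I then A I J else 0)"
    unfolding tmul_def by (intro sum.cong) (auto simp: tone_def)
  ultimately show ?thesis by simp
qed

lemma tmul_assoc: "tmul k (tmul k A B) C = tmul k A (tmul k B (C :: ('n::finite, 'b::ring_1) tmat))"
  unfolding tmul_def
  by (intro ext) (simp add: sum_distrib_left sum_distrib_right mult.assoc, rule sum.swap)

lemma tmul_cong_left:
  "(\<And>K. K \<in> midx k \<Longrightarrow> A I K = A' I K) \<Longrightarrow> tmul k A B I J = tmul k A' B I J"
  by (simp add: tmul_def)

lemma tmul_cong_right:
  "(\<And>K. K \<in> midx k \<Longrightarrow> B K J = B' K J) \<Longrightarrow> tmul k A B I J = tmul k A B' I J"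
  by (simp add: tmul_def)

lemma tprod_append:
  assumes "I \<in> midx k"
  shows "tprod k (As @ Bs) I J = tmul k (tprod k As) (tprod k Bs) (I :: nat \<Rightarrow> 'n::finite) J"
  using assms
proof (induction As arbitrary: I)
  case Nil
  then show ?case by (simp add: tprod_def tmul_tone_left)
next
  case (Cons A As)
  have "tprod k ((A # As) @ Bs) I J = tmul k A (tmul k (tprod k As) (tprod k Bs)) I J"
    using Cons.IH by (auto simp: tprod_def intro: tmul_cong_right)
  then show ?case by (simp add: tmul_assoc[symmetric]) (simp add: tprod_def)
qed

lemma tprod_singleton: "J \<in> midx k \<Longrightarrow> tprod k [A] I J = A I (J :: nat \<Rightarrow> 'n::finite)"
  by (simp add: tprod_def tmul_tone_right)

lemma tprod_tfactors:
  fixes l :: "nat \<Rightarrow> 'n::finite \<Rightarrow> 'n \<Rightarrow> 'b::ring_1"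
  assumes "distinct ps" "set ps \<subseteq> {1..k}" "I \<in> midx k" "J \<in> midx k"
  shows "tprod k (map (\<lambda>p. tfactor p (l p)) ps) I J =
    (if \<forall>q. q \<notin> set ps \<longrightarrow> I q = J q then prod_list (map (\<lambda>p. l p (I p) (J p)) ps) else 0)"
  using assms
proof (induction ps arbitrary: I)
  case Nil
  then show ?case by (auto simp: tprod_def tone_def)
next
  case (Cons p ps)
  let ?K = "I(p := J p)" and ?T = "tprod k (map (\<lambda>p. tfactor p (l p)) ps)"
  have K: "?K \<in> midx k" using Cons.prems by (auto intro: midx_upd)
  have "tprod k (map (\<lambda>p. tfactor p (l p)) (p # ps)) I J =
      (\<Sum>K\<in>midx k. tfactor p (l p) I K * ?T K J)"
    by (simp add: tprod_def tmul_def)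
  also have "\<dots> = (\<Sum>K\<in>{?K}. tfactor p (l p) I K * ?T K J)"
  proof (rule sum.mono_neutral_right)
    show "\<forall>K\<in>midx k - {?K}. tfactor p (l p) I K * ?T K J = 0"
    proof
      fix K assume K: "K \<in> midx k - {?K}"
      show "tfactor p (l p) I K * ?T K J = 0"
      proof (cases "\<forall>q. q \<noteq> p \<longrightarrow> I q = K q")
        case True
        with K have "K p \<noteq> J p" by (auto simp: fun_eq_iff split: if_splits)
        then have "?T K J = 0" using Cons.IH[of K] Cons.prems K by auto
        then show ?thesis by simp
      next
        case False
        then have "tfactor p (l p) I K = 0" unfolding tfactor_def by (rule if_not_P)
        then show ?thesis by simp
      qed
    qed
  qed (use K in auto)
  also have "\<dots> = l p (I p) (J p) * ?T ?K J" by (simp add: tfactor_def)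
  also have "?T ?K J = (if \<forall>q. q \<notin> set (p # ps) \<longrightarrow> I q = J q
      then prod_list (map (\<lambda>p. l p (I p) (J p)) ps) else 0)"
  proof -
    have "map (\<lambda>q. l q (?K q) (J q)) ps = map (\<lambda>p. l p (I p) (J p)) ps"
      using Cons.prems by (intro map_cong) auto
    moreover have "(\<forall>q. q \<notin> set ps \<longrightarrow> ?K q = J q) \<longleftrightarrow> (\<forall>q. q \<notin> set (p # ps) \<longrightarrow> I q = J q)"
      by auto
    moreover have "?T ?K J = (if \<forall>q. q \<notin> set ps \<longrightarrow> ?K q = J q
        then prod_list (map (\<lambda>q. l q (?K q) (J q)) ps) else 0)"
      using Cons.prems by (intro Cons.IH K) auto
    ultimately show ?thesis by (simp only:)
  qed
  finally show ?case by auto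
qed

lemma tmul_Rbar_left:
  fixes Y :: "('n::finite, 'b::ring_1) tmat"
  assumes "I \<in> midx k" "i \<in> {1..k}" "j \<in> {1..k}"
  shows "tmul k (Rbar s i j h x) Y I J =
    x * ring_inv (x - of_int s * h) * (Y I J - h * ring_inv x * Y (I \<circ> transpose i j) J)"
proof -
  let ?a = "x * ring_inv (x - of_int s * h)" and ?I' = "I \<circ> transpose i j"
  have I': "?I' \<in> midx k"
    using assms by (intro midx_comp permutes_swap_id) auto
  have "tmul k (Rbar s i j h x) Y I J =
      (\<Sum>K\<in>midx k. ?a * ((if K = I then Y I J else 0) -
        (if K = ?I' then h * ring_inv x * Y ?I' J else 0)))"
    unfolding tmul_def Rbar_def R_mat_def
    by (intro sum.cong refl) (auto simp: tone_def tperm_def algebra_simps)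
  also have "\<dots> = ?a * (Y I J - h * ring_inv x * Y ?I' J)"
    using assms(1) I' by (simp add: sum_distrib_left[symmetric] sum_subtractf sum.delta)
  finally show ?thesis .
qed

lemma tmul_Rbar_right:
  fixes Y :: "('n::finite, 'b::ring_1) tmat"
  assumes "J \<in> midx k" "i \<in> {1..k}" "j \<in> {1..k}"
    and c: "central x" "central h" "unit_el x" "unit_el (x - of_int s * h)"
  shows "tmul k Y (Rbar s i j h x) I J =
    x * ring_inv (x - of_int s * h) * (Y I J - h * ring_inv x * Y I (J \<circ> transpose i j))"
proof -
  let ?a = "x * ring_inv (x - of_int s * h)"
  define J' where "J' = J \<circ> transpose i j"
  have J': "J' \<in> midx k"
    unfolding J'_def using assms by (intro midx_comp permutes_swap_id) auto
  have ca: "central ?a" "central (h * ring_inv x)" using c by auto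
  have invol: "(K \<circ> transpose i j) \<circ> transpose i j = K" for K :: "nat \<Rightarrow> 'n"
    by (simp add: comp_assoc)
  have eq: "J = K \<circ> transpose i j \<longleftrightarrow> K = J'" for K :: "nat \<Rightarrow> 'n"
  proof
    assume "J = K \<circ> transpose i j"
    then show "K = J'" using invol[of K] by (simp only: J'_def)
  next
    assume "K = J'"
    then show "J = K \<circ> transpose i j" using invol[of J] by (simp only: J'_def)
  qed
  have "tmul k Y (Rbar s i j h x) I J =
      (\<Sum>K\<in>midx k. ?a * ((if K = J then Y I J else 0) -
        (if K = J' then h * ring_inv x * Y I J' else 0)))"
    unfolding tmul_def Rbar_def R_mat_def
  proof (intro sum.cong refl)
    fix K
    have "Y I K * (?a * (tone K J - tperm i j K J * h * ring_inv x)) =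
        ?a * (Y I K * (tone K J - tperm i j K J * h * ring_inv x))"
      by (metis ca(1) central_left_commute)
    also have "Y I K * (tone K J - tperm i j K J * h * ring_inv x) =
        (if K = J then Y I J else 0) - (if K = J' then h * ring_inv x * Y I J' else 0)"
      using centralD[OF ca(2), of "Y I K"]
      by (auto simp: tone_def tperm_def eq right_diff_distrib mult.assoc)
    finally show "Y I K * (?a * (tone K J - tperm i j K J * h * ring_inv x)) =
        ?a * ((if K = J then Y I J else 0) - (if K = J' then h * ring_inv x * Y I J' else 0))" .
  qed
  also have "\<dots> = ?a * (Y I J - h * ring_inv x * Y I J')"
    using assms(1) J' by (simp add: sum_distrib_left[symmetric] sum_subtractf sum.delta)
  finally show ?thesis unfolding J'_def .
qed

section \<open>The fused exchange relation\<close>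

text \<open>The relation lives in $F((u))[[v]][[h]]$, where $v=u\pm h$ cannot be substituted. Without
  its denominators it is a power series in \<open>u\<close> and \<open>v\<close>. The notions below transfer it to
  \<^typ>\<open>'a mps\<close>, with \<open>u\<close> and \<open>v\<close> as the variables \<open>1\<close> and \<open>2\<close>, by comparing coefficients.\<close>

definition rel_coeff :: "'n rel_ring \<Rightarrow> int \<Rightarrow> nat \<Rightarrow> 'n free_alg fps"
  where "rel_coeff X a b = Abs_fps (\<lambda>k. fls_nth (fps_nth (fps_nth X k) b) a)"

definition uv_coeff :: "'n free_alg fps mps \<Rightarrow> int \<Rightarrow> nat \<Rightarrow> 'n free_alg fps"
  where "uv_coeff f a b =
    (if a < 0 then 0 else mps_nth f (replicate_mset (nat a) 1 + replicate_mset b 2))"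

definition same_coeffs :: "'n rel_ring \<Rightarrow> 'n free_alg fps mps \<Rightarrow> bool"
  where "same_coeffs X f \<longleftrightarrow> (\<forall>a b. rel_coeff X a b = uv_coeff f a b)"

lemma rel_coeff_diff: "rel_coeff (X - Y) a b = rel_coeff X a b - rel_coeff Y a b"
  and rel_coeff_u: "rel_coeff (rel_u * X) a b = rel_coeff X (a - 1) b"
  and rel_coeff_v: "rel_coeff (rel_v * X) a b = (if b = 0 then 0 else rel_coeff X a (b - 1))"
  and rel_coeff_h: "rel_coeff (fps_X * X) a b = fps_X * rel_coeff X a b"
  by (auto simp: rel_coeff_def rel_u_def rel_v_def fls_X_times_conv_shift fps_eq_iff)

lemma uv_coeff_diff: "uv_coeff (f - g) a b = uv_coeff f a b - uv_coeff g a b"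
  by (simp add: uv_coeff_def)

lemma uv_coeff_u: "uv_coeff (mps_var 1 * f) a b = uv_coeff f (a - 1) b"
proof (cases "a > 0")
  case True
  then have "nat a = Suc (nat (a - 1))" by simp
  then show ?thesis using True by (simp add: uv_coeff_def mps_nth_var_mult)
qed (auto simp: uv_coeff_def mps_nth_var_mult)

lemma uv_coeff_v: "uv_coeff (mps_var 2 * f) a b = (if b = 0 then 0 else uv_coeff f a (b - 1))"
  by (cases b) (auto simp: uv_coeff_def mps_nth_var_mult)

lemma uv_coeff_h: "uv_coeff (mps_const fps_X * f) a b = fps_X * uv_coeff f a b"
  by (simp add: uv_coeff_def)

lemma same_coeffs_diff: "same_coeffs X f \<Longrightarrow> same_coeffs Y g \<Longrightarrow> same_coeffs (X - Y) (f - g)"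
  and same_coeffs_u: "same_coeffs X f \<Longrightarrow> same_coeffs (rel_u * X) (mps_var 1 * f)"
  and same_coeffs_v: "same_coeffs X f \<Longrightarrow> same_coeffs (rel_v * X) (mps_var 2 * f)"
  and same_coeffs_h: "same_coeffs X f \<Longrightarrow> same_coeffs (fps_X * X) (mps_const fps_X * f)"
  by (simp_all add: same_coeffs_def rel_coeff_diff uv_coeff_diff rel_coeff_u uv_coeff_u
      rel_coeff_v uv_coeff_v rel_coeff_h uv_coeff_h del: One_nat_def)

lemma same_coeffs_uminus: "same_coeffs X f \<Longrightarrow> same_coeffs (- X) (- f)"
proof -
  have "same_coeffs 0 0"
    by (simp add: same_coeffs_def rel_coeff_def uv_coeff_def fps_eq_iff)
  then show "same_coeffs X f \<Longrightarrow> same_coeffs (- X) (- f)"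
    using same_coeffs_diff[of 0 0 X f] by simp
qed

definition gen_u :: "'n \<Rightarrow> 'n \<Rightarrow> 'n rel_ring"
  where "gen_u i j = fps_const (fps_const (fps_to_fls (Abs_fps (lgen i j))))"

definition gen_v :: "'n \<Rightarrow> 'n \<Rightarrow> 'n rel_ring"
  where "gen_v i j = fps_const (Abs_fps (\<lambda>d. fls_const (lgen i j d)))"

definition gen_series :: "nat \<Rightarrow> 'n \<Rightarrow> 'n \<Rightarrow> 'n free_alg fps mps"
  where "gen_series p i j = mps_series p (\<lambda>d. fps_const (lgen i j d))"

lemma same_coeffs_gen:
  "same_coeffs (gen_u i j * gen_v i' j') (gen_series 1 i j * gen_series 2 i' j')"
  "same_coeffs (gen_v i' j' * gen_u i j) (gen_series 2 i' j' * gen_series 1 i j)"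
proof -
  have 1: "fls_nth (fps_nth (fps_nth (gen_u i j * gen_v i' j') k) b) a =
      (if k = 0 \<and> a \<ge> 0 then lgen i j (nat a) * lgen i' j' b else 0)"
    "fls_nth (fps_nth (fps_nth (gen_v i' j' * gen_u i j) k) b) a =
      (if k = 0 \<and> a \<ge> 0 then lgen i' j' b * lgen i j (nat a) else 0)" for k b a
    by (auto simp: gen_u_def gen_v_def)
  have 2: "mps_nth (gen_series 1 i j * gen_series 2 i' j') (replicate_mset a 1 +
      replicate_mset b 2) =
      fps_const (lgen i j a) * fps_const (lgen i' j' b)" for a b
    unfolding gen_series_def by (rule mps_nth_series_mult_series) simp
  have 3: "mps_nth (gen_series 2 i' j' * gen_series 1 i j) (replicate_mset a 1 +
      replicate_mset b 2) =
      fps_const (lgen i' j' b) * fps_const (lgen i j a)" for a b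
    unfolding gen_series_def add.commute[of "replicate_mset a 1"]
    by (rule mps_nth_series_mult_series) simp
  show "same_coeffs (gen_u i j * gen_v i' j') (gen_series 1 i j * gen_series 2 i' j')"
    "same_coeffs (gen_v i' j' * gen_u i j) (gen_series 2 i' j' * gen_series 1 i j)"
    unfolding same_coeffs_def rel_coeff_def uv_coeff_def 2 3
    by (auto simp: fps_eq_iff 1)
qed

lemma central_rel [simp]: "central rel_u" "central rel_v"
proof -
  have "central (fls_X :: 'a free_alg fls)"
    by (simp add: central_def fls_X_times_comm)
  then show "central (rel_u :: 'a rel_ring)" by (simp add: rel_u_def)
qed (simp add: rel_v_def)

text \<open>In a noncommutative ring the left and the right inverse series are different constructions;
  they agree because both exist.\<close>

lemma unit_el_fps:
  fixes f :: "'a::ring_1 fps"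
  assumes "unit_el (fps_nth f 0)"
  shows "unit_el f"
proof -
  obtain y where y: "fps_nth f 0 * y = 1" "y * fps_nth f 0 = 1"
    using assms by (auto simp: unit_el_def)
  let ?l = "fps_left_inverse f y" and ?r = "fps_right_inverse f y"
  have l: "?l * f = 1" using y(2) by (rule fps_left_inverse)
  have r: "f * ?r = 1" using y(1) by (rule fps_right_inverse)
  have "?l = ?l * (f * ?r)" by (simp only: r mult_1_right)
  also have "\<dots> = ?r" by (simp only: mult.assoc[symmetric] l mult_1_left)
  finally show ?thesis using l r unit_elI by metis
qed

lemma unit_el_rel_diff: "unit_el (rel_u - rel_v + of_int k * fps_X :: 'n rel_ring)"
proof -
  have "unit_el (fls_X :: 'n free_alg fls)"
    by (rule unit_elI[of _ fls_X_inv])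
      (simp_all add: fls_X_times_conv_shift fls_X_inv_times_conv_shift)
  then have "unit_el (fps_const fls_X - fps_X :: 'n free_alg fls fps)"
    by (intro unit_el_fps) simp
  then show ?thesis
    by (rule_tac unit_el_fps) (simp add: rel_u_def rel_v_def fps_of_int[symmetric])
qed


lemma clear_denominator:
  fixes x h :: "'b::ring_1"
  assumes x: "central x" "unit_el x" and d: "central d" "unit_el d" and h: "central h"
  shows "d * (x * ring_inv d * (M - h * ring_inv x * M')) = x * M - h * M'"
proof -
  have "d * (x * ring_inv d * N) = x * N" for N
    by (metis centralD d(1) mult.assoc mult_1_left unit_el_ring_inv(1)[OF d(2)])
  moreover have "x * (h * ring_inv x * M') = h * M'"
    by (metis centralD h mult.assoc mult_1_left unit_el_ring_inv(1)[OF x(2)])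
  ultimately show ?thesis by (simp add: right_diff_distrib)
qed

lemma transpose_12 [simp]: "transpose 1 2 (1::nat) = 2" "transpose 1 2 (2::nat) = 1"
  "transpose (Suc 0) 2 (Suc 0) = 2" "transpose (Suc 0) 2 2 = Suc 0"
  by (simp_all add: transpose_def)

text \<open>With $x=v-u$ and $y=u-v$, the denominators of the two sides are $x-sh$ and $y-sh$; the other
  inverses are those of \<open>x\<close> and \<open>y\<close> in the R-matrices, which the numerators of the scalar factors
  cancel.\<close>

lemma rel_diff_cleared:
  fixes I J :: "nat \<Rightarrow> 'n::finite"
  assumes I: "I \<in> midx 2" and J: "J \<in> midx 2"
  shows "(- rel_u + rel_v - of_int s * fps_X) * (rel_u - rel_v - of_int s * fps_X) * rel_diff s I
      J =
    (rel_u - rel_v - of_int s * fps_X) *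
      ((- rel_u + rel_v) * (gen_u (I 1) (J 1) * gen_v (I 2) (J 2)) -
        fps_X * (gen_u (I 2) (J 1) * gen_v (I 1) (J 2))) -
    (- rel_u + rel_v - of_int s * fps_X) *
      ((rel_u - rel_v) * (gen_v (I 2) (J 2) * gen_u (I 1) (J 1)) -
        fps_X * (gen_v (I 2) (J 1) * gen_u (I 1) (J 2)))"
proof -
  let ?x = "- rel_u + rel_v :: 'n rel_ring" and ?y = "rel_u - rel_v :: 'n rel_ring"
  let ?h = "fps_X :: 'n rel_ring"
  let ?d = "?x - of_int s * ?h" and ?d' = "?y - of_int s * ?h"
  let ?t = "transpose 1 2 :: nat \<Rightarrow> nat"
  have units: "unit_el ?y" "unit_el ?d'"
    using unit_el_rel_diff[of 0] unit_el_rel_diff[of "- s"] by simp_all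
  have units': "unit_el ?x" "unit_el ?d"
    using unit_el_uminus[OF units(1)] unit_el_uminus[OF unit_el_rel_diff[of s]]
    by (simp_all add: algebra_simps)
  have L: "rel_L1 = tfactor 1 gen_u" "rel_L2 = tfactor 2 gen_v"
    by (simp_all add: rel_L1_def rel_L2_def gen_u_def[abs_def] gen_v_def[abs_def])
  define l where "l = (\<lambda>p :: nat. if p = 1 then gen_u else (gen_v :: 'n \<Rightarrow> 'n \<Rightarrow> 'n rel_ring))"
  have LL: "tprod 2 [rel_L1, rel_L2] I' J' = gen_u (I' 1) (J' 1) * gen_v (I' 2) (J' 2)"
    "tprod 2 [rel_L2, rel_L1] I' J' = gen_v (I' 2) (J' 2) * gen_u (I' 1) (J' 1)"
    if "I' \<in> midx 2" "J' \<in> midx 2" for I' J' :: "nat \<Rightarrow> 'n"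
  proof -
    have "I' q = J' q" if "q \<notin> {1, 2}" for q
    proof -
      have "q \<notin> {1..2}" using that by auto
      then show ?thesis
        using \<open>I' \<in> midx 2\<close> \<open>J' \<in> midx 2\<close> by (auto simp: midx_def PiE_def extensional_def)
    qed
    then show "tprod 2 [rel_L1, rel_L2] I' J' = gen_u (I' 1) (J' 1) * gen_v (I' 2) (J' 2)"
      "tprod 2 [rel_L2, rel_L1] I' J' = gen_v (I' 2) (J' 2) * gen_u (I' 1) (J' 1)"
      using tprod_tfactors[of "[1, 2]" 2 I' J' l] tprod_tfactors[of "[2, 1]" 2 I' J' l] that
      by (auto simp: l_def L)
  qed
  have t: "?t permutes {1..2}" by (rule permutes_swap_id) auto
  have "tprod 2 [Rbar s 1 2 ?h ?x, rel_L1, rel_L2] I J =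
      tmul 2 (Rbar s 1 2 ?h ?x) (tprod 2 [rel_L1, rel_L2]) I J"
    by (simp add: tprod_def)
  then have 1: "tprod 2 [Rbar s 1 2 ?h ?x, rel_L1, rel_L2] I J = ?x * ring_inv ?d *
      (gen_u (I 1) (J 1) * gen_v (I 2) (J 2) -
          ?h * ring_inv ?x * (gen_u (I 2) (J 1) * gen_v (I 1) (J 2)))"
    using tmul_Rbar_left[OF I, of 1 2 s ?h ?x] LL[OF I J] LL[OF midx_comp[OF I t] J] by simp
  have "tprod 2 [rel_L2, rel_L1, Rbar s 1 2 ?h ?y] I J =
      tmul 2 (tprod 2 [rel_L2, rel_L1]) (tprod 2 [Rbar s 1 2 ?h ?y]) I J"
    using tprod_append[OF I, of "[rel_L2, rel_L1]" "[Rbar s 1 2 ?h ?y]" J] by simp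
  also have "\<dots> = tmul 2 (tprod 2 [rel_L2, rel_L1]) (Rbar s 1 2 ?h ?y) I J"
    by (rule tmul_cong_right) (rule tprod_singleton[OF J])
  finally have 2: "tprod 2 [rel_L2, rel_L1, Rbar s 1 2 ?h ?y] I J = ?y * ring_inv ?d' *
      (gen_v (I 2) (J 2) * gen_u (I 1) (J 1) -
          ?h * ring_inv ?y * (gen_v (I 2) (J 1) * gen_u (I 1) (J 2)))"
    using tmul_Rbar_right[OF J, of 1 2 ?y ?h s] LL[OF I J] LL[OF I midx_comp[OF J t]] units by simp
  have c: "central ?x" "central ?y" "central ?d" "central ?d'" by simp_all
  have "?d * ?d' * (A - B) = ?d' * (?d * A) - ?d * (?d' * B)" for A B
    by (metis (no_types, lifting) c(3) centralD mult.assoc right_diff_distrib)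
  then show ?thesis
    unfolding rel_diff_def 1 2
    by (simp only: clear_denominator[OF c(1) units'(1) c(3) units'(2) central_fps_X]
        clear_denominator[OF c(2) units(1) c(4) units(2) central_fps_X])
qed

lemma two_sided_ideal_A: "two_sided_ideal (A_ideal s)"
  and closed_ideal_A: "closed_ideal (A_ideal s)"
  unfolding A_ideal_def
  by (simp_all add: closed_ideal_top_free_ideal closed_ideal_two_sided)

text \<open>The right-hand side of \<open>rel_diff_cleared\<close> for the row indices \<open>a, a'\<close> and the column indices
  \<open>b, b'\<close>, as a power series in the variables \<open>1\<close> and \<open>2\<close>; here \<open>x\<close> is $v-u$.\<close>

definition cleared ::
    "int \<Rightarrow> 'n \<Rightarrow> 'n \<Rightarrow> 'n \<Rightarrow> 'n \<Rightarrow> 'n free_alg fps mps"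
  where "cleared s a a' b b' = (let x = mps_var 2 - mps_var 1; h = mps_const fps_X in
    (- x - of_int s * h) * (x * (gen_series 1 a b * gen_series 2 a' b') -
        h * (gen_series 1 a' b * gen_series 2 a b')) -
    (x - of_int s * h) * (- x * (gen_series 2 a' b' * gen_series 1 a b) -
        h * (gen_series 2 a' b * gen_series 1 a b')))"

lemma cleared_in_A_ideal:
  fixes a a' b b' :: "'n::finite"
  assumes s: "s = 1 \<or> s = -1" and e: "set_mset e \<subseteq> {1, 2}"
  shows "mps_nth (cleared s a a' b b') e \<in> A_ideal s"
proof -
  define I J :: "nat \<Rightarrow> 'n"
    where "I = (\<lambda>_. undefined)(1 := a, 2 := a')" and "J = (\<lambda>_. undefined)(1 := b, 2 := b')"
  have IJ: "I \<in> midx 2" "J \<in> midx 2"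
    by (auto simp: I_def J_def midx_def PiE_def extensional_def)
  have IJ_nth: "I 1 = a" "I 2 = a'" "J 1 = b" "J 2 = b'"
    by (simp_all add: I_def J_def)
  let ?X = "(- rel_u + rel_v - of_int s * fps_X) * (rel_u - rel_v - of_int s * fps_X) * rel_diff s
      I J"
  define good where "good = (\<lambda>X :: 'n rel_ring. \<forall>a b. rel_coeff X a b \<in> A_ideal s)"
  note J = two_sided_idealD[OF two_sided_ideal_A]
  have good_diff: "good (X - Y)" if "good X" "good Y" for X Y
    using that by (auto simp: good_def rel_coeff_diff intro: J(6))
  have good_uvh: "good (rel_u * X)" "good (rel_v * X)" "good (fps_X * X)" if "good X" for X
    using that by (auto simp: good_def rel_coeff_u rel_coeff_v rel_coeff_h intro: J(1,3))
  have good_0: "good 0"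
    using J(1) by (simp add: good_def rel_coeff_def fps_zero_def[symmetric])
  have good_uminus: "good (- X)" if "good X" for X
    using good_diff[OF good_0 that] by simp
  have good_s: "good (of_int s * X)" if "good X" for X
    using s good_uminus[OF that] that by auto
  have "rel_coeff (rel_diff s I J) a b \<in> A_rels s" for a b
    unfolding A_rels_def rel_coeff_def using IJ by blast
  then have "good (rel_diff s I J)"
    unfolding good_def A_ideal_def using top_free_ideal_superset by blast
  then have "good ?X"
    by (simp add: left_diff_distrib distrib_right mult.assoc)
      (intro good_diff good_uvh good_s good_uminus | simp add: add_uminus_conv_diff[symmetric])+
  then have X: "rel_coeff ?X a b \<in> A_ideal s" for a b
    by (simp add: good_def)
  have sc_s: "same_coeffs (of_int s * X) (of_int s * f)" if "same_coeffs X f"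
      for X :: "'n rel_ring" and f
    using s that same_coeffs_uminus[OF that] by auto
  have sc_x: "same_coeffs ((- rel_u + rel_v) * X) ((mps_var 2 - mps_var 1) * f)"
    "same_coeffs ((rel_u - rel_v) * X) (- (mps_var 2 - mps_var 1) * f)"
    "same_coeffs ((- rel_u + rel_v - of_int s * fps_X) * X)
      ((mps_var 2 - mps_var 1 - of_int s * mps_const fps_X) * f)"
    "same_coeffs ((rel_u - rel_v - of_int s * fps_X) * X)
      ((- (mps_var 2 - mps_var 1) - of_int s * mps_const fps_X) * f)"
    if "same_coeffs X f" for X :: "'n rel_ring" and f
    unfolding left_diff_distrib mult.assoc minus_diff_eq uminus_add_conv_diff
    using that by (auto simp del: One_nat_def
        intro!: same_coeffs_diff same_coeffs_u same_coeffs_v same_coeffs_h sc_s)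
  have "same_coeffs ?X (cleared s a a' b b')"
    unfolding rel_diff_cleared[OF IJ] cleared_def Let_def
    unfolding IJ_nth by (intro same_coeffs_diff sc_x same_coeffs_h same_coeffs_gen)
  moreover have "e = replicate_mset (count e 1) 1 + replicate_mset (count e 2) 2"
    using e by (intro multiset_eqI) (auto simp: not_in_iff[symmetric])
  ultimately show ?thesis
    using X[of "int (count e 1)" "count e 2"]
    by (simp add: same_coeffs_def uv_coeff_def del: One_nat_def)
qed


lemma lin_subst_gen_series:
  assumes "finite V" "p \<in> V"
  shows "lin_subst V \<tau> c (gen_series p i j) =
      mps_series (\<tau> p) (fps_nth (L_shift (of_int (c p)) i j))"
proof -
  have "of_nat k * of_int m ^ t * lgen i j d = single [(i, j, d)] (of_nat k * of_int m ^ t)"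
    for k m t d
  proof -
    have "of_nat k * of_int m ^ t = (of_int (int k * m ^ t) :: 'a free_alg)"
      by simp
    also have "\<dots> = single 0 (of_nat k * of_int m ^ t)"
      by (simp only: single_of_int[symmetric]) simp
    finally show ?thesis
      by (simp add: lgen_def mult_single zero_list_def plus_list_def)
  qed
  then show ?thesis
    unfolding gen_series_def lin_subst_series[OF assms] L_shift_def
    by (intro arg_cong[where f = "mps_series _"]) (simp add: fun_eq_iff)
qed

text \<open>The quotient by \<^const>\<open>A_ideal\<close> is a complex vector space without \<open>h\<close>-torsion.\<close>

lemma A_ideal_cancel:
  assumes s: "s = 1 \<or> s = -1" and "2 * of_int s * (fps_X * (fps_X * x)) \<in> A_ideal s"
  shows "x \<in> A_ideal s"
proof -
  let ?c = "fps_const (single 0 (1 / 2)) :: 'a free_alg fps"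
  have half: "?c * 2 = (1 :: 'a free_alg fps)"
  proof -
    have "(2 :: 'a free_alg fps) = fps_const (single 0 2)"
      by (metis fps_numeral_fps_const single_numeral)
    then have "?c * 2 = fps_const (single 0 (1 / 2) * single 0 2)"
      by (simp only: fps_const_mult)
    also have "\<dots> = 1" by (simp only: mult_single) simp
    finally show ?thesis .
  qed
  have cancel: "?c * (of_int s * (2 * of_int s * y)) = y" for y :: "'a free_alg fps"
  proof -
    have "of_int s * (2 * of_int s * y) = 2 * y" using s by auto
    with half show ?thesis by (simp only: mult.assoc[symmetric] mult_1_left)
  qed
  have "?c * (of_int s * (2 * of_int s * (fps_X * (fps_X * x)))) \<in> A_ideal s"
    by (intro two_sided_idealD(3)[OF two_sided_ideal_A] assms)
  with cancel have "fps_X * (fps_X * x) \<in> A_ideal s" by simp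
  then show ?thesis
    using closed_ideal_A[of s] unfolding closed_ideal_def by blast
qed

text \<open>Substitute $u\mapsto u+ch$, $v\mapsto u+(c+s)h$ in the cleared relation: its second summand
  vanishes with the factor $v-u-sh$, and its first one becomes the product of $-2sh^2(s-P)$ and
  the two generator matrices. With the two points exchanged, $u-v-sh$ vanishes and the second
  summand gives the statement for the columns.\<close>

lemma fused_exchange:
  fixes a a' b b' :: "'n::finite"
  assumes s: "s = 1 \<or> s = -1"
  defines "L \<equiv> \<lambda>c i j. L_shift (of_int c) i j :: 'n free_alg fps fps"
  shows "fps_nth (L c a b * L (c + s) a' b' - of_int s * (L c a' b * L (c + s) a b')) d \<in> A_ideal s"
    and "fps_nth (L c a b * L (c + s) a' b' - of_int s * (L c a b' * L (c + s) a' b)) d \<in> A_ideal s"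
proof -
  define Y where "Y = (\<lambda>c i j. mps_series 1 (fps_nth (L c i j)))"
  define H where "H = (mps_const fps_X :: 'n free_alg fps mps)"
  \<comment> \<open>The variables \<open>1\<close> and \<open>2\<close> are mapped to \<open>u + c1 h\<close> and \<open>u + c2 h\<close>.\<close>
  define cc where "cc = (\<lambda>c1 c2 p :: nat. if p = 1 then c1 else (c2 :: int))"
  define \<Phi> where "\<Phi> = (\<lambda>c1 c2. lin_subst {1, 2} (\<lambda>_. 1) (cc c1 c2)
    :: 'n free_alg fps mps \<Rightarrow> 'n free_alg fps mps)"
  have ideal: "mps_nth (\<Phi> c1 c2 (cleared s a a' b b')) e \<in> A_ideal s" for c1 c2 a a' b b' e
    unfolding \<Phi>_def by (intro lin_subst_in_ideal closed_ideal_A cleared_in_A_ideal s) auto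
  have gen: "\<Phi> c1 c2 (gen_series 1 i j) = Y c1 i j" "\<Phi> c1 c2 (gen_series 2 i j) = Y c2 i j"
    for c1 c2 i j
    unfolding \<Phi>_def Y_def L_def by (simp_all add: lin_subst_gen_series cc_def del: One_nat_def)
  have x: "\<Phi> c1 c2 (mps_var 2 - mps_var 1) = of_int (c2 - c1) * H" for c1 c2
    unfolding \<Phi>_def H_def lin_subst_diff
    by (simp add: lin_subst_var lin_form_def cc_def left_diff_distrib del: One_nat_def)
  have \<Phi>: "\<Phi> c1 c2 (f - g) = \<Phi> c1 c2 f - \<Phi> c1 c2 g" "\<Phi> c1 c2 (- f) = - \<Phi> c1 c2 f"
    "\<Phi> c1 c2 (f * g) = \<Phi> c1 c2 f * \<Phi> c1 c2 g" "\<Phi> c1 c2 (of_int k) = of_int k" "\<Phi> c1 c2 H = H"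
    for c1 c2 f g k
    by (simp_all add: \<Phi>_def H_def lin_subst_diff lin_subst_uminus lin_subst_mult)
  have cl: "\<Phi> c1 c2 (cleared s a a' b b') =
      (- (of_int (c2 - c1) * H) - of_int s * H) *
        (of_int (c2 - c1) * H * (Y c1 a b * Y c2 a' b') - H * (Y c1 a' b * Y c2 a b')) -
      (of_int (c2 - c1) * H - of_int s * H) *
        (- (of_int (c2 - c1) * H) * (Y c2 a' b' * Y c1 a b) - H * (Y c2 a' b * Y c1 a b'))"
    for c1 c2 a a' b b'
    unfolding cleared_def Let_def H_def[symmetric]
    by (simp only: x[unfolded \<Phi>(1)] \<Phi> gen)
  have ss: "of_int s * (of_int s * z) = z" for z :: "'n free_alg fps mps" using s by auto
  have cH: "H * (of_int k * z) = of_int k * (H * z)" for k :: int and z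
    by (metis central_left_commute central_of_int)
  have "\<Phi> c (c + s) (cleared s a a' b b') =
      - (2 * of_int s * (H * (H * (of_int s * (Y c a b * Y (c + s) a' b') -
          Y c a' b * Y (c + s) a b'))))"
    unfolding cl by (simp add: algebra_simps cH flip: mult_2)
  also have "\<dots> = - (2 * of_int s * (H * (H * (of_int s * (Y c a b * Y (c + s) a' b' -
      of_int s * (Y c a' b * Y (c + s) a b'))))))"
    by (simp add: right_diff_distrib ss)
  finally have 1: "\<Phi> c (c + s) (cleared s a a' b b') = \<dots>" .
  have "\<Phi> (c + s) c (cleared s a' a b' b) =
      2 * of_int s * (H * (H * (of_int s * (Y c a b * Y (c + s) a' b') -
          Y c a b' * Y (c + s) a' b)))"
    unfolding cl by (simp add: algebra_simps cH flip: mult_2)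
  also have "\<dots> = 2 * of_int s * (H * (H * (of_int s * (Y c a b * Y (c + s) a' b' -
      of_int s * (Y c a b' * Y (c + s) a' b)))))"
    by (simp add: right_diff_distrib ss)
  finally have 2: "\<Phi> (c + s) c (cleared s a' a b' b) = \<dots>" .
  have two: "(2 :: 'n free_alg fps mps) = mps_const 2"
    using mps_const_of_int[of 2] by simp
  have nth: "mps_nth (2 * of_int s * (H * (H * (of_int s * Z)))) e =
      2 * of_int s * (fps_X * (fps_X * (of_int s * mps_nth Z e)))" for Z e
    unfolding two H_def mps_const_of_int[symmetric] by (simp add: mult.assoc)
  have Y: "mps_nth (Y c i j * Y (c + s) i' j' - of_int s * (Y c k l * Y (c + s) k' l'))
      (replicate_mset d 1) =
      fps_nth (L c i j * L (c + s) i' j' - of_int s * (L c k l * L (c + s) k' l')) d"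
    for i j i' j' k l k' l'
    unfolding Y_def mps_series_mult[symmetric] mps_const_of_int[symmetric]
    by (simp add: fps_of_int[symmetric] del: One_nat_def)
  have cancel: "y \<in> A_ideal s"
    if "2 * of_int s * (fps_X * (fps_X * (of_int s * y))) \<in> A_ideal s" for y :: "'n free_alg fps"
  proof -
    have "of_int s * (of_int s * y) \<in> A_ideal s"
      using two_sided_idealD(3)[OF two_sided_ideal_A A_ideal_cancel[OF s that]] .
    then show ?thesis using s by auto
  qed
  note uminus = two_sided_idealD(5)[OF two_sided_ideal_A[of s]]
  show "fps_nth (L c a b * L (c + s) a' b' - of_int s * (L c a' b * L (c + s) a b')) d \<in> A_ideal s"
    using uminus[OF ideal[of c "c + s" a a' b b' "replicate_mset d 1"]]
    unfolding 1 mps_nth_uminus minus_minus nth Y by (rule cancel)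
  show "fps_nth (L c a b * L (c + s) a' b' - of_int s * (L c a b' * L (c + s) a' b)) d \<in> A_ideal s"
    using ideal[of "c + s" c a' a b' b "replicate_mset d 1"]
    unfolding 2 nth Y by (rule cancel)
qed

section \<open>The group algebra and the Young symmetrizer\<close>

abbreviation act :: "'a Perm.perm \<Rightarrow> 'a \<Rightarrow> 'a"
  where "act \<equiv> Perm.apply"

text \<open>Finitely supported functions on an additive monoid multiply by convolution. Writing the
  composition of permutations additively therefore turns \<open>nat perm \<Rightarrow>\<^sub>0 'b\<close> into the group algebra
  with coefficients in \<open>'b\<close>.\<close>

instantiation Perm.perm :: (type) group_add
begin
definition zero_perm :: "'a Perm.perm" where "0 = (1 :: 'a Perm.perm)"
definition plus_perm :: "'a Perm.perm \<Rightarrow> 'a Perm.perm \<Rightarrow> 'a Perm.perm" where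
    "x + y = x * (y :: 'a Perm.perm)"
definition uminus_perm :: "'a Perm.perm \<Rightarrow> 'a Perm.perm" where "- x = inverse (x :: 'a Perm.perm)"
definition minus_perm :: "'a Perm.perm \<Rightarrow> 'a Perm.perm \<Rightarrow> 'a Perm.perm" where
    "x - y = x * inverse (y :: 'a Perm.perm)"
instance
  by standard (simp_all add: zero_perm_def plus_perm_def uminus_perm_def minus_perm_def mult.assoc)
end

type_synonym 'b perm_alg = "nat Perm.perm \<Rightarrow>\<^sub>0 'b"

lemma act_0 [simp]: "act 0 = id"
  and act_add [simp]: "act (f + g) = act f \<circ> act g"
  and act_uminus: "act (- f) = inv (act f)"
  and act_diff [simp]: "act (f - g) = act f \<circ> act (- g)"
  and act_swap [simp]: "act (Perm.swap a b) = transpose a b"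
  by (simp_all add: zero_perm_def plus_perm_def uminus_perm_def minus_perm_def apply_times
      apply_inverse
      Perm.apply_one swap.rep_eq)

lemma swap_add_swap [simp]: "Perm.swap a b + Perm.swap a b = 0"
  and uminus_swap [simp]: "- Perm.swap a b = Perm.swap a b"
  by (simp_all add: zero_perm_def plus_perm_def uminus_perm_def)

lemma act_cancel [simp]: "act (- f) (act f x) = x" "act f (act (- f) x) = x"
  by (metis act_0 act_add add.left_inverse comp_apply id_apply,
      metis act_0 act_add add.right_inverse comp_apply id_apply)

lemma act_inject: "act f = act g \<longleftrightarrow> f = g"
  by (metis perm_eqI)

lemma permutation_act [simp]: "permutation (act f)"
  using finite_affected[of f] by (simp add: permutation affected.rep_eq)

lemma ex_act_eq:
  assumes "p permutes S" "finite S"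
  obtains f where "act f = p"
proof -
  have "permutation p" using assms by (auto simp: permutation_permutes)
  then have "p \<in> {p. bij p \<and> finite {a. p a \<noteq> a}}" by (simp add: permutation)
  then show ?thesis using Perm_inverse that by blast
qed

text \<open>The character of the finitary symmetric group that takes the value $s=\pm1$ on
  transpositions.\<close>

definition eps :: "int \<Rightarrow> 'a Perm.perm \<Rightarrow> int"
  where "eps s f = (if s = 1 then 1 else sign (act f))"

lemma eps_0 [simp]: "eps s 0 = 1"
  by (simp add: eps_def)

lemma eps_add: "eps s (f + g) = eps s f * eps s g"
  by (simp add: eps_def sign_compose)

lemma eps_square [simp]: "eps s f * eps s f = 1"
  by (simp add: eps_def)

lemma eps_uminus [simp]: "eps s (- f) = eps s f"
  by (simp add: eps_def act_uminus sign_inverse)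

lemma eps_swap: "s = 1 \<or> s = -1 \<Longrightarrow> a \<noteq> b \<Longrightarrow> eps s (Perm.swap a b) = s"
  by (auto simp: eps_def sign_swap_id)

definition sym_group :: "nat \<Rightarrow> nat Perm.perm set"
  where "sym_group k = {f. act f permutes {1..k}}"

definition young :: "nat \<Rightarrow> nat \<Rightarrow> nat Perm.perm set"
  where "young n m = {f \<in> sym_group (n + m). act f ` {1..n} = {1..n}}"

definition adjacents :: "nat \<Rightarrow> nat \<Rightarrow> nat set"
  where "adjacents n m = {1..<n} \<union> {n + 1..<n + m}"

lemma sym_group_0: "0 \<in> sym_group k"
  and sym_group_add: "f \<in> sym_group k \<Longrightarrow> g \<in> sym_group k \<Longrightarrow> f + g \<in> sym_group k"
  and sym_group_uminus: "f \<in> sym_group k \<Longrightarrow> - f \<in> sym_group k"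
  and sym_group_swap: "i \<in> {1..k} \<Longrightarrow> j \<in> {1..k} \<Longrightarrow> Perm.swap i j \<in> sym_group k"
  by (simp_all add: sym_group_def permutes_id permutes_compose act_uminus permutes_inv
      permutes_swap_id)

lemma young_0: "0 \<in> young n m"
  by (simp add: young_def sym_group_0)

lemma young_add: "f \<in> young n m \<Longrightarrow> g \<in> young n m \<Longrightarrow> f + g \<in> young n m"
  by (auto simp: young_def sym_group_add simp flip: image_image) 

lemma young_uminus:
  assumes "f \<in> young n m"
  shows "- f \<in> young n m"
proof -
  have "act f ` {1..n} = {1..n}" using assms by (simp add: young_def)
  then have "act (- f) ` (act f ` {1..n}) = act (- f) ` {1..n}" by simp
  then have "act (- f) ` {1..n} = {1..n}" by (simp add: image_image)
  then show ?thesis using assms by (simp add: young_def sym_group_uminus)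
qed

lemma finite_young [simp]: "finite (young n m)"
proof (rule finite_imageD)
  show "finite (act ` young n m)"
    by (rule finite_subset[OF _ finite_permutations[of "{1..n + m}"]])
      (auto simp: young_def sym_group_def)
  show "inj_on act (young n m)" by (auto simp: inj_on_def act_inject)
qed

lemma card_young_pos: "card (young n m) > 0"
  using young_0 card_gt_0_iff finite_young by blast

lemma adjacent_in_young:
  assumes i: "i \<in> adjacents n m"
  shows "Perm.swap i (Suc i) \<in> young n m"
proof -
  have "transpose i (Suc i) ` {1..n} = {1..n}"
  proof (cases "i \<in> {1..<n}")
    case True
    then show ?thesis by (intro permutes_image permutes_swap_id) auto
  next
    case False
    with i have "i > n" by (auto simp: adjacents_def)
    then have "transpose i (Suc i) x = x" if "x \<in> {1..n}" for x
      using that by (auto simp: transpose_def)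
    then show ?thesis by simp
  qed
  moreover have "Perm.swap i (Suc i) \<in> sym_group (n + m)"
    using i by (intro sym_group_swap) (auto simp: adjacents_def)
  ultimately show ?thesis by (simp add: young_def)
qed

text \<open>Adjacent transpositions generate: by conjugation they yield all transpositions of a block,
  hence all permutations of a block, and every element of $S_n\times S_m$ is the product of its
  restrictions to the two blocks.\<close>

lemma young_induct [consumes 1, case_names zero adjacent]:
  assumes f: "f \<in> young n m" and P0: "P 0"
    and step: "\<And>i f. i \<in> adjacents n m \<Longrightarrow> f \<in> young n m \<Longrightarrow> P f \<Longrightarrow> P (Perm.swap i (Suc i) + f)"
  shows "P f"
proof -
  define Q where "Q = (\<lambda>f. f \<in> young n m \<and> P f)"
  have Q_step: "Q (Perm.swap i (Suc i) + f)" if "i \<in> adjacents n m" "Q f" for i f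
    using that step young_add[OF adjacent_in_young] by (simp add: Q_def)
  have Q_swap: "Q (Perm.swap a (a + Suc d) + f)" if "{a..<a + Suc d} \<subseteq> adjacents n m" "Q f"
      for a d f
    using that
  proof (induction d arbitrary: f)
    case 0
    then show ?case using Q_step[of a f] by auto
  next
    case (Suc d)
    let ?b = "a + Suc d"
    have "Perm.swap a (Suc ?b) = Perm.swap ?b (Suc ?b) + (Perm.swap a ?b + Perm.swap ?b (Suc ?b))"
      by (rule perm_eqI) (simp add: transpose_def)
    moreover have "?b \<in> adjacents n m" using Suc.prems(1) by auto
    moreover have "{a..<a + Suc d} \<subseteq> adjacents n m" using Suc.prems(1) by auto
    ultimately show ?case
      using Suc.IH Suc.prems(2) Q_step by (simp add: add.assoc)
  qed
  have Q_swap': "Q (Perm.swap a b + f)"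
    if "a \<in> {l..<r}" "b \<in> {l..<r}" "{l..<r - 1} \<subseteq> adjacents n m" "Q f" for a b l r f
  proof (cases a b rule: linorder_cases)
    case less
    then obtain d where b: "b = a + Suc d" using less_imp_Suc_add by fastforce
    then have "{a..<a + Suc d} \<subseteq> {l..<r - 1}" using that by auto
    then show ?thesis using Q_swap[of a d f] that unfolding b by blast
  next
    case equal
    have "Perm.swap a a = 0"
      by (simp add: act_inject[symmetric])
    with equal that(4) show ?thesis by simp
  next
    case greater
    then obtain d where a: "a = b + Suc d" using less_imp_Suc_add by fastforce
    then have "{b..<b + Suc d} \<subseteq> {l..<r - 1}" using that by auto
    then show ?thesis using Q_swap[of b d f] that unfolding a Perm.swap_sym[of _ b] by blast
  qed
  have Q_perm: "Q (h + f)" if "act h permutes {l..<r}" "{l..<r - 1} \<subseteq> adjacents n m" "Q f"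
      for h f l r
  proof -
    have "\<forall>h f. act h = p \<longrightarrow> Q f \<longrightarrow> Q (h + f)" if "p permutes {l..<r}" for p
      using that finite_atLeastLessThan
    proof (induction p rule: permutes_induct)
      case id
      then show ?case by (metis act_0 act_inject add_0)
    next
      case (swap a b p)
      show ?case
      proof (intro allI impI)
        fix h f assume h: "act h = transpose a b \<circ> p" and f: "Q f"
        obtain g where g: "act g = p" using ex_act_eq[OF swap(4)] by auto
        have "h = Perm.swap a b + g"
          by (simp add: act_inject[symmetric] h g)
        moreover have "Q (g + f)" using swap(5) g f by blast
        ultimately show "Q (h + f)"
          using Q_swap'[OF swap(1,2) \<open>{l..<r - 1} \<subseteq> adjacents n m\<close>] by (simp add: add.assoc)
      qed
    qed
    then show ?thesis using that by blast
  qed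
  \<comment> \<open>The restriction of \<open>f\<close> to the first block; \<open>h\<close> below is the one to the second block.\<close>
  define p where "p = (\<lambda>x. if x \<in> {1..n} then act f x else x)"
  have fU: "act f permutes {1..n + m}" and fX: "act f ` {1..n} = {1..n}"
    using f by (simp_all add: young_def sym_group_def)
  have "bij_betw (act f) {1..n} {1..n}"
    using fX by (auto simp: bij_betw_def inj_on_def apply_inj)
  then have "bij_betw p {1..n} {1..n}"
    by (subst bij_betw_cong[of _ _ "act f"]) (auto simp: p_def)
  then have p: "p permutes {1..n}"
    by (rule bij_imp_permutes) (auto simp: p_def)
  obtain g where g: "act g = p" using ex_act_eq[OF p] by auto
  define h where "h = - g + f"
  have gx: "act g x = act f x" if "x \<in> {1..n}" for x using that by (simp add: g p_def)
  have h_fix: "act h x = x" if "x \<notin> {n + 1..n + m}" for x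
  proof (cases "x \<in> {1..n}")
    case True
    then show ?thesis using gx[OF True] act_cancel(1)[of g x] by (simp add: h_def)
  next
    case False
    with that have "x \<notin> {1..n + m}" by auto
    then have "act f x = x" using fU unfolding permutes_def by blast
    moreover have "act g x = x" using False by (auto simp: g p_def)
    ultimately show ?thesis using act_cancel(1)[of g x] by (simp add: h_def)
  qed
  have "act h permutes {n + 1..n + m}"
    unfolding permutes_def using h_fix bij_apply[of h] by (auto simp: bij_iff)
  then have "act h permutes {n + 1..<n + m + 1}" by (simp add: atLeastLessThanSuc_atLeastAtMost)
  then have "Q (h + 0)"
    by (rule Q_perm) (auto simp: adjacents_def Q_def young_0 P0)
  moreover have "act g permutes {1..<n + 1}"
    using p g by (simp add: atLeastLessThanSuc_atLeastAtMost)
  ultimately have "Q (g + (h + 0))"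
    using Q_perm[of g 1 "n + 1" "h + 0"] by (auto simp: adjacents_def)
  then show ?thesis by (simp add: h_def Q_def)
qed

text \<open>The parts into which \<open>U\<close> is cut by \<open>X\<close> and \<open>A\<close> have the same sizes as those into which it is
  cut by \<open>X\<close> and \<open>B\<close>, so that \<open>p\<close> can be chosen on each part separately.\<close>

lemma ex_permutes_stabilizing:
  assumes U: "finite U" and sub: "X \<subseteq> U" "A \<subseteq> U" "B \<subseteq> U"
    and card: "card A = card B" "card (A \<inter> X) = card (B \<inter> X)"
  shows "\<exists>p. p permutes U \<and> p ` X = X \<and> p ` A = B"
proof -
  note fin = U sub[THEN finite_subset[OF _ U]]
  have ex: "\<exists>f. bij_betw f C D" if "card C = card D" "C \<subseteq> U" "D \<subseteq> U" for C D
    using that U finite_subset by (intro bij_betw_iff_card[THEN iffD2]) auto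
  have AX: "card (A - X) = card (B - X)"
    using card fin by (metis card_Diff_subset_Int finite_Int inf_commute)
  have XA: "card (X - A) = card (X - B)"
    using card fin by (simp add: card_Diff_subset_Int Int_commute)
  have UA: "card (U - X - A) = card (U - X - B)"
  proof -
    have "card (U - X - C) = card (U - X) - card (C - X)" if "C \<subseteq> U" for C
    proof -
      have "U - X - C = (U - X) - (C - X)" by auto
      also have "card \<dots> = card (U - X) - card (C - X)"
        using that U finite_subset by (intro card_Diff_subset) auto
      finally show ?thesis .
    qed
    then show ?thesis using sub AX by simp
  qed
  obtain f1 where f1: "bij_betw f1 (A \<inter> X) (B \<inter> X)" using ex[OF card(2)] sub by blast
  obtain f2 where f2: "bij_betw f2 (A - X) (B - X)" using ex[OF AX] sub by blast
  obtain f3 where f3: "bij_betw f3 (X - A) (X - B)" using ex[OF XA] sub by blast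
  obtain f4 where f4: "bij_betw f4 (U - X - A) (U - X - B)" using ex[OF UA] sub by blast
  define p where "p = (\<lambda>x. if x \<in> A \<inter> X then f1 x else if x \<in> A - X then f2 x
    else if x \<in> X - A then f3 x else if x \<in> U - X - A then f4 x else x)"
  have p1: "bij_betw p (A \<inter> X) (B \<inter> X)" using f1 by (subst bij_betw_cong[of _ _ f1]) (auto
      simp: p_def)
  have p2: "bij_betw p (A - X) (B - X)" using f2 by (subst bij_betw_cong[of _ _ f2]) (auto
      simp: p_def)
  have p3: "bij_betw p (X - A) (X - B)" using f3 by (subst bij_betw_cong[of _ _ f3]) (auto
      simp: p_def)
  have p4: "bij_betw p (U - X - A) (U - X - B)" using f4 by (subst bij_betw_cong[of _ _ f4]) (auto
      simp: p_def)
  have pA: "bij_betw p (A \<inter> X \<union> (A - X)) (B \<inter> X \<union> (B - X))"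
    by (rule bij_betw_combine[OF p1 p2]) auto
  have pX: "bij_betw p (A \<inter> X \<union> (X - A)) (B \<inter> X \<union> (X - B))"
    by (rule bij_betw_combine[OF p1 p3]) auto
  have pA': "bij_betw p (X - A \<union> (U - X - A)) (X - B \<union> (U - X - B))"
    by (rule bij_betw_combine[OF p3 p4]) auto
  have "bij_betw p (A \<inter> X \<union> (A - X) \<union> (X - A \<union> (U - X - A)))
      (B \<inter> X \<union> (B - X) \<union> (X - B \<union> (U - X - B)))"
    by (rule bij_betw_combine[OF pA pA']) auto
  moreover have "A \<inter> X \<union> (A - X) \<union> (X - A \<union> (U - X - A)) = U"
    "B \<inter> X \<union> (B - X) \<union> (X - B \<union> (U - X - B)) = U" using sub by auto
  ultimately have "p permutes U"
    using sub by (intro bij_imp_permutes) (auto simp: p_def)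
  moreover have "A \<inter> X \<union> (X - A) = X" "B \<inter> X \<union> (X - B) = X" "A \<inter> X \<union> (A - X) = A"
    "B \<inter> X \<union> (B - X) = B" by auto
  ultimately show ?thesis using pA pX by (intro exI[of _ p]) (simp add: bij_betw_def)
qed

text \<open>The double coset of \<open>\<sigma>\<close> modulo $S_n\times S_m$ is determined by the number of points that
  \<open>\<sigma>\<close> keeps in \<open>{1..n}\<close>. This number is the same for $\sigma^{-1}$.\<close>

lemma uminus_in_double_coset:
  assumes f: "f \<in> sym_group (n + m)"
  obtains g g' where "g \<in> young n m" "g' \<in> young n m" "- f = g + f + g'" "eps s g * eps s g' = 1"
proof -
  let ?U = "{1..n + m}" and ?X = "{1..n}"
  have fU: "act f permutes ?U" "act (- f) permutes ?U"
    using f sym_group_uminus[OF f] by (simp_all add: sym_group_def)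
  have inj: "inj_on (act h) C" for h :: "nat Perm.perm" and C by (auto simp: inj_on_def apply_inj)
  have "act f ` (act (- f) ` ?X \<inter> ?X) = act f ` ?X \<inter> ?X"
    by (subst image_Int[OF inj[of f UNIV, unfolded inj_on_def[symmetric]]])
      (auto simp: image_image)
  then have "card (act (- f) ` ?X \<inter> ?X) = card (act f ` ?X \<inter> ?X)"
    by (metis card_image inj)
  moreover have "card (act (- f) ` ?X) = card (act f ` ?X)"
    by (simp add: card_image inj)
  moreover have "act f ` ?X \<subseteq> ?U" "act (- f) ` ?X \<subseteq> ?U"
    using permutes_image[OF fU(1)] permutes_image[OF fU(2)] by fastforce+
  ultimately obtain p where p: "p permutes ?U" "p ` ?X = ?X" "p ` (act (- f) ` ?X) = act f ` ?X"
    using ex_permutes_stabilizing[of ?U ?X "act (- f) ` ?X" "act f ` ?X"] by fastforce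
  obtain h where h: "act h = p" using ex_act_eq[OF p(1)] by auto
  have hy: "h \<in> young n m" using p h by (simp add: young_def sym_group_def)
  \<comment> \<open>With \<open>g' = - h\<close> the equation determines \<open>g\<close>, which preserves \<open>{1..n}\<close> by the choice of \<open>p\<close>.\<close>
  define g where "g = - f + h + - f"
  have "act g ` ?X = act (- f) ` (act h ` (act (- f) ` ?X))"
    by (simp add: g_def image_image)
  also have "\<dots> = act (- f) ` (act f ` ?X)" by (simp only: h p(3))
  also have "\<dots> = ?X" by (simp add: image_image)
  finally have "act g ` ?X = ?X" .
  moreover have "g \<in> sym_group (n + m)"
    using hy f by (simp only: g_def young_def sym_group_add sym_group_uminus mem_Collect_eq)
  ultimately have gy: "g \<in> young n m" by (simp add: young_def)
  have "- f = g + f + - h"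
    by (simp add: g_def add.assoc)
  moreover have "eps s g * eps s (- h) = 1"
  proof -
    have "eps s g * eps s (- h) = (eps s f * eps s f) * (eps s h * eps s h)"
      unfolding g_def eps_add eps_uminus by (simp only: ac_simps)
    then show ?thesis by simp
  qed
  ultimately show ?thesis using that[of g "- h"] gy young_uminus[OF hy] by blast
qed


lemma poly_mapping_sum_single:
  "(\<Sum>k\<in>keys x. single k (lookup x k)) = x"
  by (rule poly_mapping_eqI)
    (auto simp: lookup_sum lookup_single when_def sum.delta' in_keys_iff)

lemma central_single_0 [simp]:
  assumes "central c"
  shows "central (single (0::'a::monoid_add) c)"
  unfolding central_def
proof
  fix y :: "'a \<Rightarrow>\<^sub>0 'b"
  have "single 0 c * (\<Sum>k\<in>keys y. single k (lookup y k)) =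
      (\<Sum>k\<in>keys y. single k (lookup y k)) * single 0 c"
    unfolding sum_distrib_left sum_distrib_right
    by (intro sum.cong refl) (simp only: mult_single add_0_left add_0_right centralD[OF assms])
  then show "single 0 c * y = y * single 0 c"
    by (simp only: poly_mapping_sum_single)
qed

text \<open>Inverting permutations reverses products only up to the order of the coefficients, so that
  these have to commute.\<close>

definition central_coeffs :: "('a \<Rightarrow>\<^sub>0 'b::ring_1) \<Rightarrow> bool"
  where "central_coeffs x \<longleftrightarrow> (\<forall>k. central (lookup x k))"

lemma central_coeffs_add: "central_coeffs x \<Longrightarrow> central_coeffs y \<Longrightarrow> central_coeffs (x + y)"
  and central_coeffs_diff: "central_coeffs x \<Longrightarrow> central_coeffs y \<Longrightarrow> central_coeffs (x - y)"
  and central_coeffs_single: "central c \<Longrightarrow> central_coeffs (single k c)"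
  by (auto simp: central_coeffs_def lookup_add lookup_minus lookup_single when_def)

lemma central_coeffs_sum: "(\<And>i. i \<in> I \<Longrightarrow> central_coeffs (f i)) \<Longrightarrow> central_coeffs (sum f I)"
  by (auto simp: central_coeffs_def lookup_sum intro: central_sum)

lemma poly_mapping_mult_sum:
  "x * y = (\<Sum>k\<in>keys x. \<Sum>l\<in>keys y.
    single (k + l) (lookup x k * lookup y l))"
proof -
  have "x * y = (\<Sum>k\<in>keys x. single k (lookup x k)) *
      (\<Sum>l\<in>keys y. single l (lookup y l))"
    by (simp only: poly_mapping_sum_single)
  then show ?thesis by (simp add: sum_product mult_single)
qed

lemma central_coeffs_mult: "central_coeffs x \<Longrightarrow> central_coeffs y \<Longrightarrow> central_coeffs (x * y)"
  unfolding poly_mapping_mult_sum[of x y]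
  by (intro central_coeffs_sum central_coeffs_single) (simp add: central_coeffs_def)

lemma central_coeffs_prod_list:
  "(\<And>x. x \<in> set xs \<Longrightarrow> central_coeffs x) \<Longrightarrow> central_coeffs
      (prod_list (xs :: ('a::monoid_add \<Rightarrow>\<^sub>0 'b::ring_1) list))"
proof (induction xs)
  case Nil
  then show ?case by (simp flip: single_one add: central_coeffs_single)
qed (simp add: central_coeffs_mult)

text \<open>The anti-automorphism of the group algebra that inverts the group elements.\<close>

definition adjoint :: "('g::group_add \<Rightarrow>\<^sub>0 'b::ring_1) \<Rightarrow> ('g \<Rightarrow>\<^sub>0 'b)"
  where "adjoint = Poly_Mapping.map_key uminus"

lemma adjoint_add: "adjoint (x + y) = adjoint x + adjoint y"
  and adjoint_0 [simp]: "adjoint 0 = 0"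
  and adjoint_single [simp]: "adjoint (single k c) = single (- k) c"
proof -
  show "adjoint (x + y) = adjoint x + adjoint y" "adjoint 0 = 0"
    by (simp_all add: adjoint_def map_key_plus)
  show "adjoint (single k c) = single (- k) c"
    using map_key_single[of uminus "- k" c] by (simp add: adjoint_def)
qed

lemma adjoint_sum: "adjoint (sum f I) = (\<Sum>i\<in>I. adjoint (f i))"
  by (induction I rule: infinite_finite_induct) (simp_all add: adjoint_add)

lemma adjoint_eq_sum:
  "adjoint x = (\<Sum>k\<in>keys x. single (- k) (lookup x k))"
proof -
  have "adjoint x = adjoint (\<Sum>k\<in>keys x. single k (lookup x k))"
    by (simp only: poly_mapping_sum_single)
  then show ?thesis by (simp only: adjoint_sum adjoint_single)
qed

lemma adjoint_mult:
  assumes "central_coeffs x"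
  shows "adjoint (x * y) = adjoint y * adjoint x"
proof -
  have "adjoint (x * y) = (\<Sum>k\<in>keys x. \<Sum>l\<in>keys y.
      single (- l + - k) (lookup y l * lookup x k))"
    unfolding poly_mapping_mult_sum[of x y] adjoint_sum adjoint_single minus_add
    using assms by (intro sum.cong refl arg_cong[where f = "single _"] centralD)
      (simp add: central_coeffs_def)
  also have "\<dots> = adjoint y * adjoint x"
    unfolding adjoint_eq_sum sum_product mult_single by (rule sum.swap)
  finally show ?thesis .
qed

lemma adjoint_prod_list:
  fixes xs :: "('g::group_add \<Rightarrow>\<^sub>0 'b::ring_1) list"
  assumes "\<And>x. x \<in> set xs \<Longrightarrow> central_coeffs x \<and> adjoint x = x"
  shows "adjoint (prod_list xs) = prod_list (rev xs)"
  using assms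
proof (induction xs)
  case Nil
  then show ?case by (simp flip: single_one)
qed (simp add: adjoint_mult)

definition supported :: "nat \<Rightarrow> 'b::ring_1 perm_alg \<Rightarrow> bool"
  where "supported k x \<longleftrightarrow> keys x \<subseteq> sym_group k"

lemma supported_add: "supported k x \<Longrightarrow> supported k y \<Longrightarrow> supported k (x + y)"
  unfolding supported_def using Poly_Mapping.keys_add[of x y] by blast

lemma supported_single: "f \<in> sym_group k \<Longrightarrow> supported k (single f c)"
  by (simp add: supported_def)

lemma supported_1: "supported k 1"
  by (simp flip: single_one add: supported_single sym_group_0)

lemma supported_diff: "supported k x \<Longrightarrow> supported k y \<Longrightarrow> supported k (x - y)"
proof -
  have "keys (x - y) \<subseteq> keys x \<union> keys y"
    by (auto simp: in_keys_iff lookup_minus)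
  then show "supported k x \<Longrightarrow> supported k y \<Longrightarrow> supported k (x - y)"
    unfolding supported_def by blast
qed

lemma supported_mult: "supported k x \<Longrightarrow> supported k y \<Longrightarrow> supported k (x * y)"
proof -
  assume "supported k x" "supported k y"
  then have "{f + g | f g. f \<in> keys x \<and> g \<in> keys y} \<subseteq> sym_group k"
    by (auto simp: supported_def intro: sym_group_add)
  then show ?thesis unfolding supported_def using keys_mult[of x y] by (rule subset_trans[rotated])
qed

lemma supported_prod_list: "(\<And>x. x \<in> set xs \<Longrightarrow> supported k x) \<Longrightarrow> supported k (prod_list xs)"
  by (induction xs) (simp_all add: supported_1 supported_mult)

text \<open>Up to the factor $n!\,m!$ the projection to the tensors that are symmetric (\<open>s = 1\<close>) or
  skew-symmetric (\<open>s = -1\<close>) in the first \<open>n\<close> and in the last \<open>m\<close> factors.\<close>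

definition young_sym :: "int \<Rightarrow> nat \<Rightarrow> nat \<Rightarrow> 'b::ring_1 perm_alg"
  where "young_sym s n m = (\<Sum>f\<in>young n m. single f (of_int (eps s f)))"

abbreviation perm_el :: "nat Perm.perm \<Rightarrow> 'b::ring_1 perm_alg"
  where "perm_el f \<equiv> single f 1"

lemma single_conv_of_int: "single f (of_int k) = of_int k * perm_el f"
  by (simp flip: single_of_int add: mult_single)

lemma eps_cancel: "eps s g * (eps s g * k) = k" "eps s g * (k * eps s g) = k"
  by (simp_all add: mult.assoc[symmetric])

lemma perm_el_young_sym:
  assumes g: "g \<in> young n m"
  shows "perm_el g * young_sym s n m = of_int (eps s g) * young_sym s n m"
    and "young_sym s n m * perm_el g = of_int (eps s g) * (young_sym s n m :: 'b::ring_1 perm_alg)"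
proof -
  have "perm_el g * young_sym s n m = (\<Sum>f\<in>young n m. single (g + f) (of_int (eps s f)))"
    by (simp add: young_sym_def sum_distrib_left mult_single)
  also have "\<dots> = (\<Sum>f\<in>young n m. single f (of_int (eps s g * eps s f)))"
    by (rule sum.reindex_bij_witness[where i = "\<lambda>f. - g + f" and j = "\<lambda>f. g + f"])
      (simp_all add: g young_add young_uminus eps_add eps_cancel add.assoc[symmetric]
          flip: of_int_mult)
  also have "\<dots> = of_int (eps s g) * young_sym s n m"
    by (simp add: young_sym_def sum_distrib_left mult_single flip: single_of_int)
  finally show "perm_el g * young_sym s n m = of_int (eps s g) * young_sym s n m" .
  have "young_sym s n m * perm_el g = (\<Sum>f\<in>young n m. single (f + g) (of_int (eps s f)))"
    by (simp add: young_sym_def sum_distrib_right mult_single)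
  also have "\<dots> = (\<Sum>f\<in>young n m. single f (of_int (eps s g * eps s f)))"
    by (rule sum.reindex_bij_witness[where i = "\<lambda>f. f + - g" and j = "\<lambda>f. f + g"])
      (simp_all add: g young_add young_uminus eps_add eps_cancel add.assoc mult.commute del:
          add_uminus_conv_diff flip: of_int_mult)
  also have "\<dots> = of_int (eps s g) * young_sym s n m"
    by (simp add: young_sym_def sum_distrib_left mult_single flip: single_of_int)
  finally show "young_sym s n m * perm_el g = of_int (eps s g) * (young_sym s n m :: 'b perm_alg)" .
qed

lemma young_sym_mult_left:
  assumes s: "s = 1 \<or> s = -1"
    and x: "\<And>i. i \<in> adjacents n m \<Longrightarrow> perm_el (Perm.swap i (Suc i)) * x = of_int s * x"
  shows "young_sym s n m * x = of_nat (card (young n m)) * x"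
proof -
  have "perm_el f * x = of_int (eps s f) * x" if "f \<in> young n m" for f
    using that
  proof (induction rule: young_induct)
    case zero
    then show ?case by simp
  next
    case (adjacent i f)
    have "perm_el (Perm.swap i (Suc i) + f) * x = perm_el (Perm.swap i (Suc i)) * (perm_el f * x)"
      by (simp add: mult_single flip: mult.assoc)
    also have "\<dots> = of_int (eps s f) * (perm_el (Perm.swap i (Suc i)) * x)"
      unfolding adjacent.IH by (metis mult.assoc mult_of_int_commute)
    also have "\<dots> = of_int (eps s (Perm.swap i (Suc i) + f)) * x"
    proof -
      have "eps s (Perm.swap i (Suc i) + f) = eps s f * s"
        using eps_swap[OF s, of i "Suc i"] by (simp add: eps_add)
      then show ?thesis unfolding x[OF adjacent.hyps(1)] by (simp only: of_int_mult mult.assoc)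
    qed
    finally show ?case .
  qed
  then have "young_sym s n m * x = (\<Sum>f\<in>young n m. of_int (eps s f) * (of_int (eps s f) * x))"
    by (simp add: young_sym_def sum_distrib_right single_conv_of_int mult.assoc)
  also have "\<dots> = (\<Sum>f\<in>young n m. x)"
    by (simp flip: mult.assoc of_int_mult)
  finally show ?thesis by simp
qed

lemma young_sym_square:
  assumes s: "s = 1 \<or> s = -1"
  shows "young_sym s n m * young_sym s n m = of_nat (card (young n m)) * (young_sym s n m
      :: 'b::ring_1 perm_alg)"
proof -
  have "young_sym s n m * young_sym s n m = (\<Sum>f\<in>young n m. of_int (eps s f) *
      (of_int (eps s f) * (young_sym s n m :: 'b perm_alg)))"
    by (subst young_sym_def) (simp add: sum_distrib_right single_conv_of_int mult.assoc
        perm_el_young_sym)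
  also have "\<dots> = of_nat (card (young n m)) * young_sym s n m"
    by (simp flip: mult.assoc of_int_mult)
  finally show ?thesis .
qed

lemma central_coeffs_young_sym: "central_coeffs (young_sym s n m)"
  unfolding young_sym_def by (intro central_coeffs_sum central_coeffs_single) simp

lemma adjoint_young_sym: "adjoint (young_sym s n m) = young_sym s n m"
  unfolding young_sym_def adjoint_sum adjoint_single
  by (rule sum.reindex_bij_witness[where i = uminus and j = uminus])
    (simp_all add: young_uminus)

text \<open>$(S_{n+m}, S_n\times S_m)$ is a Gelfand pair. Since \<open>\<sigma>\<close> and $\sigma^{-1}$ lie in the same
  double coset, \<^const>\<open>adjoint\<close> is trivial on the elements that are symmetrized on both sides.\<close>

lemma young_sym_adjoint:
  fixes x :: "'b::ring_1 perm_alg"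
  assumes "supported (n + m) x"
  shows "young_sym s n m * adjoint x * young_sym s n m = young_sym s n m * x * young_sym s n m"
proof -
  let ?A = "young_sym s n m :: 'b perm_alg"
  have *: "?A * single (- f) c * ?A = ?A * single f c * ?A"
    if f: "f \<in> sym_group (n + m)" for f c
  proof -
    obtain g g' where g: "g \<in> young n m" "g' \<in> young n m" "- f = g + f + g'" "eps s g * eps s g' =
        1"
      using uminus_in_double_coset[OF f] by blast
    have "single (- f) c = perm_el g * single f c * perm_el g'"
      by (simp add: g(3) mult_single)
    then have "?A * single (- f) c * ?A =
        (?A * perm_el g) * single f c * (perm_el g' * ?A)"
      by (simp add: mult.assoc)
    also have "\<dots> = of_int (eps s g) * (?A * single f c) * (of_int (eps s g') * ?A)"
      by (simp only: perm_el_young_sym g(1,2) mult.assoc)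
    also have "\<dots> = of_int (eps s g * eps s g') * (?A * single f c * ?A)"
      by (metis (no_types, lifting) mult.assoc mult_of_int_commute of_int_mult)
    finally show ?thesis by (simp add: g(4))
  qed
  have "?A * adjoint x * ?A = (\<Sum>f\<in>keys x. ?A * single (- f) (lookup x f) * ?A)"
    by (simp add: adjoint_eq_sum sum_distrib_left sum_distrib_right)
  also have "\<dots> = (\<Sum>f\<in>keys x. ?A * single f (lookup x f) * ?A)"
    using assms by (intro sum.cong refl *) (auto simp: supported_def)
  also have "\<dots> = ?A * (\<Sum>f\<in>keys x. single f (lookup x f)) * ?A"
    by (simp only: sum_distrib_left sum_distrib_right)
  finally show ?thesis by (simp only: poly_mapping_sum_single)
qed

text \<open>Integers have to be inverted in order to divide by the order of a group.\<close>

definition rational :: "'b::ring_1 itself \<Rightarrow> bool"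
  where "rational _ \<longleftrightarrow> (\<forall>k > 0. \<exists>q :: 'b. of_nat k * q = 1)"

lemma rational_cancel:
  fixes x y :: "'a::monoid_add \<Rightarrow>\<^sub>0 'b::ring_1"
  assumes "rational TYPE('b)" "k > 0" and eq: "of_nat k * x = of_nat k * y"
  shows "x = y"
proof -
  obtain q :: 'b where q: "of_nat k * q = 1" using assms(1,2) by (auto simp: rational_def)
  have "of_nat k * single 0 q = (1 :: 'a \<Rightarrow>\<^sub>0 'b)"
    by (simp add: q mult_single flip: single_of_nat)
  then have "single 0 q * of_nat k = (1 :: 'a \<Rightarrow>\<^sub>0 'b)"
    by (simp add: mult_of_nat_commute)
  then have "single 0 q * (of_nat k * z) = z" for z :: "'a \<Rightarrow>\<^sub>0 'b"
    by (simp flip: mult.assoc)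
  then show ?thesis using eq by metis
qed

text \<open>By invariance $xA$ is proportional to $AxA$. Taking adjoints, $Ax^*$ is proportional to
  $Ax^*A$ with the same factor, and $Ax^*A=AxA$ by the Gelfand property.\<close>

lemma symmetrized_adjoint_commute:
  fixes x :: "'b::ring_1 perm_alg"
  assumes rat: "rational TYPE('b)" and s: "s = 1 \<or> s = -1"
    and x: "supported (n + m) x" "central_coeffs x"
    and sym: "\<And>i. i \<in> adjacents n m \<Longrightarrow>
      perm_el (Perm.swap i (Suc i)) * (x * young_sym s n m) = of_int s * (x * young_sym s n m)"
  shows "x * young_sym s n m = young_sym s n m * adjoint x"
proof (rule rational_cancel[OF rat card_young_pos])
  let ?A = "young_sym s n m :: 'b perm_alg" and ?N = "of_nat (card (young n m)) :: 'b perm_alg"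
  have 1: "?N * (x * ?A) = ?A * x * ?A"
    using young_sym_mult_left[OF s sym] by (simp add: mult.assoc)
  have "adjoint (?N * (x * ?A)) = ?A * adjoint x * ?N"
  proof -
    have "adjoint ?N = ?N" "central_coeffs ?N"
      by (simp_all flip: single_of_nat add: central_coeffs_single)
    then show ?thesis
      by (simp add: adjoint_mult x adjoint_young_sym)
  qed
  moreover have "adjoint (?A * x * ?A) = ?A * adjoint x * ?A"
    by (simp add: adjoint_mult x central_coeffs_mult central_coeffs_young_sym adjoint_young_sym
        mult.assoc)
  ultimately have "?A * adjoint x * ?N = ?A * adjoint x * ?A"
    unfolding 1 by simp
  then show "?N * (x * ?A) = ?N * (?A * adjoint x)"
    unfolding 1 young_sym_adjoint[OF x(1), symmetric] by (simp add: mult_of_nat_commute)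
qed

section \<open>The action of the group algebra on tensor powers\<close>

text \<open>The permutation \<open>f\<close> acts by \<open>J = I \<circ> f\<close> on indices, as in \<^const>\<open>tperm\<close>. It is the composition of
  index functions with permutations, rather than with their inverses, that makes \<open>rep\<close>
  multiplicative.\<close>

definition rep :: "'b::ring_1 perm_alg \<Rightarrow> ('n, 'b) tmat"
  where "rep x I J =
    (\<Sum>f\<in>keys x. if J = I \<circ> act f then lookup x f else 0)"

lemma rep_eq_sum:
  assumes "finite S" "keys x \<subseteq> S"
  shows "rep x I J = (\<Sum>f\<in>S. if J = I \<circ> act f then lookup x f else 0)"
  unfolding rep_def using assms by (intro sum.mono_neutral_left) (auto simp: in_keys_iff)

lemma rep_single: "rep (single f c) I J = (if J = I \<circ> act f then c else 0)"
  by (subst rep_eq_sum[of "{f}"]) auto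

lemma rep_1: "rep 1 = tone"
  by (auto simp: fun_eq_iff rep_single tone_def simp flip: single_one)

lemma rep_add: "rep (x + y) I J = rep x I J + rep y I J"
proof -
  let ?S = "keys x \<union> keys y"
  show ?thesis
    using Poly_Mapping.keys_add[of x y]
    by (simp add: rep_eq_sum[of ?S] lookup_add flip: sum.distrib) (intro sum.cong, auto
        simp: lookup_add)
qed

lemma rep_0: "rep 0 I J = 0"
  by (simp add: rep_def)

lemma rep_diff: "rep (x - y) I J = rep x I J - rep y I J"
  using rep_add[of "x - y" y I J] by (simp add: eq_diff_eq)

lemma rep_sum: "rep (sum g S) I J = (\<Sum>i\<in>S. rep (g i) I J)"
  by (induction S rule: infinite_finite_induct) (simp_all add: rep_add rep_0)

lemma rep_mult:
  fixes x y :: "'b::ring_1 perm_alg"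
  assumes x: "supported k x" and I: "I \<in> midx k"
  shows "tmul k (rep x) (rep y) I J = rep (x * y) (I :: nat \<Rightarrow> 'n::finite) J"
proof -
  let ?t = "\<lambda>f g K. (if K = I \<circ> act f then lookup x f else 0) *
    (if J = K \<circ> act g then lookup y g else 0)"
  have "tmul k (rep x) (rep y) I J =
      (\<Sum>K\<in>midx k. \<Sum>f\<in>keys x. \<Sum>g\<in>keys y. ?t f g K)"
    by (simp add: tmul_def rep_def sum_product)
  also have "\<dots> = (\<Sum>f\<in>keys x. \<Sum>g\<in>keys y. \<Sum>K\<in>midx k. ?t f g K)"
    by (subst sum.swap) (intro sum.cong refl, rule sum.swap)
  also have "\<dots> = (\<Sum>f\<in>keys x. \<Sum>g\<in>keys y.
      if J = I \<circ> act (f + g) then lookup x f * lookup y g else 0)"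
  proof (intro sum.cong refl)
    fix f g assume "f \<in> keys x"
    then have f: "I \<circ> act f \<in> midx k"
      using x I by (intro midx_comp) (auto simp: supported_def sym_group_def)
    have "(\<Sum>K\<in>midx k. ?t f g K) = (\<Sum>K\<in>midx k. if K = I \<circ> act f then
        (if J = I \<circ> act (f + g) then lookup x f * lookup y g else 0) else 0)"
      by (intro sum.cong) (auto simp: comp_assoc)
    then show "(\<Sum>K\<in>midx k. ?t f g K) =
        (if J = I \<circ> act (f + g) then lookup x f * lookup y g else 0)"
      using f by simp
  qed
  also have "\<dots> = rep (x * y) I J"
    by (simp add: poly_mapping_mult_sum[of x y] rep_sum rep_single)
  finally show ?thesis .
qed

lemma rep_prod_list:
  assumes "\<And>x. x \<in> set xs \<Longrightarrow> supported k x" "I \<in> midx k"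
  shows "tprod k (map rep xs) I J = rep (prod_list xs) (I :: nat \<Rightarrow> 'n::finite) J"
  using assms
proof (induction xs arbitrary: I)
  case Nil
  then show ?case by (simp add: tprod_def rep_1)
next
  case (Cons x xs)
  have "tprod k (map rep (x # xs)) I J = tmul k (rep x) (tprod k (map rep xs)) I J"
    by (simp add: tprod_def)
  also have "\<dots> = tmul k (rep x) (rep (prod_list xs)) I J"
    using Cons by (intro tmul_cong_right) auto
  finally show ?case using Cons.prems by (simp add: rep_mult)
qed

lemma tmul_inverse_unique:
  assumes "\<And>I J. I \<in> midx k \<Longrightarrow> J \<in> midx k \<Longrightarrow> tmul k A B I J = tone I J"
    "\<And>I J. I \<in> midx k \<Longrightarrow> J \<in> midx k \<Longrightarrow> tmul k C A I J = tone I J"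
    and I: "I \<in> midx k" and J: "(J :: nat \<Rightarrow> 'n::finite) \<in> midx k"
  shows "B I J = C I J"
proof -
  have "B I J = tmul k tone B I J" using I by (simp add: tmul_tone_left)
  also have "\<dots> = tmul k (tmul k C A) B I J" using assms by (intro tmul_cong_left) simp
  also have "\<dots> = tmul k C (tmul k A B) I J" by (simp add: tmul_assoc)
  also have "\<dots> = tmul k C tone I J" using assms by (intro tmul_cong_right) simp
  also have "\<dots> = C I J" using J by (simp add: tmul_tone_right)
  finally show ?thesis .
qed

lemma tinv_rep:
  assumes A: "\<And>I J. I \<in> midx k \<Longrightarrow> J \<in> midx k \<Longrightarrow> A I J = rep x I J"
    and x: "supported k x" and y: "supported k y" and xy: "x * y = 1" "y * x = 1"
    and I: "I \<in> midx k" and J: "(J :: nat \<Rightarrow> 'n::finite) \<in> midx k"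
  shows "tinv k A I J = rep y I J"
proof -
  define B where "B = (\<lambda>I J. if I \<in> midx k \<and> J \<in> midx k then rep y I (J :: nat \<Rightarrow> 'n) else 0)"
  have AB: "tmul k A B I J = tone I J" "tmul k B A I J = tone I J"
    if "I \<in> midx k" "J \<in> midx k" for I J
  proof -
    have "tmul k A B I J = tmul k (rep x) (rep y) I J"
      unfolding tmul_def using that by (intro sum.cong) (auto simp: A B_def)
    then show "tmul k A B I J = tone I J"
      using rep_mult[OF x that(1)] by (simp add: xy rep_1)
    have "tmul k B A I J = tmul k (rep y) (rep x) I J"
      unfolding tmul_def using that by (intro sum.cong) (auto simp: A B_def)
    then show "tmul k B A I J = tone I J"
      using rep_mult[OF y that(1)] by (simp add: xy rep_1)
  qed
  have "tinv k A = B"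
    unfolding tinv_def
  proof (rule the_equality)
    show "(\<forall>I J. \<not> (I \<in> midx k \<and> J \<in> midx k) \<longrightarrow> B I J = 0) \<and>
        (\<forall>I\<in>midx k. \<forall>J\<in>midx k. tmul k A B I J = tone I J \<and> tmul k B A I J = tone I J)"
    proof (intro conjI allI impI ballI)
      show "B I J = 0" if "\<not> (I \<in> midx k \<and> J \<in> midx k)" for I J
        using that unfolding B_def by (rule if_not_P)
    qed (rule AB; assumption)+
  next
    fix C assume C: "(\<forall>I J. \<not> (I \<in> midx k \<and> J \<in> midx k) \<longrightarrow> C I J = 0) \<and>
        (\<forall>I\<in>midx k. \<forall>J\<in>midx k. tmul k A C I J = tone I J \<and> tmul k C A I J = tone I J)"
    show "C = B"
    proof (intro ext)
      fix I J
      show "C I J = B I J"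
      proof (cases "I \<in> midx k \<and> J \<in> midx k")
        case True
        show ?thesis
          by (rule tmul_inverse_unique[of k A C B]) (use True C AB(2) in blast)+
      next
        case False
        then show ?thesis using C by (auto simp: B_def)
      qed
    qed
  qed
  then show ?thesis using I J by (simp add: B_def)
qed


section \<open>Fusion of R-matrices\<close>

definition rbar_el :: "int \<Rightarrow> 'b \<Rightarrow> 'b \<Rightarrow> nat \<Rightarrow> nat \<Rightarrow> 'b::ring_1 perm_alg"
  where "rbar_el s h x i j = single 0 (x * ring_inv (x - of_int s * h)) -
    single (Perm.swap i j) (x * ring_inv (x - of_int s * h) * (h * ring_inv x))"

lemma rep_rbar_el: "rep (rbar_el s h x i j) = Rbar s i j h x"
  by (auto simp: fun_eq_iff rbar_el_def rep_diff rep_single Rbar_def R_mat_def tone_def tperm_def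
      right_diff_distrib mult.assoc)

lemma supported_rbar_el:
  "i \<in> {1..k} \<Longrightarrow> j \<in> {1..k} \<Longrightarrow> supported k (rbar_el s h x i j)"
  unfolding rbar_el_def
  by (intro supported_diff supported_single sym_group_0 sym_group_swap)

lemma central_coeffs_rbar_el:
  "central x \<Longrightarrow> central h \<Longrightarrow> unit_el x \<Longrightarrow> unit_el (x - of_int s * h) \<Longrightarrow>
    central_coeffs (rbar_el s h x i j)"
  unfolding rbar_el_def by (intro central_coeffs_diff central_coeffs_single) simp_all

lemma adjoint_rbar_el: "adjoint (rbar_el s h x i j) = rbar_el s h x i j"
proof -
  have "adjoint (x - y) = adjoint x - adjoint y" for x y :: "'a perm_alg"
    using adjoint_add[of "x - y" y] by (simp add: eq_diff_eq)
  then show ?thesis by (simp add: rbar_el_def)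
qed

abbreviation scal :: "'b \<Rightarrow> 'b::ring_1 perm_alg"
  where "scal c \<equiv> single 0 c"

lemma rbar_el_eq:
  assumes "central x" "central h" "unit_el x" "unit_el (x - of_int s * h)"
  shows "rbar_el s h x i j =
    scal (ring_inv (x - of_int s * h)) * (scal x - scal h * perm_el (Perm.swap i j))"
proof -
  let ?d = "ring_inv (x - of_int s * h)"
  have d: "central ?d" using assms by simp
  have "x * ?d * (h * ring_inv x) = ?d * h"
  proof -
    have "x * ?d * (h * ring_inv x) = ?d * (x * (h * ring_inv x))"
      using centralD[OF assms(1), of ?d] by (simp add: mult.assoc)
    also have "x * (h * ring_inv x) = h * (x * ring_inv x)"
      using central_left_commute[OF assms(2)] .
    finally show ?thesis using assms(3) by (simp add: unit_el_ring_inv)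
  qed
  then show ?thesis
    using centralD[OF assms(1), of ?d]
    by (simp add: rbar_el_def right_diff_distrib mult_single)
qed

lemma central_mult_mult: "central e \<Longrightarrow> (d * a) * (e * b) = d * e * (a * b)"
  by (simp only: mult.assoc central_left_commute[of e a b])

text \<open>The inverse of $(x-hP)/(x-sh)$ is $(x+hP)/(x+sh)$, since $P^2=1$ and $s^2=1$.\<close>

lemma unit_el_rbar_el:
  assumes s: "s = 1 \<or> s = -1" and c: "central x" "central h"
    and u: "unit_el x" "unit_el (x - of_int s * h)" "unit_el (x + of_int s * h)"
    and ij: "i \<in> {1..k}" "j \<in> {1..k}"
  shows "\<exists>y. supported k y \<and> rbar_el s h x i j * y = 1 \<and> y * rbar_el s h x i j = 1"
proof -
  let ?d = "ring_inv (x - of_int s * h)" and ?e = "ring_inv (x + of_int s * h)"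
  let ?P = "perm_el (Perm.swap i j) :: 'a perm_alg"
  let ?y = "scal ?e * (scal x + scal h * ?P)"
  have de: "central (scal ?d)" "central (scal ?e)" using c u by simp_all
  have xh: "central (scal x)" "central (scal h)" using c by simp_all
  have P: "?P * ?P = 1" by (simp add: mult_single)
  have sq: "(scal x - scal h * ?P) * (scal x + scal h * ?P) =
      scal ((x - of_int s * h) * (x + of_int s * h))"
    "(scal x + scal h * ?P) * (scal x - scal h * ?P) =
        scal ((x - of_int s * h) * (x + of_int s * h))"
    using s centralD[OF c(1), of h]
    by (auto simp: algebra_simps mult_single simp flip: single_add single_diff)
  have one: "?d * ?e * ((x - of_int s * h) * (x + of_int s * h)) = 1"
  proof -
    have "?e * ((x - of_int s * h) * (x + of_int s * h)) =
        (x - of_int s * h) * (?e * (x + of_int s * h))"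
      using c by (intro central_left_commute) simp
    then show ?thesis using u by (simp add: unit_el_ring_inv mult.assoc)
  qed
  have "rbar_el s h x i j * ?y = scal ?d * scal ?e * ((scal x - scal h * ?P) * (scal x +
      scal h * ?P))"
    unfolding rbar_el_eq[OF c u(1,2)] by (rule central_mult_mult[OF de(2)])
  also have "\<dots> = 1" unfolding sq(1) by (simp only: mult_single add_0_left one single_one)
  finally have 1: "rbar_el s h x i j * ?y = 1" .
  have "?y * rbar_el s h x i j = scal ?d * scal ?e * ((scal x + scal h * ?P) * (scal x -
      scal h * ?P))"
    unfolding rbar_el_eq[OF c u(1,2)]
    by (simp only: central_mult_mult[OF de(1)] centralD[OF de(2), of "scal ?d"])
  also have "\<dots> = 1" unfolding sq(2) by (simp only: mult_single add_0_left one single_one)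
  finally have 2: "?y * rbar_el s h x i j = 1" .
  have "supported k ?y"
    by (intro supported_mult supported_add supported_single sym_group_0 sym_group_swap ij)
  with 1 2 show ?thesis by blast
qed

text \<open>The Yang--Baxter equation at the value of the spectral parameter at which one of its three
  R-matrices degenerates to a (skew-)symmetrizer.\<close>

lemma fused_yang_baxter:
  fixes p q r X H :: "'a::ring_1"
  assumes X: "central X" and H: "central H" and s: "s = 1 \<or> s = -1"
    and rel: "p * p = 1" "q * q = 1" "r * r = 1" "q * r = p * q" "r * p = p * q" "q * p = p * r"
        "r * q = p * r"
  shows "(1 + of_int s * p) * (X - H * q) * (X + of_int s * H - H * r) =
    (X + of_int s * H - H * r) * (X - H * q) * (1 + of_int s * p)"
proof -
  have rel': "p * (p * z) = z" "q * (q * z) = z" "r * (r * z) = z" "q * (r * z) = p * (q * z)"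
    "r * (p * z) = p * (q * z)" "q * (p * z) = p * (r * z)" "r * (q * z) = p * (r * z)" for z
    by (simp_all add: rel flip: mult.assoc)
  have c: "t * X = X * t" "t * H = H * t" for t
    by (simp_all only: centralD[OF X, of t] centralD[OF H, of t])
  have c': "t * (X * z) = X * (t * z)" "t * (H * z) = H * (t * z)" for t z
    by (simp_all only: central_left_commute[OF X, of t z] central_left_commute[OF H, of t z])
  note comm = c[of p] c[of q] c[of r] c(1)[of H] c'[of p] c'[of q] c'[of r] c'(1)[of H]
  show ?thesis
    using s by (elim disjE) (simp_all add: distrib_left distrib_right left_diff_distrib
        right_diff_distrib mult.assoc rel rel' comm algebra_simps)
qed

lemma swap_relations:
  assumes "i \<noteq> j" "j \<noteq> k" "i \<noteq> k"
  defines "p \<equiv> perm_el (Perm.swap i j)" and "q \<equiv> perm_el (Perm.swap i k)" and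
      "r \<equiv> perm_el (Perm.swap j k)"
  shows "p * p = 1" "q * q = 1" "r * r = 1" "q * r = p * q" "r * p = p * q" "q * p = p * r"
      "r * q = p * r"
proof -
  have "Perm.swap i k + Perm.swap j k = Perm.swap i j + Perm.swap i k"
    "Perm.swap j k + Perm.swap i j = Perm.swap i j + Perm.swap i k"
    "Perm.swap i k + Perm.swap i j = Perm.swap i j + Perm.swap j k"
    "Perm.swap j k + Perm.swap i k = Perm.swap i j + Perm.swap j k"
    using assms by (auto intro!: perm_eqI simp: transpose_def)
  then show "p * p = 1" "q * q = 1" "r * r = 1" "q * r = p * q" "r * p = p * q" "q * p = p * r"
      "r * q = p * r"
    unfolding p_def q_def r_def by (simp_all add: mult_single)
qed

lemma fused_rbar_el:
  assumes s: "s = 1 \<or> s = -1" and c: "central x" "central y" "central h"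
    and u: "unit_el x" "unit_el (x - of_int s * h)" "unit_el y" "unit_el (y - of_int s * h)"
    and y: "y = x + of_int s * h" and ijk: "i \<noteq> j" "j \<noteq> k" "i \<noteq> k"
  shows "rbar_el s h y j k * rbar_el s h x i k * (1 + of_int s * perm_el (Perm.swap i j)) =
    (1 + of_int s * perm_el (Perm.swap i j)) * (rbar_el s h x i k * rbar_el s h y j k)"
proof -
  let ?p = "perm_el (Perm.swap i j)" and ?q = "perm_el (Perm.swap i k)"
    and ?r = "perm_el (Perm.swap j k) :: 'a perm_alg"
  let ?dx = "scal (ring_inv (x - of_int s * h))" and ?dy = "scal (ring_inv (y - of_int s * h))"
  let ?fx = "scal x - scal h * ?q" and ?fy = "scal y - scal h * ?r" and ?a = "1 + of_int s * ?p"
  have d: "central ?dx" "central ?dy" using c u by simp_all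
  have "(scal y :: 'a perm_alg) = scal x + of_int s * scal h"
    by (simp add: y single_add mult_single flip: single_of_int)
  then have yb: "?a * ?fx * ?fy = ?fy * ?fx * ?a"
    using fused_yang_baxter[OF _ _ s swap_relations[OF ijk], of "scal x" "scal h"] c by simp
  have "?dy * ?fy * (?dx * ?fx) = ?dx * ?dy * (?fy * ?fx)"
    by (simp only: central_mult_mult[OF d(1)] centralD[OF d(1), of ?dy])
  then have "?dy * ?fy * (?dx * ?fx) * ?a = ?dx * ?dy * (?fy * ?fx * ?a)"
    by (simp only: mult.assoc)
  also have "\<dots> = ?dx * ?dy * (?a * (?fx * ?fy))"
    unfolding yb[symmetric] by (simp only: mult.assoc)
  also have "\<dots> = ?a * (?dx * ?fx * (?dy * ?fy))"
    by (simp only: central_mult_mult[OF d(2)] central_left_commute[OF central_mult[OF d]])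
  finally show ?thesis
    unfolding rbar_el_eq[OF c(1,3) u(1,2)] rbar_el_eq[OF c(2,3) u(3,4)] .
qed


section \<open>Products of R-matrices\<close>

lemma prod_list_intertwine:
  fixes f g :: "'i \<Rightarrow> 'a::monoid_mult"
  assumes "\<And>i. i \<in> set is \<Longrightarrow> f i * a = a * g i"
  shows "prod_list (map f is) * a = a * prod_list (map g is)"
  using assms
proof (induction "is")
  case (Cons i "is")
  have IH: "prod_list (map f is) * a = a * prod_list (map g is)" using Cons by simp
  have "prod_list (map f (i # is)) * a = f i * (prod_list (map f is) * a)" by (simp add: mult.assoc)
  also have "\<dots> = f i * a * prod_list (map g is)" unfolding IH by (simp only: mult.assoc)
  also have "\<dots> = a * g i * prod_list (map g is)" using Cons.prems[of i] by simp
  finally show ?case by (simp add: mult.assoc)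
qed simp

lemma prod_list_commute:
  fixes x :: "'a::monoid_mult"
  assumes "\<And>i. i \<in> set is \<Longrightarrow> x * f i = f i * x"
  shows "x * prod_list (map f is) = prod_list (map f is) * x"
  using prod_list_intertwine[of "is" f x f] assms by metis

text \<open>A row is merged with the column products of the remaining rows one column at a time; its
  later factors then only have to pass columns other than their own.\<close>

lemma double_prod_swap:
  fixes F :: "'i \<Rightarrow> 'j \<Rightarrow> 'a::monoid_mult"
  assumes "distinct is" "distinct js"
    and "\<And>i i' j j'. i \<in> set is \<Longrightarrow> i' \<in> set is \<Longrightarrow> j \<in> set js \<Longrightarrow> j' \<in> set js \<Longrightarrow>
      i \<noteq> i' \<Longrightarrow> j \<noteq> j' \<Longrightarrow> F i j * F i' j' = F i' j' * F i j"
  shows "prod_list (map (\<lambda>i. prod_list (map (F i) js)) is) =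
    prod_list (map (\<lambda>j. prod_list (map (\<lambda>i. F i j) is)) js)"
  using assms
proof (induction "is")
  case Nil
  then show ?case by (induction js) auto
next
  case (Cons i "is")
  let ?C = "\<lambda>j. prod_list (map (\<lambda>i. F i j) is)"
  have comm: "?C j * F i j' = F i j' * ?C j" if "j \<in> set js" "j' \<in> set js" "j \<noteq> j'" for j j'
    using that Cons.prems(1) by (intro prod_list_commute[symmetric] Cons.prems(3)) auto
  have "prod_list (map (F i) js') * prod_list (map ?C js') = prod_list (map (\<lambda>j. F i j * ?C j) js')"
    if "distinct js'" "set js' \<subseteq> set js" for js'
    using that
  proof (induction js')
    case (Cons j js')
    have "?C j * prod_list (map (F i) js') = prod_list (map (F i) js') * ?C j"
      using Cons.prems by (intro prod_list_commute comm) auto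
    note swap = this
    have "F i j * prod_list (map (F i) js') * (?C j * prod_list (map ?C js')) =
        F i j * (prod_list (map (F i) js') * ?C j) * prod_list (map ?C js')"
      by (simp only: mult.assoc)
    also have "\<dots> = F i j * ?C j * (prod_list (map (F i) js') * prod_list (map ?C js'))"
      unfolding swap[symmetric] by (simp only: mult.assoc)
    finally show ?case using Cons by simp
  qed simp
  from this[OF \<open>distinct js\<close>] show ?case
    using Cons by simp
qed

lemma adjacent_intertwine:
  fixes f :: "'i \<Rightarrow> 'a::monoid_mult"
  assumes "f x * f y * a = a * (f y * f x)"
    and "\<And>z. z \<in> set xs \<union> set ys \<Longrightarrow> f z * a = a * f z"
  shows "prod_list (map f (xs @ [x, y] @ ys)) * a = a * prod_list (map f (xs @ [y, x] @ ys))"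
proof -
  let ?x = "prod_list (map f xs)" and ?y = "prod_list (map f ys)"
  have xy: "?x * a = a * ?x" "?y * a = a * ?y"
    by (rule prod_list_intertwine, rule assms(2), simp)+
  have "prod_list (map f (xs @ [x, y] @ ys)) * a = ?x * (f x * f y) * (?y * a)"
    by (simp add: mult.assoc)
  also have "\<dots> = ?x * (f x * f y * a) * ?y" unfolding xy by (simp only: mult.assoc)
  also have "\<dots> = (?x * a) * (f y * f x) * ?y" unfolding assms(1) by (simp only: mult.assoc)
  also have "\<dots> = a * prod_list (map f (xs @ [y, x] @ ys))" unfolding xy by (simp add: mult.assoc)
  finally show ?thesis .
qed

lemma upt_split_adjacent:
  assumes "a \<le> j" "Suc j < b"
  shows "[a..<b] = [a..<j] @ [j, Suc j] @ [Suc (Suc j)..<b]"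
proof -
  have "[a..<b] = [a..<j] @ [j..<b]"
    using upt_add_eq_append[of a j "b - j"] assms by simp
  also have "[j..<b] = [j, Suc j] @ [Suc (Suc j)..<b]"
    using assms by (simp add: upt_conv_Cons)
  finally show ?thesis .
qed

lemma rbar_el_commute_perm_el:
  assumes "{i, j} \<inter> {k, l} = {}"
  shows "rbar_el s h x i j * perm_el (Perm.swap k l) = perm_el (Perm.swap k l) * rbar_el s h x i j"
proof -
  have "Perm.swap i j + Perm.swap k l = Perm.swap k l + Perm.swap i j"
    using assms by (auto intro!: perm_eqI simp: transpose_def)
  then show ?thesis
    by (simp add: rbar_el_def left_diff_distrib right_diff_distrib mult_single)
qed

lemma rbar_el_commute:
  assumes "{i, j} \<inter> {k, l} = {}" "central y" "central h" "unit_el y" "unit_el (y - of_int s * h)"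
  shows "rbar_el s h x i j * rbar_el s h y k l = rbar_el s h y k l * rbar_el s h x i j"
proof -
  let ?r = "rbar_el s h x i j" and ?P = "perm_el (Perm.swap k l) :: 'a perm_alg"
  have c: "central (scal (ring_inv (y - of_int s * h)))" "central (scal y)" "central (scal h)"
    using assms by simp_all
  have "?r * (scal y - scal h * ?P) = (scal y - scal h * ?P) * ?r"
    unfolding right_diff_distrib left_diff_distrib centralD[OF c(2)] central_left_commute[OF c(3)]
      rbar_el_commute_perm_el[OF assms(1)] by (simp only: mult.assoc)
  then show ?thesis
    unfolding rbar_el_eq[OF assms(2-5)] by (simp only: central_left_commute[OF c(1)] mult.assoc)
qed

lemma prod_list_supported_inverse:
  assumes "\<And>x. x \<in> set xs \<Longrightarrow> \<exists>y. supported k y \<and> x * y = 1 \<and> y * x = 1"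
  shows "\<exists>y. supported k y \<and> prod_list xs * y = 1 \<and> y * prod_list xs = 1"
  using assms
proof (induction xs)
  case Nil
  then show ?case by (intro exI[of _ 1]) (simp add: supported_1)
next
  case (Cons x xs)
  obtain y where y: "supported k y" "x * y = 1" "y * x = 1" using Cons.prems by auto
  obtain z where z: "supported k z" "prod_list xs * z = 1" "z * prod_list xs = 1"
    using Cons by auto
  have "x * prod_list xs * (z * y) = x * (prod_list xs * z) * y"
    "z * y * (x * prod_list xs) = z * (y * x) * prod_list xs" by (simp_all only: mult.assoc)
  then show ?case
    using y z by (intro exI[of _ "z * y"]) (simp add: supported_mult)
qed

definition r_list :: "(nat \<Rightarrow> nat \<Rightarrow> 'a) \<Rightarrow> nat \<Rightarrow> nat \<Rightarrow> 'a list"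
  where "r_list F n m = [F i j. i \<leftarrow> [1..<n + 1], j \<leftarrow> rev [n + 1..<n + m + 1]]"

definition r_list_bar :: "(nat \<Rightarrow> nat \<Rightarrow> 'a) \<Rightarrow> nat \<Rightarrow> nat \<Rightarrow> 'a list"
  where "r_list_bar F n m = [F i j. i \<leftarrow> rev [1..<n + 1], j \<leftarrow> [n + 1..<n + m + 1]]"

lemma rev_r_list_bar: "rev (r_list_bar F n m) = r_list F n m"
  by (simp add: r_list_def r_list_bar_def rev_concat rev_map comp_def del: upt_Suc)

lemma set_r_list:
  "set (r_list F n m) = {F i j | i j. i \<in> {1..n} \<and> j \<in> {n + 1..n + m}}"
  "set (r_list_bar F n m) = {F i j | i j. i \<in> {1..n} \<and> j \<in> {n + 1..n + m}}"
  unfolding r_list_def r_list_bar_def by (auto simp del: upt_Suc) (force simp del: upt_Suc)+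

lemma prod_r_list_bar:
  fixes F :: "nat \<Rightarrow> nat \<Rightarrow> 'a::monoid_mult"
  shows "prod_list (r_list_bar F n m) =
    prod_list (map (\<lambda>i. prod_list (map (F i) [n + 1..<n + m + 1])) (rev [1..<n + 1]))"
proof -
  have "prod_list (concat xss) = prod_list (map prod_list xss)" for xss :: "'a list list"
    by (induction xss) auto
  then show ?thesis by (simp add: r_list_bar_def comp_def del: upt_Suc)
qed

text \<open>The parameter \<open>X i j\<close> is the argument $z+u_i-v_{j-n}$ of the R-matrix on the factors \<open>i\<close> and
  \<open>j\<close>.\<close>

locale r_matrices =
  fixes s :: int and h :: "'b::ring_1" and X :: "nat \<Rightarrow> nat \<Rightarrow> 'b" and n m :: nat
  assumes s: "s = 1 \<or> s = -1"
    and central_h: "central h"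
    and central_X: "central (X i j)"
    and unit_X: "i \<in> {1..n} \<Longrightarrow> j \<in> {n + 1..n + m} \<Longrightarrow> unit_el (X i j + of_int k * h)"
begin

definition factor_el :: "nat \<Rightarrow> nat \<Rightarrow> 'b perm_alg"
  where "factor_el i j = rbar_el s h (X i j) i j"

definition R_el :: "'b perm_alg" where "R_el = prod_list (r_list factor_el n m)"
definition R_bar_el :: "'b perm_alg" where "R_bar_el = prod_list (r_list_bar factor_el n m)"

lemma units:
  assumes "i \<in> {1..n}" "j \<in> {n + 1..n + m}"
  shows "unit_el (X i j)" "unit_el (X i j - of_int s * h)" "unit_el (X i j + of_int s * h)"
  using unit_X[OF assms, of 0] unit_X[OF assms, of "- s"] unit_X[OF assms, of s] by simp_all

lemma factor_el:
  assumes "i \<in> {1..n}" "j \<in> {n + 1..n + m}"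
  shows "supported (n + m) (factor_el i j)" "central_coeffs (factor_el i j)"
    "adjoint (factor_el i j) = factor_el i j"
    "\<exists>y. supported (n + m) y \<and> factor_el i j * y = 1 \<and> y * factor_el i j = 1"
  unfolding factor_el_def using assms units[OF assms]
  by (auto intro!: supported_rbar_el central_coeffs_rbar_el adjoint_rbar_el unit_el_rbar_el s
      central_X central_h)

lemma
  shows supported_R_bar_el: "supported (n + m) R_bar_el"
    and supported_R_el: "supported (n + m) R_el"
    and central_coeffs_R_bar_el: "central_coeffs R_bar_el"
    and adjoint_R_bar_el: "adjoint R_bar_el = R_el"
    and R_el_inverse: "\<exists>y. supported (n + m) y \<and> R_el * y = 1 \<and> y * R_el = 1"
    and R_bar_el_inverse: "\<exists>y. supported (n + m) y \<and> R_bar_el * y = 1 \<and> y * R_bar_el = 1"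
proof -
  show "supported (n + m) R_bar_el" "supported (n + m) R_el"
    unfolding R_bar_el_def R_el_def
    by (rule supported_prod_list; auto simp: set_r_list factor_el)+
  show "central_coeffs R_bar_el"
    unfolding R_bar_el_def by (rule central_coeffs_prod_list) (auto simp: set_r_list factor_el)
  show "adjoint R_bar_el = R_el"
    unfolding R_bar_el_def R_el_def rev_r_list_bar[symmetric]
    by (rule adjoint_prod_list) (auto simp: set_r_list factor_el)
  show "\<exists>y. supported (n + m) y \<and> R_el * y = 1 \<and> y * R_el = 1"
    unfolding R_el_def by (rule prod_list_supported_inverse) (auto simp: set_r_list factor_el)
  show "\<exists>y. supported (n + m) y \<and> R_bar_el * y = 1 \<and> y * R_bar_el = 1"
    unfolding R_bar_el_def by (rule prod_list_supported_inverse) (auto simp: set_r_list factor_el)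
qed

end

text \<open>Neighbouring parameters differ by \<open>sh\<close> as they do after the specialization $u_i=u+s(i-1)h$,
  $v_j=v+s(j-1)h$.\<close>

locale fused_r_matrices = r_matrices s h X n m
  for s :: int and h :: "'b::ring_1" and X and n m :: nat +
  assumes rational: "rational TYPE('b)"
    and X_Suc_left: "X (Suc i) j = X i j + of_int s * h"
    and X_Suc_right: "X i j = X i (Suc j) + of_int s * h"
begin

abbreviation fuse :: "nat \<Rightarrow> 'b perm_alg"
  where "fuse i \<equiv> 1 + of_int s * perm_el (Perm.swap i (Suc i))"

lemma factor_el_left:
  assumes "i \<in> {1..<n}" "j \<in> {n + 1..n + m}"
  shows "factor_el (Suc i) j * factor_el i j * fuse i =
      fuse i * (factor_el i j * factor_el (Suc i) j)"
  unfolding factor_el_def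
  by (rule fused_rbar_el[OF s])
    (use assms in \<open>auto intro!: central_X central_h units X_Suc_left\<close>)

lemma factor_el_right:
  assumes "i \<in> {1..n}" "j \<in> {n + 1..<n + m}"
  shows "factor_el i j * factor_el i (Suc j) * fuse j =
      fuse j * (factor_el i (Suc j) * factor_el i j)"
proof -
  have "rbar_el s h (X i j) j i * rbar_el s h (X i (Suc j)) (Suc j) i *
      (1 + of_int s * perm_el (Perm.swap (Suc j) j)) =
    (1 + of_int s * perm_el (Perm.swap (Suc j) j)) *
      (rbar_el s h (X i (Suc j)) (Suc j) i * rbar_el s h (X i j) j i)"
    by (rule fused_rbar_el[OF s])
      (use assms in \<open>auto intro!: central_X central_h units X_Suc_right\<close>)
  then show ?thesis
    unfolding factor_el_def rbar_el_def by (simp add: Perm.swap_sym[of i]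
        Perm.swap_sym[of "Suc j" j])
qed

lemma factor_el_fuse:
  assumes "i \<noteq> k" "i \<noteq> Suc k" "j \<noteq> k" "j \<noteq> Suc k"
  shows "factor_el i j * fuse k = fuse k * factor_el i j"
proof -
  have "factor_el i j * perm_el (Perm.swap k (Suc k)) = perm_el (Perm.swap k (Suc k)) * factor_el
      i j"
    unfolding factor_el_def using assms by (intro rbar_el_commute_perm_el) auto
  then show ?thesis
    by (simp only: distrib_left distrib_right mult_1_left mult_1_right mult.assoc
        central_left_commute[OF central_of_int])
qed

lemma factor_el_commute:
  assumes "i \<noteq> i'" "j \<noteq> j'" "i \<in> {1..n}" "i' \<in> {1..n}" "j \<in> {n + 1..n + m}" "j' \<in> {n + 1..n + m}"
  shows "factor_el i j * factor_el i' j' = factor_el i' j' * factor_el i j"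
  unfolding factor_el_def
  by (rule rbar_el_commute) (use assms in \<open>auto intro!: central_X central_h units\<close>)

text \<open>For \<open>k\<close> in the second block each row of the double product contains the factors with columns
  \<open>k\<close> and \<open>k + 1\<close> next to each other. For \<open>k\<close> in the first block the product is first rearranged
  column by column.\<close>

lemma R_bar_el_fuse:
  assumes k: "k \<in> adjacents n m"
  shows "\<exists>x. R_bar_el * fuse k = fuse k * x"
proof (cases "k \<in> {1..<n}")
  case True
  let ?js = "[n + 1..<n + m + 1]"
  have split: "rev [1..<n + 1] = rev [Suc (Suc k)..<n + 1] @ [Suc k, k] @ rev [1..<k]"
    using upt_split_adjacent[of 1 k "n + 1"] True by (simp del: upt_Suc)
  have "R_bar_el = prod_list (map (\<lambda>j. prod_list (map (\<lambda>i. factor_el i j) (rev [1..<n + 1]))) ?js)"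
    unfolding R_bar_el_def prod_r_list_bar
    by (rule double_prod_swap) (auto intro!: factor_el_commute simp del: upt_Suc)
  moreover have "prod_list (map (\<lambda>j. prod_list (map (\<lambda>i. factor_el i j) (rev [1..<n + 1]))) ?js) *
      fuse k =
    fuse k * prod_list (map (\<lambda>j. prod_list (map (\<lambda>i. factor_el i j)
      (rev [Suc (Suc k)..<n + 1] @ [k, Suc k] @ rev [1..<k]))) ?js)"
    unfolding split
    by (intro prod_list_intertwine adjacent_intertwine factor_el_left factor_el_fuse)
      (use True in \<open>auto simp del: upt_Suc\<close>)
  ultimately show ?thesis by metis
next
  case False
  with k have k: "k \<in> {n + 1..<n + m}" by (auto simp: adjacents_def)
  have split: "[n + 1..<n + m + 1] = [n + 1..<k] @ [k, Suc k] @ [Suc (Suc k)..<n + m + 1]"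
    using k by (intro upt_split_adjacent) auto
  have "R_bar_el * fuse k = fuse k * prod_list (map (\<lambda>i. prod_list (map (factor_el i)
      ([n + 1..<k] @ [Suc k, k] @ [Suc (Suc k)..<n + m + 1]))) (rev [1..<n + 1]))"
    unfolding R_bar_el_def prod_r_list_bar split
    by (intro prod_list_intertwine adjacent_intertwine factor_el_right factor_el_fuse)
      (use k in \<open>auto simp del: upt_Suc\<close>)
  then show ?thesis ..
qed

text \<open>Since \<open>A\<close> is half of \<open>fuse k * A\<close>, moving \<open>fuse k\<close> through the product exhibits it as a left
  factor of \<open>R_bar_el * A\<close>, and \<open>fuse k\<close> absorbs the transposition of \<open>k\<close> and \<open>k + 1\<close>.\<close>

lemma R_bar_el_young_sym: "R_bar_el * young_sym s n m = young_sym s n m * R_el"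
proof -
  let ?A = "young_sym s n m :: 'b perm_alg"
  have "perm_el (Perm.swap k (Suc k)) * (R_bar_el * ?A) = of_int s * (R_bar_el * ?A)"
    if k: "k \<in> adjacents n m" for k
  proof (rule rational_cancel[OF rational, of 2])
    let ?P = "perm_el (Perm.swap k (Suc k)) :: 'b perm_alg"
    obtain x where x: "R_bar_el * fuse k = fuse k * x" using R_bar_el_fuse[OF k] ..
    have ss: "of_int s * (of_int s * z) = z" for z :: "'b perm_alg" using s by auto
    have PA: "?P * ?A = of_int s * ?A"
      using perm_el_young_sym(1)[OF adjacent_in_young[OF k], of s] eps_swap[OF s, of k "Suc k"]
          by simp
    have fA: "fuse k * ?A = of_nat 2 * ?A"
      by (simp add: distrib_right mult.assoc PA ss mult_2)
    have "of_nat 2 * (R_bar_el * ?A) = R_bar_el * (fuse k * ?A)"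
      unfolding fA by (rule central_left_commute[OF central_of_nat, symmetric])
    also have "\<dots> = fuse k * (x * ?A)"
      by (simp only: x flip: mult.assoc)
    finally have 1: "of_nat 2 * (R_bar_el * ?A) = fuse k * (x * ?A)" .
    have PP: "?P * (of_int s * (?P * z)) = of_int s * z" for z
    proof -
      have "?P * (of_int s * (?P * z)) = of_int s * (?P * ?P * z)"
        by (simp only: central_left_commute[OF central_of_int] mult.assoc)
      then show ?thesis by (simp add: mult_single)
    qed
    have 2: "?P * (fuse k * z) = of_int s * (fuse k * z)" for z
      by (simp add: distrib_left distrib_right mult.assoc PP ss add.commute)
    have "of_nat 2 * (?P * (R_bar_el * ?A)) = ?P * (of_nat 2 * (R_bar_el * ?A))"
      by (rule central_left_commute[OF central_of_nat, symmetric])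
    also have "\<dots> = of_int s * (of_nat 2 * (R_bar_el * ?A))"
      unfolding 1 by (rule 2)
    also have "\<dots> = of_nat 2 * (of_int s * (R_bar_el * ?A))"
      by (rule central_left_commute[OF central_of_nat])
    finally show "of_nat 2 * (?P * (R_bar_el * ?A)) = of_nat 2 * (of_int s * (R_bar_el * ?A))" .
  qed simp
  then show ?thesis
    using symmetrized_adjoint_commute[OF rational s supported_R_bar_el central_coeffs_R_bar_el]
    by (simp add: adjoint_R_bar_el)
qed

text \<open>Conjugation of the intertwining relation by the inverses turns it into $AR^{-1}=R'^{-1}A$,
  and the two relations move all R-matrices to the outside of $A\cdot A$, where they cancel.\<close>

lemma symmetrized_R_quotient:
  assumes "R_el * y = 1"
  shows "young_sym s n m * (y * R_bar_el) * young_sym s n m =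
    of_nat (card (young n m)) * young_sym s n m"
proof -
  let ?A = "young_sym s n m :: 'b perm_alg"
  obtain z where z: "z * R_bar_el = 1" using R_bar_el_inverse by blast
  have "?A * y = z * (R_bar_el * ?A) * y" using z by (simp flip: mult.assoc)
  also have "\<dots> = z * ?A * (R_el * y)" unfolding R_bar_el_young_sym by (simp add: mult.assoc)
  finally have Ay: "?A * y = z * ?A" using assms by simp
  have "?A * (y * R_bar_el) * ?A = (?A * y) * (R_bar_el * ?A)" by (simp add: mult.assoc)
  also have "\<dots> = z * (?A * ?A) * R_el" unfolding Ay R_bar_el_young_sym by (simp add: mult.assoc)
  also have "\<dots> = of_nat (card (young n m)) * (z * (?A * R_el))"
    unfolding young_sym_square[OF s]
    by (simp only: mult.assoc central_left_commute[OF central_of_nat])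
  also have "z * (?A * R_el) = ?A" unfolding R_bar_el_young_sym[symmetric] using z
      by (simp flip: mult.assoc)
  finally show ?thesis .
qed

end

section \<open>Embeddings into the tensor square\<close>

definition ring_hom_fun :: "('a::ring_1 \<Rightarrow> 'b::ring_1) \<Rightarrow> bool"
  where "ring_hom_fun \<phi> \<longleftrightarrow>
    \<phi> 1 = 1 \<and> (\<forall>x y. \<phi> (x + y) = \<phi> x + \<phi> y) \<and> (\<forall>x y. \<phi> (x * y) = \<phi> x * \<phi> y)"

lemma ring_hom_funD:
  assumes "ring_hom_fun \<phi>"
  shows "\<phi> 1 = 1" "\<phi> (x + y) = \<phi> x + \<phi> y" "\<phi> (x * y) = \<phi> x * \<phi> y" "\<phi> 0 = 0" "\<phi> (- x) = - \<phi> x"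
    "\<phi> (x - y) = \<phi> x - \<phi> y"
proof -
  show "\<phi> 1 = 1" and add: "\<And>x y. \<phi> (x + y) = \<phi> x + \<phi> y" and "\<phi> (x * y) = \<phi> x * \<phi> y"
    using assms by (auto simp: ring_hom_fun_def)
  show 0: "\<phi> 0 = 0" using add[of 0 0] by simp
  show uminus: "\<And>x. \<phi> (- x) = - \<phi> x"
    using add[of _ "- _"] 0 by (metis add.right_inverse minus_unique)
  show "\<phi> (x - y) = \<phi> x - \<phi> y" using add[of x "- y"] uminus[of y] by simp
qed

lemma ring_hom_fun_sum: "ring_hom_fun \<phi> \<Longrightarrow> \<phi> (sum f I) = (\<Sum>i\<in>I. \<phi> (f i))"
  by (induction I rule: infinite_finite_induct) (simp_all add: ring_hom_funD)

lemma ring_hom_fun_prod_list: "ring_hom_fun \<phi> \<Longrightarrow> \<phi> (prod_list xs) = prod_list (map \<phi> xs)"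
  by (induction xs) (simp_all add: ring_hom_funD)

lemma ring_hom_fun_of_nat: "ring_hom_fun \<phi> \<Longrightarrow> \<phi> (of_nat k) = of_nat k"
  by (induction k) (simp_all add: ring_hom_funD)

lemma ring_hom_fun_of_int: "ring_hom_fun \<phi> \<Longrightarrow> \<phi> (of_int k) = of_int k"
  by (cases k) (simp_all add: ring_hom_funD ring_hom_fun_of_nat del: of_nat_Suc)

lemma ring_hom_fun_compose: "ring_hom_fun \<phi> \<Longrightarrow> ring_hom_fun \<psi> \<Longrightarrow> ring_hom_fun (\<lambda>x. \<psi> (\<phi> x))"
  by (simp add: ring_hom_fun_def)

lemma ring_hom_fun_fps:
  assumes "ring_hom_fun \<phi>"
  shows "ring_hom_fun (\<lambda>f. Abs_fps (\<lambda>k. \<phi> (fps_nth f k)))"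
  unfolding ring_hom_fun_def
  using assms by (auto simp: fps_eq_iff fps_mult_nth ring_hom_funD ring_hom_fun_sum)

lemma ring_hom_fun_series:
  assumes "ring_hom_fun \<phi>"
  shows "ring_hom_fun (\<lambda>f. mps_series p (\<lambda>a. \<phi> (fps_nth f a)))"
proof -
  have "ring_hom_fun (\<lambda>f. mps_series p (fps_nth f))"
    unfolding ring_hom_fun_def
    by (auto intro!: mps_eqI simp: mps_series_mult mps_nth_series mps_nth_1)
  moreover have "fps_nth (Abs_fps g) = g" for g :: "nat \<Rightarrow> 'b" by (simp add: fun_eq_iff)
  ultimately show ?thesis using ring_hom_fun_compose[OF ring_hom_fun_fps[OF assms]] by fastforce
qed

lemma ring_hom_fun_lin_subst: "finite V \<Longrightarrow> ring_hom_fun (lin_subst V \<tau> c)"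
  by (simp add: ring_hom_fun_def lin_subst_add lin_subst_mult)

lemma push_words_eq_sum:
  assumes "finite S" "keys p \<subseteq> S"
  shows "push_words f p = (\<Sum>w\<in>S. single (f w) (lookup p w))"
  unfolding push_words_def using assms by (intro sum.mono_neutral_left) (auto simp: in_keys_iff)

lemma push_words_single: "push_words f (single w c) = single (f w) c"
  by (subst push_words_eq_sum[of "{w}"]) auto

lemma push_words_add: "push_words f (p + q) = push_words f p + push_words f q"
proof -
  let ?S = "keys p \<union> keys q"
  show ?thesis
    using Poly_Mapping.keys_add[of p q]
    by (simp add: push_words_eq_sum[of ?S] lookup_add single_add sum.distrib)
qed

lemma push_words_sum: "push_words f (sum g S) = (\<Sum>i\<in>S. push_words f (g i))"
proof -
  have "push_words f 0 = 0" by (simp add: push_words_def)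
  then show ?thesis
    by (induction S rule: infinite_finite_induct) (simp_all add: push_words_add)
qed

lemma ring_hom_fun_push_words:
  assumes "f 0 = 0" "\<And>v w. f (v + w) = f v + f w"
  shows "ring_hom_fun (push_words f)"
  unfolding ring_hom_fun_def
proof (intro conjI allI)
  show "push_words f 1 = 1" using assms(1) by (simp flip: single_one add: push_words_single)
  fix p q
  show "push_words f (p + q) = push_words f p + push_words f q" by (rule push_words_add)
  have "push_words f (p * q) = (\<Sum>v\<in>keys p. \<Sum>w\<in>keys q.
      single (f v) (lookup p v) * single (f w) (lookup q w))"
    by (simp add: poly_mapping_mult_sum[of p q] push_words_sum push_words_single mult_single assms)
  then show "push_words f (p * q) = push_words f p * push_words f q"
    by (simp add: push_words_def sum_product)
qed

lemma lookup_map_0: "g 0 = 0 \<Longrightarrow> lookup (Poly_Mapping.map g p) k = g (lookup p k)"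
  by (simp add: Poly_Mapping.map.rep_eq when_def)

lemma ring_hom_fun_map:
  assumes g: "ring_hom_fun g"
  shows "ring_hom_fun (Poly_Mapping.map g :: ('w::monoid_add \<Rightarrow>\<^sub>0 'a::ring_1) \<Rightarrow> ('w \<Rightarrow>\<^sub>0 'b::ring_1))"
proof -
  have add: "Poly_Mapping.map g (p + q) = Poly_Mapping.map g p + Poly_Mapping.map g q"
      for p q :: "'w \<Rightarrow>\<^sub>0 'a"
    by (rule poly_mapping_eqI) (simp add: lookup_map_0 ring_hom_funD[OF g] lookup_add)
  have single: "Poly_Mapping.map g (single k c) = single k (g c)" for k :: 'w and c
    by (rule poly_mapping_eqI) (simp add: lookup_map_0 ring_hom_funD[OF g] lookup_single when_def)
  have sum: "Poly_Mapping.map g (sum f S) = (\<Sum>i\<in>S. Poly_Mapping.map g (f i))"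
      for f :: "'w \<Rightarrow> 'w \<Rightarrow>\<^sub>0 'a" and S
    by (induction S rule: infinite_finite_induct)
      (auto simp: add intro!: poly_mapping_eqI simp: lookup_map_0 ring_hom_funD[OF g])
  have eq: "Poly_Mapping.map g p = (\<Sum>k\<in>keys p. single k (g (lookup p k)))" for p :: "'w \<Rightarrow>\<^sub>0 'a"
    by (subst poly_mapping_sum_single[of p, symmetric]) (simp only: sum single)
  have "Poly_Mapping.map g (p * q) = Poly_Mapping.map g p * Poly_Mapping.map g q"
      for p q :: "'w \<Rightarrow>\<^sub>0 'a"
    unfolding poly_mapping_mult_sum[of p q] sum single
    by (simp add: eq[of p] eq[of q] sum_product mult_single ring_hom_funD[OF g])
  moreover have "Poly_Mapping.map g (1 :: 'w \<Rightarrow>\<^sub>0 'a) = 1"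
    by (simp flip: single_one add: single ring_hom_funD[OF g])
  ultimately show ?thesis using add by (simp add: ring_hom_fun_def)
qed

lemma ring_hom_fun_tensor_left: "ring_hom_fun tensor_left"
  and ring_hom_fun_tensor_right: "ring_hom_fun tensor_right"
  unfolding tensor_left_def[abs_def] tensor_right_def[abs_def]
  by (intro ring_hom_fun_fps ring_hom_fun_push_words; simp add: zero_prod_def zero_list_def
      plus_list_def)+

lemma ring_hom_fun_fls_const: "ring_hom_fun (fls_const :: 'a::comm_ring_1 \<Rightarrow> 'a fls)"
  by (simp add: ring_hom_fun_def fls_plus_const)

lemma ring_hom_fun_extend_z: "ring_hom_fun extend_z"
  unfolding extend_z_def[abs_def]
  by (intro ring_hom_fun_fps ring_hom_fun_map ring_hom_fun_fls_const)


section \<open>The matrix of products of generators\<close>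

definition word_gen :: "bool \<Rightarrow> 'n \<Rightarrow> 'n \<Rightarrow> nat \<Rightarrow> 'n word \<times> 'n word"
  where "word_gen l i j d = (if l then ([(i, j, d)], []) else ([], [(i, j, d)]))"

definition LL_gen :: "nat \<Rightarrow> nat \<Rightarrow> 'n \<Rightarrow> 'n \<Rightarrow> ('n, 'c::comm_ring_1) free_alg2 mps"
  where "LL_gen n p i j = mps_series p (\<lambda>d. fps_const (single (word_gen (p \<le> n) i j d) 1))"

lemma LL_eq_prod_list:
  assumes I: "I \<in> midx (n + m)" and J: "(J :: nat \<Rightarrow> 'n::finite) \<in> midx (n + m)"
  shows "(LL n m I J :: ('n, 'c::comm_ring_1) free_alg2 mps) =
    prod_list (map (\<lambda>p. LL_gen n p (I p) (J p)) [1..<n + m + 1])"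
proof -
  have "LL n m = tprod (n + m) (map (\<lambda>p. tfactor p (LL_gen n p :: 'n \<Rightarrow> 'n \<Rightarrow> ('n, 'c) free_alg2
      mps)) [1..<n + m + 1])"
  proof -
    have "[1..<n + m + 1] = [1..<n + 1] @ [n + 1..<n + m + 1]"
      using upt_add_eq_append[of 1 "n + 1" m] by (simp add: add.commute add.left_commute)
    then show ?thesis
      unfolding LL_def
      by (simp only: map_append, intro arg_cong[where f = "tprod (n + m)"] arg_cong2[where f =
          "(@)"]
          map_cong refl arg_cong[where f = "tfactor _"] ext)
        (auto simp: LL_gen_def word_gen_def simp del: upt_Suc)
  qed
  then have "LL n m I J = (if \<forall>q. q \<notin> set [1..<n + m + 1] \<longrightarrow> I q = J q
      then prod_list (map (\<lambda>p. LL_gen n p (I p) (J p)) [1..<n + m + 1])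
      else (0 :: ('n, 'c) free_alg2 mps))"
    by (simp only:) (rule tprod_tfactors, use I J in auto)
  moreover have "\<forall>q. q \<notin> set [1..<n + m + 1] \<longrightarrow> I q = J q"
    using I J by (auto simp: midx_def PiE_def extensional_def simp del: upt_Suc)
  ultimately show ?thesis by (simp only: if_P)
qed

lemma L_trace_eq:
  "L_trace s n = (\<Sum>I\<in>midx n. prod_list (map (\<lambda>p. L_shift (of_int (s * int (p - 1))) (I p)
      (I p :: 'n::finite)) [1..<n + 1]))"
  unfolding L_trace_def ttrace_def
proof (intro sum.cong refl)
  fix I :: "nat \<Rightarrow> 'n" assume I: "I \<in> midx n"
  show "tprod n (map (\<lambda>p. tfactor p (L_shift (of_int s * of_nat (p - 1)))) [1..<n + 1]) I I =
      prod_list (map (\<lambda>p. L_shift (of_int (s * int (p - 1))) (I p) (I p)) [1..<n + 1])"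
  proof -
    have "tprod n (map (\<lambda>p. tfactor p (L_shift (of_int s * of_nat (p - 1)))) [1..<n + 1]) I I =
        (if \<forall>q. q \<notin> set [1..<n + 1] \<longrightarrow> I q = I q
         then prod_list (map (\<lambda>p. L_shift (of_int s * of_nat (p - 1)) (I p) (I p)) [1..<n + 1])
             else 0)"
      by (rule tprod_tfactors) (use I in auto)
    then show ?thesis by (simp only: simp_thms if_True of_int_mult of_int_of_nat_eq)
  qed
qed

text \<open>The specialization $u_i = u \pm (i-1)h$, $v_j = v \pm (j-1)h$. The variables \<open>u\<close> and \<open>v\<close> are
  those numbered \<open>1\<close> and \<open>n + 1\<close>.\<close>

definition block :: "nat \<Rightarrow> nat \<Rightarrow> nat"
  where "block n p = (if p \<le> n then 1 else n + 1)"

definition offset :: "int \<Rightarrow> nat \<Rightarrow> nat \<Rightarrow> int"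
  where "offset s n p = s * int (p - block n p)"

definition specialize :: "int \<Rightarrow> nat \<Rightarrow> nat \<Rightarrow> 'q::ring_1 fps mps \<Rightarrow> 'q fps mps"
  where "specialize s n m = lin_subst {1..n + m} (block n) (offset s n)"

lemma ring_hom_fun_specialize: "ring_hom_fun (specialize s n m)"
  by (simp add: specialize_def[abs_def] ring_hom_fun_lin_subst)

text \<open>Common properties of the embeddings of the algebra as the left (\<open>l\<close>) or right factor of its
  tensor square, with and without the variable \<open>z\<close>. They are what determines the specialized
  product of generators.\<close>

definition gen_embedding ::
    "bool \<Rightarrow> ('n free_alg fps \<Rightarrow> ('n, 'c::comm_ring_1) free_alg2) \<Rightarrow> bool"
  where "gen_embedding l \<phi> \<longleftrightarrow> ring_hom_fun \<phi> \<and> (\<forall>c i j a. \<phi> (fps_nth (L_shift (of_int c) i j) a) =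
    Abs_fps (\<lambda>t. of_nat ((a + t) choose a) * of_int c ^ t * single (word_gen l i j (a + t)) 1))"

lemma single_scalar:
  "single w (of_nat k * of_int c ^ t) =
    (of_nat k * of_int c ^ t * single w 1 :: 'w::monoid_add \<Rightarrow>\<^sub>0 'c::comm_ring_1)"
proof -
  have "of_nat k * of_int c ^ t = (of_int (int k * c ^ t) :: 'w \<Rightarrow>\<^sub>0 'c)" by simp
  also have "\<dots> = single 0 (of_nat k * of_int c ^ t)"
    by (simp only: single_of_int[symmetric]) simp
  finally show ?thesis by (simp add: mult_single)
qed

lemma gen_embedding_tensor_left: "gen_embedding True tensor_left"
  unfolding gen_embedding_def
  by (simp add: ring_hom_fun_tensor_left tensor_left_def L_shift_def push_words_single word_gen_def
      flip: single_scalar)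

lemma gen_embedding_tensor_right: "gen_embedding False tensor_right"
  unfolding gen_embedding_def
  by (simp add: ring_hom_fun_tensor_right tensor_right_def L_shift_def push_words_single
      word_gen_def
      flip: single_scalar)

lemma gen_embedding_extend_z:
  fixes \<phi> :: "'n free_alg fps \<Rightarrow> ('n, complex) free_alg2"
  assumes "gen_embedding l \<phi>"
  shows "gen_embedding l (\<lambda>x. extend_z (\<phi> x))"
proof -
  have "Poly_Mapping.map fls_const (of_nat k * of_int c ^ t * single w 1) =
      (of_nat k * of_int c ^ t * single w 1 :: ('n word \<times> 'n word) \<Rightarrow>\<^sub>0 complex fls)" for k c t w
  proof -
    have "fls_const (of_nat k * of_int c ^ t :: complex) = of_int (int k * c ^ t)"
      using ring_hom_fun_of_int[OF ring_hom_fun_fls_const, of "int k * c ^ t"] by simp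
    then have "Poly_Mapping.map fls_const (single w (of_nat k * of_int c ^ t :: complex)) =
        single w (of_nat k * of_int c ^ t)" by simp
    then show ?thesis by (simp only: single_scalar)
  qed
  then show ?thesis
    using assms by (simp add: gen_embedding_def ring_hom_fun_compose[OF _ ring_hom_fun_extend_z])
      (simp add: extend_z_def)
qed

lemma specialize_LL_gen:
  assumes \<phi>: "gen_embedding (p \<le> n) \<phi>" and p: "p \<in> {1..n + m}"
  shows "specialize s n m (LL_gen n p i j) =
    mps_series (block n p) (\<lambda>a. \<phi> (fps_nth (L_shift (of_int (offset s n p)) i j) a))"
  unfolding specialize_def LL_gen_def
  by (subst lin_subst_series) (use p \<phi> in \<open>auto simp: gen_embedding_def\<close>)

lemma specialize_LL:
  assumes "gen_embedding True \<phi>" "gen_embedding False \<psi>"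
    and I: "I \<in> midx (n + m)" and J: "(J :: nat \<Rightarrow> 'n::finite) \<in> midx (n + m)"
  shows "specialize s n m (LL n m I J) = prod_list (map (\<lambda>p. mps_series (block n p)
    (\<lambda>a. (if p \<le> n then \<phi> else \<psi>) (fps_nth (L_shift (of_int (offset s n p)) (I p) (J p)) a)))
        [1..<n + m + 1])"
  unfolding LL_eq_prod_list[OF I J] ring_hom_fun_prod_list[OF ring_hom_fun_specialize] map_map
proof (intro arg_cong[where f = prod_list] map_cong refl)
  fix p assume "p \<in> set [1..<n + m + 1]"
  then show "(specialize s n m \<circ> (\<lambda>p. LL_gen n p (I p) (J p))) p = mps_series (block n p)
      (\<lambda>a. (if p \<le> n then \<phi> else \<psi>) (fps_nth (L_shift (of_int (offset s n p)) (I p) (J p)) a))"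
    using assms by (auto simp del: upt_Suc intro!: specialize_LL_gen)
qed

lemma sum_midx_add:
  fixes f g :: "(nat \<Rightarrow> 'n::finite) \<Rightarrow> 'b::ring_1"
  assumes "\<And>I. f I = f (restrict I {1..n})" and "\<And>I. g I = g (restrict I {1..m})"
  shows "(\<Sum>I\<in>midx (n + m). f I * g (\<lambda>p. I (n + p))) = (\<Sum>I\<in>midx n. f I) * (\<Sum>I\<in>midx m. g I)"
proof -
  have "(\<Sum>I\<in>midx n. f I) * (\<Sum>I\<in>midx m. g I) = (\<Sum>(I, J)\<in>midx n \<times> midx m. f I * g J)"
    by (simp add: sum_product sum.cartesian_product)
  also have "\<dots> = (\<Sum>I\<in>midx (n + m). f I * g (\<lambda>p. I (n + p)))"
  proof (rule sum.reindex_bij_witness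
      [where i = "\<lambda>I. (restrict I {1..n}, restrict (\<lambda>p. I (n + p)) {1..m})"
        and j = "\<lambda>(I, J). restrict (\<lambda>p. if p \<le> n then I p else J (p - n)) {1..n + m}"], goal_cases)
    case (1 a)
    then show ?case
      by (auto simp: midx_def PiE_iff extensional_def restrict_def fun_eq_iff)
  next
    case (2 a)
    then show ?case by (auto simp: midx_def)
  next
    case (3 b)
    then show ?case
      by (auto simp: midx_def PiE_iff extensional_def restrict_def fun_eq_iff)
  next
    case (4 b)
    then show ?case by (auto simp: midx_def)
  next
    case (5 a)
    obtain I J where a: "a = (I, J)" by fastforce
    let ?I = "restrict (\<lambda>p. if p \<le> n then I p else J (p - n)) {1..n + m}"
    have "restrict ?I {1..n} = restrict I {1..n}"
      "restrict (\<lambda>p. ?I (n + p)) {1..m} = restrict J {1..m}"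
      by (auto simp: restrict_def fun_eq_iff)
    then have "f ?I = f I" "g (\<lambda>p. ?I (n + p)) = g J"
      using assms by metis+
    then show ?case by (simp add: a)
  qed
  finally show ?thesis ..
qed

text \<open>An entry of the product only involves the row and column index of each factor, so that the
  trace over \<open>n + m\<close> factors is the product of the traces over the two blocks.\<close>

lemma specialize_trace_LL:
  assumes \<phi>: "gen_embedding True \<phi>" and \<psi>: "gen_embedding False \<psi>"
  shows "specialize s n m (\<Sum>I\<in>midx (n + m). LL n m I (I :: nat \<Rightarrow> 'n::finite)) =
    mps_series 1 (\<lambda>a. \<phi> (fps_nth (L_trace s n) a)) * mps_series (n + 1)
        (\<lambda>a. \<psi> (fps_nth (L_trace s m) a))"
proof -
  define F where "F = (\<lambda>I :: nat \<Rightarrow> 'n. prod_list (map (\<lambda>p. mps_series 1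
    (\<lambda>a. \<phi> (fps_nth (L_shift (of_int (s * int (p - 1))) (I p) (I p)) a))) [1..<n + 1]))"
  define G where "G = (\<lambda>I :: nat \<Rightarrow> 'n. prod_list (map (\<lambda>p. mps_series (n + 1)
    (\<lambda>a. \<psi> (fps_nth (L_shift (of_int (s * int (p - 1))) (I p) (I p)) a))) [1..<m + 1]))"
  have h: "ring_hom_fun (\<lambda>f. mps_series 1 (\<lambda>a. \<phi> (fps_nth f a)))"
    "ring_hom_fun (\<lambda>f. mps_series (n + 1) (\<lambda>a. \<psi> (fps_nth f a)))"
    using \<phi> \<psi> by (auto simp: gen_embedding_def intro!: ring_hom_fun_series)
  have upt: "[1..<n + m + 1] = [1..<n + 1] @ map (\<lambda>p. n + p) [1..<m + 1]"
  proof -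
    have "[1..<n + m + 1] = [1..<n + 1] @ [n + 1..<n + m + 1]"
      using upt_add_eq_append[of 1 "n + 1" m] by (simp add: add.commute add.left_commute)
    moreover have "map (\<lambda>p. n + p) [1..<m + 1] = [n + 1..<n + m + 1]"
      by (induction m) simp_all
    ultimately show ?thesis by simp
  qed
  have "specialize s n m (\<Sum>I\<in>midx (n + m). LL n m I I) =
      (\<Sum>I\<in>midx (n + m). F I * G (\<lambda>p. I (n + p)))"
    unfolding ring_hom_fun_sum[OF ring_hom_fun_specialize]
  proof (intro sum.cong refl)
    fix I :: "nat \<Rightarrow> 'n" assume I: "I \<in> midx (n + m)"
    show "specialize s n m (LL n m I I) = F I * G (\<lambda>p. I (n + p))"
      unfolding specialize_LL[OF \<phi> \<psi> I I] upt map_append prod_list.append map_map F_def G_def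
      by (intro arg_cong2[where f = "(*)"] arg_cong[where f = prod_list] map_cong)
        (auto simp: block_def offset_def simp del: upt_Suc)
  qed
  also have "\<dots> = (\<Sum>I\<in>midx n. F I) * (\<Sum>I\<in>midx m. G I)"
    by (rule sum_midx_add; unfold F_def G_def)
      (auto intro!: arg_cong[where f = prod_list] map_cong simp del: upt_Suc)
  also have "(\<Sum>I\<in>midx n. F I) = mps_series 1 (\<lambda>a. \<phi> (fps_nth (L_trace s n) a))"
    unfolding L_trace_eq ring_hom_fun_sum[OF h(1)] ring_hom_fun_prod_list[OF h(1)] F_def
    by (simp add: comp_def del: upt_Suc)
  also have "(\<Sum>I\<in>midx m. G I) = mps_series (n + 1) (\<lambda>a. \<psi> (fps_nth (L_trace s m) a))"
    unfolding L_trace_eq ring_hom_fun_sum[OF h(2)] ring_hom_fun_prod_list[OF h(2)] G_def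
    by (simp add: comp_def del: upt_Suc)
  finally show ?thesis .
qed

section \<open>Traces of symmetric matrices\<close>

text \<open>The trace of $P_f M$, which is also that of $M P_f$. It extends linearly to the group
  algebra.\<close>

definition cyclic_trace :: "nat \<Rightarrow> ('n::finite, 'b::ring_1) tmat \<Rightarrow> nat Perm.perm \<Rightarrow> 'b"
  where "cyclic_trace k M f = (\<Sum>I\<in>midx k. M (I \<circ> act f) I)"

definition trace_functional :: "nat \<Rightarrow> ('n::finite, 'b::ring_1) tmat \<Rightarrow> 'b perm_alg \<Rightarrow> 'b"
  where "trace_functional k M x =
    (\<Sum>f\<in>keys x. cyclic_trace k M f * lookup x f)"

lemma trace_functional_eq_sum:
  assumes "finite S" "keys x \<subseteq> S"
  shows "trace_functional k M x = (\<Sum>f\<in>S. cyclic_trace k M f * lookup x f)"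
  unfolding trace_functional_def using assms
  by (intro sum.mono_neutral_left) (auto simp: in_keys_iff)

lemma trace_functional_single:
  "trace_functional k M (single f c) = cyclic_trace k M f * c"
  by (subst trace_functional_eq_sum[of "{f}"]) auto

lemma trace_functional_0: "trace_functional k M 0 = 0"
  by (simp add: trace_functional_def)

lemma trace_functional_add:
  "trace_functional k M (x + y) = trace_functional k M x + trace_functional k M y"
proof -
  let ?S = "keys x \<union> keys y"
  show ?thesis
    using Poly_Mapping.keys_add[of x y]
    by (simp add: trace_functional_eq_sum[of ?S] lookup_add distrib_left sum.distrib)
qed

lemma trace_functional_sum:
  "trace_functional k M (sum g S) = (\<Sum>i\<in>S. trace_functional k M (g i))"
  by (induction S rule: infinite_finite_induct)
    (simp_all add: trace_functional_add trace_functional_0)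

lemma trace_functional_of_nat:
  "trace_functional k M (of_nat N * x) = of_nat N * trace_functional k M x"
  by (induction N) (simp_all add: distrib_right trace_functional_add trace_functional_0)

lemma trace_functional_1: "trace_functional k M 1 = ttrace k M"
  by (simp flip: single_one add: trace_functional_single cyclic_trace_def ttrace_def)

lemma sum_swap4:
  "(\<Sum>i\<in>A. \<Sum>f\<in>B. \<Sum>l\<in>C. \<Sum>g\<in>D. h i f l g) = (\<Sum>f\<in>B. \<Sum>g\<in>D. \<Sum>l\<in>C. \<Sum>i\<in>A. h i f l g)"
proof -
  have "(\<Sum>i\<in>A. \<Sum>l\<in>C. \<Sum>g\<in>D. h i f l g) = (\<Sum>g\<in>D. \<Sum>l\<in>C. \<Sum>i\<in>A. h i f l g)" for f
  proof -
    have "(\<Sum>i\<in>A. \<Sum>l\<in>C. \<Sum>g\<in>D. h i f l g) = (\<Sum>i\<in>A. \<Sum>g\<in>D. \<Sum>l\<in>C. h i f l g)"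
      by (rule sum.cong[OF refl]) (rule sum.swap)
    also have "\<dots> = (\<Sum>g\<in>D. \<Sum>i\<in>A. \<Sum>l\<in>C. h i f l g)" by (rule sum.swap)
    also have "\<dots> = (\<Sum>g\<in>D. \<Sum>l\<in>C. \<Sum>i\<in>A. h i f l g)"
      by (rule sum.cong[OF refl]) (rule sum.swap)
    finally show ?thesis .
  qed
  then show ?thesis by (subst sum.swap) simp
qed

text \<open>Cyclicity of the trace: the operator on the left can be moved to the right because its
  entries are central.\<close>

lemma ttrace_rep:
  fixes M :: "('n::finite, 'b::ring_1) tmat"
  assumes b: "supported k b" "central_coeffs b" and y: "supported k y"
  shows "ttrace k (tmul k (rep b) (tmul k M (rep y))) = trace_functional k M (y * b)"
proof -
  let ?B = "keys b" and ?Y = "keys y"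
  let ?b = "lookup b" and ?y = "lookup y"
  have left: "tmul k (rep b) Z I J = (\<Sum>f\<in>?B. ?b f * Z (I \<circ> act f) J)"
    if I: "I \<in> midx k" for Z :: "('n, 'b) tmat" and I J
  proof -
    have "tmul k (rep b) Z I J =
        (\<Sum>f\<in>?B. \<Sum>K\<in>midx k. if K = I \<circ> act f then ?b f * Z (I \<circ> act f) J else 0)"
      unfolding tmul_def rep_def sum_distrib_right
      by (subst sum.swap) (intro sum.cong, auto)
    also have "\<dots> = (\<Sum>f\<in>?B. ?b f * Z (I \<circ> act f) J)"
      using b(1) midx_comp[OF I]
      by (intro sum.cong refl) (auto simp: supported_def sym_group_def)
    finally show ?thesis .
  qed
  have "ttrace k (tmul k (rep b) (tmul k M (rep y))) =
      (\<Sum>I\<in>midx k. \<Sum>f\<in>?B. \<Sum>L\<in>midx k. \<Sum>g\<in>?Y.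
        if I = L \<circ> act g then ?b f * (M (I \<circ> act f) L * ?y g) else 0)"
    unfolding ttrace_def
    by (intro sum.cong refl)
      (auto simp: left tmul_def[of k M] rep_def sum_distrib_left intro!: sum.cong)
  also have "\<dots> = (\<Sum>f\<in>?B. \<Sum>g\<in>?Y. \<Sum>L\<in>midx k. \<Sum>I\<in>midx k.
        if I = L \<circ> act g then ?b f * (M (I \<circ> act f) L * ?y g) else 0)"
    by (rule sum_swap4)
  also have "\<dots> = (\<Sum>f\<in>?B. \<Sum>g\<in>?Y. \<Sum>L\<in>midx k. M (L \<circ> act (g + f)) L * (?y g * ?b f))"
  proof (intro sum.cong refl)
    fix f g and L :: "nat \<Rightarrow> 'n" assume g: "g \<in> ?Y" and L: "L \<in> midx k"
    then have "L \<circ> act g \<in> midx k"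
      using y by (intro midx_comp) (auto simp: supported_def sym_group_def)
    moreover have "?b f * (z * ?y g) = z * (?y g * ?b f)" for z
      using b(2) by (metis central_coeffs_def centralD mult.assoc)
    ultimately show "(\<Sum>I\<in>midx k. if I = L \<circ> act g then ?b f * (M (I \<circ> act f) L * ?y g) else 0) =
        M (L \<circ> act (g + f)) L * (?y g * ?b f)"
      by (simp add: comp_assoc)
  qed
  also have "\<dots> = (\<Sum>g\<in>?Y. \<Sum>f\<in>?B. cyclic_trace k M (g + f) * (?y g * ?b f))"
    by (subst sum.swap) (simp add: cyclic_trace_def sum_distrib_right)
  also have "\<dots> = trace_functional k M (y * b)"
    unfolding poly_mapping_mult_sum[of y b] trace_functional_sum trace_functional_single ..
  finally show ?thesis .
qed

text \<open>Matrices that are, modulo an ideal, symmetric or skew-symmetric under adjacent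
  transpositions of their row and of their column factors.\<close>

locale young_symmetric_matrix =
  fixes s :: int and n m :: nat and J :: "'b::ring_1 set" and M :: "('n::finite, 'b) tmat"
  assumes s: "s = 1 \<or> s = -1"
    and ideal: "two_sided_ideal J"
    and left: "k \<in> adjacents n m \<Longrightarrow> I \<in> midx (n + m) \<Longrightarrow> I' \<in> midx (n + m) \<Longrightarrow>
      M (I \<circ> transpose k (Suc k)) I' - of_int s * M I I' \<in> J"
    and right: "k \<in> adjacents n m \<Longrightarrow> I \<in> midx (n + m) \<Longrightarrow> I' \<in> midx (n + m) \<Longrightarrow>
      M I (I' \<circ> transpose k (Suc k)) - of_int s * M I I' \<in> J"
begin

abbreviation ctr :: "nat Perm.perm \<Rightarrow> 'b" where "ctr \<equiv> cyclic_trace (n + m) M"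
abbreviation tf :: "'b perm_alg \<Rightarrow> 'b" where "tf \<equiv> trace_functional (n + m) M"
abbreviation A :: "'b perm_alg" where "A \<equiv> young_sym s n m"
abbreviation N :: nat where "N \<equiv> card (young n m)"

lemma adjacent_permutes: "k \<in> adjacents n m \<Longrightarrow> transpose k (Suc k) permutes {1..n + m}"
  by (rule permutes_swap_id) (auto simp: adjacents_def)

lemma adjacent_sym_group: "k \<in> adjacents n m \<Longrightarrow> Perm.swap k (Suc k) \<in> sym_group (n + m)"
  using adjacent_permutes by (simp add: sym_group_def)

lemma ctr_swap_left:
  assumes k: "k \<in> adjacents n m" and f: "f \<in> sym_group (n + m)"
  shows "ctr (Perm.swap k (Suc k) + f) - of_int s * ctr f \<in> J"
proof -
  let ?t = "transpose k (Suc k)"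
  have "ctr (Perm.swap k (Suc k) + f) = (\<Sum>I\<in>midx (n + m). M (I \<circ> act f) (I \<circ> ?t))"
    unfolding cyclic_trace_def
    by (rule sum.reindex_bij_witness[where i = "\<lambda>I. I \<circ> ?t" and j = "\<lambda>I. I \<circ> ?t"])
      (simp_all add: comp_assoc midx_comp[OF _ adjacent_permutes[OF k]])
  then have "ctr (Perm.swap k (Suc k) + f) - of_int s * ctr f =
      (\<Sum>I\<in>midx (n + m). M (I \<circ> act f) (I \<circ> ?t) - of_int s * M (I \<circ> act f) I)"
    by (simp add: cyclic_trace_def sum_subtractf sum_distrib_left)
  also have "\<dots> \<in> J"
    using f by (intro two_sided_ideal_sum[OF ideal] right k midx_comp) (auto simp: sym_group_def)
  finally show ?thesis .
qed

lemma ctr_swap_right: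
  assumes k: "k \<in> adjacents n m" and f: "f \<in> sym_group (n + m)"
  shows "ctr (f + Perm.swap k (Suc k)) - of_int s * ctr f \<in> J"
proof -
  have "ctr (f + Perm.swap k (Suc k)) - of_int s * ctr f =
      (\<Sum>I\<in>midx (n + m). M ((I \<circ> act f) \<circ> transpose k (Suc k)) I - of_int s * M (I \<circ> act f) I)"
    by (simp add: cyclic_trace_def sum_subtractf sum_distrib_left comp_assoc)
  also have "\<dots> \<in> J"
    using f by (intro two_sided_ideal_sum[OF ideal] left k midx_comp) (auto simp: sym_group_def)
  finally show ?thesis .
qed

lemma eps_adjacent: "eps s (Perm.swap k (Suc k) + h) = s * eps s h"
  by (simp add: eps_add eps_swap[OF s])

lemma combine:
  assumes "x - of_int c * y \<in> J" "y - of_int d * z \<in> J"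
  shows "x - of_int (c * d) * z \<in> J"
proof -
  have "x - of_int (c * d) * z = (x - of_int c * y) + of_int c * (y - of_int d * z)"
    by (simp add: right_diff_distrib mult.assoc)
  also have "\<dots> \<in> J"
    by (intro two_sided_idealD(2)[OF ideal] two_sided_idealD(3)[OF ideal] assms)
  finally show ?thesis .
qed

lemma ctr_young_left:
  assumes "h \<in> young n m" "f \<in> sym_group (n + m)"
  shows "ctr (h + f) - of_int (eps s h) * ctr f \<in> J"
  using assms(1)
proof (induction rule: young_induct)
  case zero
  then show ?case using two_sided_idealD(1)[OF ideal] by simp
next
  case (adjacent k h)
  have "h + f \<in> sym_group (n + m)"
    using adjacent.hyps(2) assms(2) by (simp add: young_def sym_group_add)
  then show ?case
    using combine[OF ctr_swap_left[OF adjacent.hyps(1)] adjacent.IH]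
    unfolding eps_adjacent by (simp add: add.assoc)
qed

lemma ctr_young_right:
  assumes "h \<in> young n m" "f \<in> sym_group (n + m)"
  shows "ctr (f + h) - of_int (eps s h) * ctr f \<in> J"
  using assms
proof (induction arbitrary: f rule: young_induct)
  case zero
  then show ?case using two_sided_idealD(1)[OF ideal] by simp
next
  case (adjacent k h)
  have "f + Perm.swap k (Suc k) \<in> sym_group (n + m)"
    using adjacent.prems adjacent_sym_group[OF adjacent.hyps(1)] by (rule sym_group_add)
  from combine[OF adjacent.IH[OF this] ctr_swap_right[OF adjacent.hyps(1) adjacent.prems]]
  show ?case unfolding eps_adjacent by (simp add: add.assoc mult.commute)
qed

lemma eps_mult_cancel: "of_int (eps s h) * (x * (of_int (eps s h) * z)) = x * (z :: 'b)"
proof -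
  have "of_int (eps s h) * (x * (of_int (eps s h) * z)) = of_int (eps s h * eps s h) * (x * z)"
    unfolding central_left_commute[OF central_of_int[of "eps s h"], of x z]
    by (simp only: of_int_mult mult.assoc)
  then show ?thesis unfolding eps_square by simp
qed

lemma tf_young_sym_left:
  assumes y: "supported (n + m) y"
  shows "tf (A * y) - of_nat N * tf y \<in> J"
proof -
  let ?e = "\<lambda>h. of_int (eps s h) :: 'b" and ?y = "lookup y"
  have "A * y = (\<Sum>h\<in>young n m. \<Sum>f\<in>keys y. single (h + f) (?e h * ?y f))"
    by (subst poly_mapping_sum_single[of y, symmetric])
      (simp add: young_sym_def sum_product mult_single)
  then have "tf (A * y) - of_nat N * tf y =
      (\<Sum>h\<in>young n m. \<Sum>f\<in>keys y. ctr (h + f) * (?e h * ?y f) - ctr f * ?y f)"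
    by (simp add: trace_functional_sum trace_functional_single trace_functional_def[of _ _ y]
        sum_subtractf)
  also have "\<dots> = (\<Sum>h\<in>young n m. \<Sum>f\<in>keys y. (ctr (h + f) - ?e h * ctr f) * (?e h * ?y f))"
    by (simp only: left_diff_distrib mult.assoc eps_mult_cancel)
  also have "\<dots> \<in> J"
    using y by (intro two_sided_ideal_sum[OF ideal] two_sided_idealD(4)[OF ideal] ctr_young_left)
      (auto simp: supported_def)
  finally show ?thesis .
qed

lemma tf_young_sym_right:
  assumes y: "supported (n + m) y"
  shows "tf (y * A) - of_nat N * tf y \<in> J"
proof -
  let ?e = "\<lambda>h. of_int (eps s h) :: 'b" and ?y = "lookup y"
  have "y * A = (\<Sum>f\<in>keys y. \<Sum>h\<in>young n m. single (f + h) (?y f * ?e h))"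
    by (subst poly_mapping_sum_single[of y, symmetric])
      (simp add: young_sym_def sum_product mult_single)
  also have "\<dots> = (\<Sum>h\<in>young n m. \<Sum>f\<in>keys y. single (f + h) (?e h * ?y f))"
    by (subst sum.swap) (simp add: mult_of_int_commute)
  finally have "tf (y * A) - of_nat N * tf y =
      (\<Sum>h\<in>young n m. \<Sum>f\<in>keys y. ctr (f + h) * (?e h * ?y f) - ctr f * ?y f)"
    by (simp add: trace_functional_sum trace_functional_single trace_functional_def[of _ _ y]
        sum_subtractf)
  also have "\<dots> = (\<Sum>h\<in>young n m. \<Sum>f\<in>keys y. (ctr (f + h) - ?e h * ctr f) * (?e h * ?y f))"
    by (simp only: left_diff_distrib mult.assoc eps_mult_cancel)
  also have "\<dots> \<in> J"
    using y by (intro two_sided_ideal_sum[OF ideal] two_sided_idealD(4)[OF ideal] ctr_young_right)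
      (auto simp: supported_def)
  finally show ?thesis .
qed

lemma supported_young_sym: "supported (n + m) A"
proof -
  have sum: "supported (n + m) (sum g S)" if "\<And>f. f \<in> S \<Longrightarrow> supported (n + m) (g f)"
    for g :: "nat Perm.perm \<Rightarrow> 'b perm_alg" and S
  proof -
    have "supported (n + m) (0 :: 'b perm_alg)" by (simp add: supported_def)
    then show ?thesis
      using that by (induction S rule: infinite_finite_induct) (simp_all add: supported_add)
  qed
  show ?thesis
    unfolding young_sym_def by (rule sum) (simp add: supported_single young_def)
qed

text \<open>Modulo the ideal the functional does not see symmetrization up to the factor \<open>N\<close>, and the
  symmetrization of \<open>y\<close> is proportional to that of \<open>1\<close>.\<close>

lemma tf_eq_ttrace:
  assumes rat: "rational TYPE('b)" and y: "supported (n + m) y" "A * y * A = of_nat N * A"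
  shows "tf y - ttrace (n + m) M \<in> J"
proof -
  note I = two_sided_idealD[OF ideal]
  have 1: "tf (A * y * A) - of_nat N * tf (A * y) \<in> J"
    by (intro tf_young_sym_right supported_mult supported_young_sym y)
  have 2: "of_nat N * (tf (A * y) - of_nat N * tf y) \<in> J"
    by (intro I tf_young_sym_left y)
  have 3: "of_nat N * (tf (A * 1) - of_nat N * tf 1) \<in> J"
    by (intro I tf_young_sym_left supported_1)
  have "of_nat N * (of_nat N * (tf y - tf 1)) = of_nat N * (tf (A * 1) - of_nat N * tf 1) -
      (tf (A * y * A) - of_nat N * tf (A * y)) - of_nat N * (tf (A * y) - of_nat N * tf y)"
    unfolding y(2) trace_functional_of_nat by (simp add: right_diff_distrib)
  also have "\<dots> \<in> J" by (intro I(6) 1 2 3)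
  finally have *: "of_nat N * (of_nat N * (tf y - tf 1)) \<in> J" .
  have cancel: "x \<in> J" if "of_nat N * x \<in> J" for x
  proof -
    obtain q :: 'b where "of_nat N * q = 1" using rat card_young_pos[of n m]
        unfolding rational_def by blast
    then have "q * of_nat N = 1" using mult_of_nat_commute[of N q] by simp
    then have "q * (of_nat N * x) = x" by (simp only: mult_1_left flip: mult.assoc)
    then show ?thesis using I(3)[OF that, of q] by simp
  qed
  show ?thesis using cancel[OF cancel[OF *]] by (simp add: trace_functional_1)
qed

end

section \<open>The product of fused generators is symmetric\<close>

type_synonym 'n vvz_series = "('n, complex fls) free_alg2 mps"

definition coeffs_in :: "'b::ring_1 set \<Rightarrow> 'b mps set"
  where "coeffs_in K = {f. \<forall>e. mps_nth f e \<in> K}"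

lemma two_sided_ideal_coeffs_in:
  assumes K: "two_sided_ideal K"
  shows "two_sided_ideal (coeffs_in K)"
proof -
  note I = two_sided_idealD[OF K]
  have "a * x * b \<in> coeffs_in K" if x: "x \<in> coeffs_in K" for a b x
  proof -
    have "a * x \<in> coeffs_in K"
      using x by (auto simp: coeffs_in_def mps_nth_mult intro!: two_sided_ideal_sum[OF K] I(3))
    then show ?thesis
      by (auto simp: coeffs_in_def mps_nth_mult[of "a * x"] intro!: two_sided_ideal_sum[OF K] I(4))
  qed
  then show ?thesis
    unfolding two_sided_ideal_def using I(1,2) by (auto simp: coeffs_in_def)
qed

lemma closed_ideal_VVz: "closed_ideal (VVz_kernel s)"
  unfolding VVz_kernel_def by (rule closed_ideal_top_free_ideal)

lemma VVz_kernel_embedded: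
  assumes "x \<in> A_ideal s"
  shows "extend_z (tensor_left x) \<in> VVz_kernel s" "extend_z (tensor_right x) \<in> VVz_kernel s"
proof -
  have "tensor_left x \<in> VV_kernel s" "tensor_right x \<in> VV_kernel s"
    unfolding VV_kernel_def by (rule subsetD[OF top_free_ideal_superset], use assms in simp)+
  then show "extend_z (tensor_left x) \<in> VVz_kernel s" "extend_z (tensor_right x) \<in> VVz_kernel s"
    unfolding VVz_kernel_def by (auto intro: subsetD[OF top_free_ideal_superset])
qed

abbreviation LL_fused :: "int \<Rightarrow> nat \<Rightarrow> nat \<Rightarrow> ('n::finite, 'n vvz_series) tmat"
  where "LL_fused s n m \<equiv> \<lambda>I J. specialize s n m (LL n m I J)"

text \<open>A transposition of neighbouring indices in the same block only affects two neighbouring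
  factors of the entry, and these are exchanged by \<open>fused_exchange\<close>.\<close>

lemma LL_fused_symmetric:
  fixes I J :: "nat \<Rightarrow> 'n::finite"
  assumes s: "s = 1 \<or> s = -1" and k: "k \<in> adjacents n m"
    and I: "I \<in> midx (n + m)" and J: "J \<in> midx (n + m)"
  shows "LL_fused s n m (I \<circ> transpose k (Suc k)) J - of_int s * LL_fused s n m I J
      \<in> coeffs_in (VVz_kernel s)"
    and "LL_fused s n m I (J \<circ> transpose k (Suc k)) - of_int s * LL_fused s n m I J
      \<in> coeffs_in (VVz_kernel s)"
proof -
  define \<phi> where "\<phi> = (\<lambda>p x. extend_z (if p \<le> n then tensor_left x else tensor_right x)
    :: ('n, complex fls) free_alg2)"
  define Y where "Y = (\<lambda>p a b. mps_series (block n p)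
    (\<lambda>d. \<phi> p (fps_nth (L_shift (of_int (offset s n p)) a b) d)) :: 'n vvz_series)"
  let ?t = "transpose k (Suc k)"
  have K: "two_sided_ideal (coeffs_in (VVz_kernel s))"
    by (intro two_sided_ideal_coeffs_in closed_ideal_two_sided closed_ideal_VVz)
  have LL: "LL_fused s n m I J = prod_list (map (\<lambda>p. Y p (I p) (J p)) [1..<n + m + 1])"
    if "I \<in> midx (n + m)" "J \<in> midx (n + m)" for I J :: "nat \<Rightarrow> 'n"
    unfolding specialize_LL[OF gen_embedding_extend_z[OF gen_embedding_tensor_left]
        gen_embedding_extend_z[OF gen_embedding_tensor_right] that]
    by (intro arg_cong[where f = prod_list] map_cong) (auto simp: Y_def \<phi>_def)
  have t: "?t permutes {1..n + m}"
    using k by (intro permutes_swap_id) (auto simp: adjacents_def)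
  have pair: "Y k a b * Y (Suc k) a' b' - of_int s * (Y k a' b * Y (Suc k) a b')
      \<in> coeffs_in (VVz_kernel s)"
    "Y k a b * Y (Suc k) a' b' - of_int s * (Y k a b' * Y (Suc k) a' b) \<in> coeffs_in (VVz_kernel s)"
    for a b a' b' :: 'n
  proof -
    define E where "E = (\<lambda>f. mps_series (block n k) (\<lambda>d. \<phi> k (fps_nth f d)))"
    have "ring_hom_fun (\<phi> k)"
      using ring_hom_fun_compose[OF ring_hom_fun_tensor_left ring_hom_fun_extend_z]
        ring_hom_fun_compose[OF ring_hom_fun_tensor_right ring_hom_fun_extend_z]
      by (cases "k \<le> n") (simp_all add: \<phi>_def)
    then have E: "ring_hom_fun E" unfolding E_def by (rule ring_hom_fun_series)
    have "\<phi> k 0 = 0" by (rule ring_hom_funD(4)[OF \<open>ring_hom_fun (\<phi> k)\<close>])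
    have EK: "E f \<in> coeffs_in (VVz_kernel s)" if "\<And>d. fps_nth f d \<in> A_ideal s" for f
      using that VVz_kernel_embedded[of _ s] two_sided_idealD(1)[OF
          closed_ideal_two_sided[OF closed_ideal_VVz]]
      by (auto simp: coeffs_in_def E_def mps_nth_series \<phi>_def)
    have next_k: "block n (Suc k) = block n k" "offset s n (Suc k) = offset s n k + s"
        "\<phi> (Suc k) = \<phi> k"
      using k by (auto simp: adjacents_def block_def offset_def \<phi>_def algebra_simps of_nat_diff)
    let ?L = "\<lambda>c i j. L_shift (of_int c) i j :: 'n free_alg fps fps" and ?c = "offset s n k"
    have Y: "Y k i j = E (?L ?c i j)" "Y (Suc k) i j = E (?L (?c + s) i j)" for i j
      unfolding Y_def E_def next_k by simp_all
    have "Y k i j * Y (Suc k) i' j' - of_int s * (Y k u v * Y (Suc k) u' v') =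
        E (?L ?c i j * ?L (?c + s) i' j' - of_int s * (?L ?c u v * ?L (?c + s) u' v'))"
      for i j i' j' u v u' v'
      unfolding Y by (simp only: ring_hom_funD[OF E] ring_hom_fun_of_int[OF E])
    then show "Y k a b * Y (Suc k) a' b' - of_int s * (Y k a' b * Y (Suc k) a b')
        \<in> coeffs_in (VVz_kernel s)"
      "Y k a b * Y (Suc k) a' b' - of_int s * (Y k a b' * Y (Suc k) a' b)
          \<in> coeffs_in (VVz_kernel s)"
      by (simp_all only:) (intro EK fused_exchange s)+
  qed
  let ?xs = "[1..<k]" and ?ys = "[Suc (Suc k)..<n + m + 1]"
  define P where "P = prod_list (map (\<lambda>p. Y p (I p) (J p)) ?xs)"
  define Q where "Q = prod_list (map (\<lambda>p. Y p (I p) (J p)) ?ys)"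
  have split: "[1..<n + m + 1] = ?xs @ [k, Suc k] @ ?ys"
    using k by (intro upt_split_adjacent) (auto simp: adjacents_def)
  have t_fix: "?t p = p" if "p \<in> set ?xs \<union> set ?ys" for p
    using that by (auto simp: transpose_def simp del: upt_Suc)
  have prod: "prod_list (map (\<lambda>p. Y p (I' p) (J' p)) [1..<n + m + 1]) =
      P * (Y k (I' k) (J' k) * Y (Suc k) (I' (Suc k)) (J' (Suc k))) * Q"
    if "\<And>p. p \<in> set ?xs \<union> set ?ys \<Longrightarrow> I' p = I p \<and> J' p = J p" for I' J'
  proof -
    have "map (\<lambda>p. Y p (I' p) (J' p)) ?xs = map (\<lambda>p. Y p (I p) (J p)) ?xs"
      "map (\<lambda>p. Y p (I' p) (J' p)) ?ys = map (\<lambda>p. Y p (I p) (J p)) ?ys"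
      using that by auto
    then show ?thesis
      unfolding split P_def Q_def map_append prod_list.append
          by (simp only: list.map prod_list.Cons prod_list.Nil mult_1_right mult.assoc)
  qed
  have diff: "P * x * Q - of_int s * (P * y * Q) = P * (x - of_int s * y) * Q" for x y
    by (simp add: left_diff_distrib right_diff_distrib mult.assoc
        central_left_commute[OF central_of_int[of s], of P])
  have comp: "(I \<circ> ?t) k = I (Suc k)" "(I \<circ> ?t) (Suc k) = I k" "(J \<circ> ?t) k = J (Suc k)"
      "(J \<circ> ?t) (Suc k) = J k"
    by simp_all
  have 1: "LL_fused s n m I J = P * (Y k (I k) (J k) * Y (Suc k) (I (Suc k)) (J (Suc k))) * Q"
    unfolding LL[OF I J] by (rule prod) simp
  have 2: "LL_fused s n m (I \<circ> ?t) J = P * (Y k (I (Suc k)) (J k) * Y (Suc k) (I k) (J (Suc k))) *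
      Q"
    unfolding LL[OF midx_comp[OF I t] J] by (subst prod) (simp_all only: comp_apply t_fix comp,
        simp_all)
  have 3: "LL_fused s n m I (J \<circ> ?t) = P * (Y k (I k) (J (Suc k)) * Y (Suc k) (I (Suc k)) (J k)) *
      Q"
    unfolding LL[OF I midx_comp[OF J t]] by (subst prod) (simp_all only: comp_apply t_fix comp,
        simp_all)
  show "LL_fused s n m (I \<circ> ?t) J - of_int s * LL_fused s n m I J \<in> coeffs_in (VVz_kernel s)"
    unfolding 1 2 diff by (intro two_sided_idealD(3,4)[OF K] pair)
  show "LL_fused s n m I (J \<circ> ?t) - of_int s * LL_fused s n m I J \<in> coeffs_in (VVz_kernel s)"
    unfolding 1 3 diff by (intro two_sided_idealD(3,4)[OF K] pair)
qed


section \<open>Specialization of the R-matrices\<close>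

lemma ring_hom_fun_tprod:
  fixes As :: "('n::finite, 'b::ring_1) tmat list"
  assumes "ring_hom_fun \<phi>"
  shows "\<phi> (tprod k As I J) = tprod k (map (\<lambda>A I J. \<phi> (A I J)) As) I J"
proof (induction As arbitrary: I)
  case Nil
  then show ?case by (simp add: tprod_def tone_def ring_hom_funD[OF assms])
next
  case (Cons A As)
  have "\<phi> (tmul k A (tprod k As) I J) = tmul k (\<lambda>I J. \<phi> (A I J))
      (tprod k (map (\<lambda>A I J. \<phi> (A I J)) As)) I J"
    by (simp add: tmul_def ring_hom_fun_sum[OF assms] ring_hom_funD[OF assms] Cons.IH)
  then show ?case by (simp add: tprod_def)
qed

lemma ring_hom_fun_ring_inv:
  assumes \<phi>: "ring_hom_fun \<phi>" and x: "unit_el x"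
  shows "\<phi> (ring_inv x) = ring_inv (\<phi> x)"
proof -
  have "\<phi> x * \<phi> (ring_inv x) = 1" "\<phi> (ring_inv x) * \<phi> x = 1"
    using unit_el_ring_inv[OF x] by (simp_all
        flip: ring_hom_funD(3)[OF \<phi>] add: ring_hom_funD(1)[OF \<phi>])
  then show ?thesis by (rule ring_inv_eq[symmetric])
qed

lemma ring_hom_fun_Rbar:
  assumes \<phi>: "ring_hom_fun \<phi>" and "unit_el x" "unit_el (x - of_int s * h)"
  shows "\<phi> (Rbar s i j h x I J) = Rbar s i j (\<phi> h) (\<phi> x) I J"
  using assms unfolding Rbar_def R_mat_def
  by (simp add: ring_hom_funD[OF \<phi>] ring_hom_fun_of_int[OF \<phi>] ring_hom_fun_ring_inv[OF \<phi>] tone_def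
      tperm_def)

definition h_var :: "'n vvz_series"
  where "h_var = mps_const fps_X"

definition z_var :: "'n vvz_series"
  where "z_var = mps_const (fps_const (single 0 fls_X))"

lemma central_h_z [simp]: "central h_var" "central z_var"
  by (simp_all add: h_var_def z_var_def central_def[of fls_X] mult.commute)

definition generic_param :: "nat \<Rightarrow> nat \<Rightarrow> 'n vvz_series"
  where "generic_param i j = z_var + mps_var i - mps_var j"

text \<open>The specialization of $z+u_i-v_{j-n}$.\<close>

definition fused_param :: "int \<Rightarrow> nat \<Rightarrow> nat \<Rightarrow> nat \<Rightarrow> 'n vvz_series"
  where "fused_param s n i j = z_var + mps_var 1 - mps_var (n + 1) +
      of_int (s * (int i - int j + int n)) * h_var"

lemma unit_el_z:
  fixes f :: "'n vvz_series"
  assumes "fps_nth (mps_nth f {#}) 0 = single 0 fls_X"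
  shows "unit_el f"
proof -
  have "unit_el (single (0 :: 'n word \<times> 'n word) (fls_X :: complex fls))"
    by (rule unit_elI[of _ "single 0 fls_X_inv"])
      (simp_all add: mult_single fls_X_times_conv_shift fls_X_inv_times_conv_shift)
  then show ?thesis using assms by (intro unit_el_mps unit_el_fps) simp
qed

lemma const_term_of_int_h: "fps_nth (mps_nth (of_int k * h_var) {#}) 0 = 0"
  by (simp add: h_var_def mps_const_of_int[symmetric] fps_of_int[symmetric])

lemma unit_generic_param: "unit_el (generic_param i j + of_int k * h_var)"
  by (rule unit_el_z) (simp add: generic_param_def const_term_of_int_h mps_nth_var z_var_def
      mps_nth_const)

lemma unit_fused_param: "unit_el (fused_param s n i j + of_int k * h_var)"
  by (rule unit_el_z)
    (simp add: fused_param_def const_term_of_int_h mps_nth_var z_var_def mps_nth_const del: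
        of_int_mult)

lemma generic_r_matrices: "s = 1 \<or> s = -1 \<Longrightarrow> r_matrices s h_var generic_param n m"
  by unfold_locales (simp_all add: unit_generic_param, simp add: generic_param_def)

lemma rational_mps: "rational TYPE('n vvz_series)"
  unfolding rational_def
proof (intro allI impI)
  fix k :: nat assume "k > 0"
  have "of_nat k * fls_const (1 / of_nat k :: complex) = fls_const (of_nat k * (1 / of_nat k))"
    unfolding ring_hom_fun_of_nat[OF ring_hom_fun_fls_const, symmetric]
    by (simp only: fls_const_mult_const)
  then have "of_nat k * fls_const (1 / of_nat k :: complex) = 1"
    using \<open>k > 0\<close> by simp
  then have "of_nat k * mps_const (fps_const (single 0 (fls_const (1 / of_nat k)))) =
      (1 :: 'n vvz_series)"
    by (simp add: mult_single flip: mps_const_of_nat fps_of_nat single_of_nat mps_const_mult)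
  then show "\<exists>q :: 'n vvz_series. of_nat k * q = 1" ..
qed

lemma fused_r_matrices_param:
  assumes "s = 1 \<or> s = -1"
  shows "fused_r_matrices s h_var (fused_param s n) n m"
  by unfold_locales
    (simp_all add: assms rational_mps unit_fused_param, simp_all add: fused_param_def algebra_simps)

lemma specialize_generic_param:
  assumes "i \<in> {1..n}" "j \<in> {n + 1..n + m}"
  shows "specialize s n m (generic_param i j) = fused_param s n i j"
proof -
  have "specialize s n m (generic_param i j) = z_var + lin_form (block n) (offset s n) i -
      lin_form (block n) (offset s n) j"
    using assms unfolding specialize_def generic_param_def z_var_def
    by (simp add: lin_subst_add lin_subst_diff lin_subst_var)
  then show ?thesis
    using assms by (simp add: lin_form_def fused_param_def block_def offset_def of_nat_diff
        h_var_def algebra_simps)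
qed

lemma specialize_R_factor:
  assumes "s = 1 \<or> s = -1" "i \<in> {1..n}" "j \<in> {n + 1..n + m}"
  shows "(\<lambda>I J. specialize s n m (R_factor s i j I J)) =
    (rep (rbar_el s h_var (fused_param s n i j) i j) :: ('n, 'n vvz_series) tmat)"
proof (intro ext)
  fix I J :: "nat \<Rightarrow> 'n"
  have R: "R_factor s i j = (Rbar s i j h_var (generic_param i j) :: ('n, 'n vvz_series) tmat)"
    by (simp add: R_factor_def h_var_def generic_param_def z_var_def)
  have "specialize s n m h_var = (h_var :: 'n vvz_series)" by (simp add: specialize_def h_var_def)
  moreover have "unit_el (generic_param i j :: 'n vvz_series)"
    "unit_el (generic_param i j - of_int s * h_var :: 'n vvz_series)"
    using unit_generic_param[of i j 0] unit_generic_param[of i j "- s"] by simp_all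
  ultimately show "specialize s n m (R_factor s i j I J) =
      rep (rbar_el s h_var (fused_param s n i j) i j) I J"
    unfolding R rep_rbar_el using assms
    by (subst ring_hom_fun_Rbar[OF ring_hom_fun_specialize])
        (simp_all add: specialize_generic_param)
qed

lemma map_r_list:
  assumes "\<And>i j. i \<in> {1..n} \<Longrightarrow> j \<in> {n + 1..n + m} \<Longrightarrow> \<phi> (F i j) = \<psi> (G i j)"
  shows "map \<phi> (r_list F n m) = map \<psi> (r_list G n m)"
    and "map \<phi> (r_list_bar F n m) = map \<psi> (r_list_bar G n m)"
  unfolding r_list_def r_list_bar_def map_concat map_map comp_def
  by (intro arg_cong[where f = concat] map_cong refl; use assms in \<open>auto simp del: upt_Suc\<close>)+

text \<open>By cyclicity the conjugated trace is the value of \<^const>\<open>trace_functional\<close> at $R^{-1}R'$, whose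
  symmetrization is proportional to that of \<open>1\<close>.\<close>

lemma trace_conjugated_LL:
  assumes s: "s = 1 \<or> s = -1"
  shows "specialize s n m (\<Sum>I\<in>midx (n + m).
      tprod (n + m) [R_nm_bar s n m, LL n m, tinv (n + m) (R_nm s n m)] I (I :: nat \<Rightarrow> 'n::finite)) -
    specialize s n m (\<Sum>I\<in>midx (n + m). LL n m I I) \<in> coeffs_in (VVz_kernel s)"
proof -
  let ?k = "n + m" and ?\<phi> = "specialize s n m :: 'n vvz_series \<Rightarrow> _"
  let ?Ri = "tinv ?k (R_nm s n m) :: ('n, 'n vvz_series) tmat"
  interpret G: r_matrices s h_var "generic_param :: _ \<Rightarrow> _ \<Rightarrow> 'n vvz_series" n m
    by (rule generic_r_matrices[OF s])
  interpret F: fused_r_matrices s h_var "fused_param s n :: _ \<Rightarrow> _ \<Rightarrow> 'n vvz_series" n m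
    by (rule fused_r_matrices_param[OF s])
  interpret Y: young_symmetric_matrix s n m "coeffs_in (VVz_kernel s)"
    "LL_fused s n m :: ('n, 'n vvz_series) tmat"
    by unfold_locales (simp_all add: s LL_fused_symmetric[OF s] two_sided_ideal_coeffs_in
        closed_ideal_two_sided closed_ideal_VVz)
  note hom = ring_hom_fun_specialize[of s n m]
  have R_factor: "R_factor s i j = (rep (G.factor_el i j) :: ('n, _) tmat)" for i j
    unfolding R_factor_def G.factor_el_def rep_rbar_el
    unfolding h_var_def generic_param_def z_var_def ..
  have R: "R_nm s n m I J = rep G.R_el I J" if "I \<in> midx ?k" for I J :: "nat \<Rightarrow> 'n"
  proof -
    have "R_nm s n m = tprod ?k (map (\<lambda>A. A) (r_list (R_factor s :: _ \<Rightarrow> _ \<Rightarrow> ('n, _) tmat) n m))"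
      by (simp add: R_nm_def r_list_def)
    also have "map (\<lambda>A. A) (r_list (R_factor s :: _ \<Rightarrow> _ \<Rightarrow> ('n, _) tmat) n m) =
        map rep (r_list G.factor_el n m)"
      by (rule map_r_list) (rule R_factor)
    finally show ?thesis
      using that by (simp add: G.R_el_def) (rule rep_prod_list, auto simp: set_r_list G.factor_el)
  qed
  have \<phi>R: "?\<phi> (R_nm s n m I J) = rep F.R_el I J" if "I \<in> midx ?k" for I J :: "nat \<Rightarrow> 'n"
  proof -
    have "?\<phi> (R_nm s n m I J) = tprod ?k (map (\<lambda>A I J. ?\<phi> (A I J)) (r_list (R_factor s) n m)) I J"
      unfolding R_nm_def r_list_def by (rule ring_hom_fun_tprod[OF hom])
    also have "map (\<lambda>A I J. ?\<phi> (A I J)) (r_list (R_factor s :: _ \<Rightarrow> _ \<Rightarrow> ('n, _) tmat) n m) =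
        map rep (r_list F.factor_el n m)"
      unfolding F.factor_el_def by (rule map_r_list) (rule specialize_R_factor[OF s])
    finally show ?thesis
      using that by (simp add: F.R_el_def) (rule rep_prod_list, auto simp: set_r_list F.factor_el)
  qed
  have \<phi>Rbar: "?\<phi> (R_nm_bar s n m I J) = rep F.R_bar_el I J" if "I \<in> midx ?k" for I J :: "nat \<Rightarrow> 'n"
  proof -
    have "?\<phi> (R_nm_bar s n m I J) = tprod ?k (map (\<lambda>A I J. ?\<phi> (A I J))
        (r_list_bar (R_factor s) n m)) I J"
      unfolding R_nm_bar_def r_list_bar_def by (rule ring_hom_fun_tprod[OF hom])
    also have "map (\<lambda>A I J. ?\<phi> (A I J)) (r_list_bar (R_factor s :: _ \<Rightarrow> _ \<Rightarrow> ('n, _) tmat) n m) =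
        map rep (r_list_bar F.factor_el n m)"
      unfolding F.factor_el_def by (rule map_r_list) (rule specialize_R_factor[OF s])
    finally show ?thesis
      using that by (simp add: F.R_bar_el_def) (rule rep_prod_list, auto
          simp: set_r_list F.factor_el)
  qed
  obtain y0 where y0: "supported ?k y0" "G.R_el * y0 = 1" "y0 * G.R_el = 1"
    using G.R_el_inverse by blast
  obtain y where y: "supported ?k y" "F.R_el * y = 1" "y * F.R_el = 1"
    using F.R_el_inverse by blast
  have Ri: "?Ri I J = rep y0 I J" if "I \<in> midx ?k" "J \<in> midx ?k" for I J
    using R that by (intro tinv_rep[OF _ G.supported_R_el y0]) auto
  have \<phi>Ri: "?\<phi> (?Ri I J) = rep y I J" if "I \<in> midx ?k" "J \<in> midx ?k" for I J
  proof (rule tmul_inverse_unique[of ?k "rep F.R_el"])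
    fix I J :: "nat \<Rightarrow> 'n" assume IJ: "I \<in> midx ?k" "J \<in> midx ?k"
    have "tmul ?k (rep F.R_el) (\<lambda>I J. ?\<phi> (?Ri I J)) I J = ?\<phi> (tmul ?k (rep G.R_el) (rep y0) I J)"
      unfolding tmul_def ring_hom_fun_sum[OF hom]
      by (intro sum.cong refl) (simp add: ring_hom_funD(3)[OF hom] \<phi>R[symmetric] R Ri IJ)
    also have "\<dots> = tone I J"
      by (simp add: rep_mult[OF G.supported_R_el] IJ y0 rep_1 tone_def ring_hom_funD[OF hom])
    finally show "tmul ?k (rep F.R_el) (\<lambda>I J. ?\<phi> (?Ri I J)) I J = tone I J" .
    show "tmul ?k (rep y) (rep F.R_el) I J = tone I J"
      by (simp add: rep_mult[OF y(1)] IJ y rep_1)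
  qed (use that in auto)
  have "?\<phi> (\<Sum>I\<in>midx ?k. tprod ?k [R_nm_bar s n m, LL n m, ?Ri] I I) =
      ttrace ?k (tmul ?k (rep F.R_bar_el) (tmul ?k (LL_fused s n m) (rep y)))"
    unfolding ring_hom_fun_sum[OF hom] ttrace_def
  proof (intro sum.cong refl)
    fix I :: "nat \<Rightarrow> 'n" assume I: "I \<in> midx ?k"
    have "?\<phi> (tprod ?k [R_nm_bar s n m, LL n m, ?Ri] I I) =
        tmul ?k (\<lambda>I J. ?\<phi> (R_nm_bar s n m I J)) (tmul ?k (LL_fused s n m)
          (tmul ?k (\<lambda>I J. ?\<phi> (?Ri I J)) tone)) I I"
      by (simp add: ring_hom_fun_tprod[OF hom]) (simp add: tprod_def)
    also have "\<dots> = tmul ?k (rep F.R_bar_el) (tmul ?k (LL_fused s n m)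
          (tmul ?k (\<lambda>I J. ?\<phi> (?Ri I J)) tone)) I I"
      by (rule tmul_cong_left) (rule \<phi>Rbar[OF I])
    also have "\<dots> = tmul ?k (rep F.R_bar_el) (tmul ?k (LL_fused s n m) (rep y)) I I"
      by (intro tmul_cong_right) (simp add: tmul_tone_right I \<phi>Ri)
    finally show "?\<phi> (tprod ?k [R_nm_bar s n m, LL n m, ?Ri] I I) = \<dots>" .
  qed
  also have "\<dots> = trace_functional ?k (LL_fused s n m) (y * F.R_bar_el)"
    by (intro ttrace_rep F.supported_R_bar_el F.central_coeffs_R_bar_el y)
  finally have 1: "?\<phi> (\<Sum>I\<in>midx ?k. tprod ?k [R_nm_bar s n m, LL n m, ?Ri] I I) = \<dots>" .
  have 2: "?\<phi> (\<Sum>I\<in>midx ?k. LL n m I (I :: nat \<Rightarrow> 'n)) = ttrace ?k (LL_fused s n m)"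
    unfolding ring_hom_fun_sum[OF hom] ttrace_def ..
  show ?thesis
    unfolding 1 2
    by (intro Y.tf_eq_ttrace rational_mps supported_mult y F.supported_R_bar_el
        F.symmetrized_R_quotient)
qed


section \<open>Continuity of the braiding\<close>

lemma ring_hom_fun_h_scalar: "ring_hom_fun h_scalar"
proof -
  have "ring_hom_fun (single (0 :: 'n word \<times> 'n word) :: complex \<Rightarrow> _)"
    by (simp add: ring_hom_fun_def single_add mult_single)
  then show ?thesis unfolding h_scalar_def[abs_def] by (rule ring_hom_fun_fps)
qed

lemma h_scalar_fps_X: "h_scalar fps_X = fps_X"
  by (simp add: h_scalar_def fps_eq_iff)

lemma extend_z_fps_X: "extend_z (fps_X :: ('n, complex) free_alg2) = fps_X"
proof -
  have "Poly_Mapping.map fls_const (1 :: ('n word \<times> 'n word) \<Rightarrow>\<^sub>0 complex) = 1"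
    using ring_hom_funD(1)[OF ring_hom_fun_map[OF ring_hom_fun_fls_const]] .
  moreover have "Poly_Mapping.map fls_const (0 :: ('n word \<times> 'n word) \<Rightarrow>\<^sub>0 complex) = 0"
    using ring_hom_funD(4)[OF ring_hom_fun_map[OF ring_hom_fun_fls_const]] .
  ultimately show ?thesis
    by (auto simp: extend_z_def fps_eq_iff)
qed

text \<open>The expansion of a product of linear forms has integral coefficients, and so does not depend
  on the ring of coefficients.\<close>

lemma lin_monom_h_scalar:
  "\<exists>d. mps_nth (lin_monom \<tau> c e) e' = (h_scalar d :: ('n, complex) free_alg2) \<and>
    mps_nth (lin_monom \<tau> c e) e' = extend_z (h_scalar d :: ('n, complex) free_alg2)"
proof (induction e arbitrary: e')
  case empty
  note h = ring_hom_funD[OF ring_hom_fun_h_scalar] and z = ring_hom_funD[OF ring_hom_fun_extend_z]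
  show ?case
    by (rule exI[of _ "if e' = {#} then 1 else 0"]) (simp add: mps_nth_1 h z)
next
  case (add p e)
  note h = ring_hom_funD[OF ring_hom_fun_h_scalar] and z = ring_hom_funD[OF ring_hom_fun_extend_z]
  have nth: "mps_nth (lin_monom \<tau> c (add_mset p e)) e' =
      (if \<tau> p \<in># e' then mps_nth (lin_monom \<tau> c e) (e' - {#\<tau> p#}) else 0) +
      of_int (c p) * (fps_X * mps_nth (lin_monom \<tau> c e) e' :: 'q::ring_1 fps)"
    by (simp add: lin_monom_add_mset lin_form_def distrib_right mps_nth_var_mult mult.assoc
        flip: mps_const_of_int)
  obtain d1 where d1: "mps_nth (lin_monom \<tau> c e) e' = (h_scalar d1 :: ('n, complex) free_alg2)"
    "mps_nth (lin_monom \<tau> c e) e' = extend_z (h_scalar d1 :: ('n, complex) free_alg2)"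
    using add by blast
  obtain d2 where d2: "mps_nth (lin_monom \<tau> c e) (e' - {#\<tau> p#}) =
      (h_scalar d2 :: ('n, complex) free_alg2)"
    "mps_nth (lin_monom \<tau> c e) (e' - {#\<tau> p#}) = extend_z (h_scalar d2 :: ('n, complex) free_alg2)"
    using add by blast
  show ?case
    by (rule exI[of _ "(if \<tau> p \<in># e' then d2 else 0) + of_int (c p) * (fps_X * d1)"])
      (simp add: nth d1 d2 h z ring_hom_fun_of_int[OF ring_hom_fun_h_scalar]
        ring_hom_fun_of_int[OF ring_hom_fun_extend_z] h_scalar_fps_X extend_z_fps_X)
qed

lemma VVz_class_eq_iff:
  fixes x y :: "('n, complex fls) free_alg2"
  shows "VVz_class s x = VVz_class s y \<longleftrightarrow> x - y \<in> VVz_kernel s"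
proof -
  define K where "K = (VVz_kernel s :: ('n, complex fls) free_alg2 set)"
  have I: "two_sided_ideal K"
    unfolding K_def by (rule closed_ideal_two_sided[OF closed_ideal_VVz])
  have "x +o K = y +o K \<longleftrightarrow> x - y \<in> K"
  proof
    assume eq: "x +o K = y +o K"
    have "x \<in> x +o K" using set_plus_intro2[OF two_sided_idealD(1)[OF I], of x] by simp
    then have "x \<in> y +o K" unfolding eq .
    then obtain k where "x = y + k" "k \<in> K" unfolding elt_set_plus_def by blast
    then show "x - y \<in> K" by simp
  next
    have sub: "x +o K \<subseteq> y +o K" if "x - y \<in> K" for x y
    proof
      fix z assume "z \<in> x +o K"
      then obtain k where k: "z = x + k" "k \<in> K" unfolding elt_set_plus_def by auto
      have "y + (x - y + k) \<in> y +o K"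
        using two_sided_idealD(2)[OF I that k(2)] by (rule set_plus_intro2)
      then show "z \<in> y +o K" by (simp add: k(1))
    qed
    assume xy: "x - y \<in> K"
    have "y - x \<in> K" using two_sided_idealD(5)[OF I xy] by simp
    with xy show "x +o K = y +o K" by (intro subset_antisym sub)
  qed
  then show ?thesis by (simp add: VVz_class_def K_def)
qed

lemma VVz_class_add:
  fixes x y :: "('n, complex fls) free_alg2"
  shows "VVz_class s x + VVz_class s y = VVz_class s (x + y)"
proof -
  define K where "K = (VVz_kernel s :: ('n, complex fls) free_alg2 set)"
  have I: "two_sided_ideal K"
    unfolding K_def by (rule closed_ideal_two_sided[OF closed_ideal_VVz])
  have "K + K = K"
  proof
    show "K + K \<subseteq> K" using two_sided_idealD(2)[OF I] by (auto simp: set_plus_def)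
    show "K \<subseteq> K + K"
    proof
      fix k assume "k \<in> K"
      then have "k + 0 \<in> K + K" using two_sided_idealD(1)[OF I] by (rule set_plus_intro)
      then show "k \<in> K + K" by simp
    qed
  qed
  then show ?thesis
    unfolding VVz_class_def K_def[symmetric] set_plus_rearrange by simp
qed

locale module_map =
  fixes s :: int and S :: "('n::finite, complex) free_alg2 set \<Rightarrow> ('n, complex fls) free_alg2 set"
  assumes module_map: "VV_module_map s S"
begin

definition maps_to :: "('n, complex) free_alg2 \<Rightarrow> ('n, complex fls) free_alg2 \<Rightarrow> bool"
  where "maps_to x y \<longleftrightarrow> S (VV_class s x) = VVz_class s y"

lemma ex_maps_to: "\<exists>y. maps_to x y"
  using module_map by (auto simp: VV_module_map_def maps_to_def)

lemma maps_to_add: "maps_to x y \<Longrightarrow> maps_to x' y' \<Longrightarrow> maps_to (x + x') (y + y')"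
  using module_map by (simp add: VV_module_map_def maps_to_def VVz_class_add)

lemma maps_to_scalar: "maps_to x y \<Longrightarrow> maps_to (h_scalar c * x) (extend_z (h_scalar c) * y)"
  using module_map by (simp add: VV_module_map_def maps_to_def)

lemma maps_to_0: "maps_to 0 0"
proof -
  obtain y where "maps_to 0 y" using ex_maps_to by blast
  then have "maps_to (h_scalar 0 * 0) (extend_z (h_scalar 0) * y)" by (rule maps_to_scalar)
  then show ?thesis
    by (simp add: ring_hom_funD[OF ring_hom_fun_h_scalar] ring_hom_funD[OF ring_hom_fun_extend_z])
qed

lemma maps_to_sum: "(\<And>i. i \<in> I \<Longrightarrow> maps_to (f i) (g i)) \<Longrightarrow> maps_to (sum f I) (sum g I)"
  by (induction I rule: infinite_finite_induct) (auto intro: maps_to_0 maps_to_add)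

lemma maps_to_cong: "maps_to x y \<Longrightarrow> y - y' \<in> VVz_kernel s \<Longrightarrow> maps_to x y'"
  by (simp add: maps_to_def flip: VVz_class_eq_iff)

lemma maps_to_unique: "maps_to x y \<Longrightarrow> maps_to x y' \<Longrightarrow> y - y' \<in> VVz_kernel s"
  by (simp add: maps_to_def flip: VVz_class_eq_iff)

lemma maps_to_fps_X_power: "maps_to x y \<Longrightarrow> maps_to (fps_X ^ D * x) (fps_X ^ D * y)"
proof (induction D)
  case (Suc D)
  have "maps_to (h_scalar fps_X * (fps_X ^ D * x)) (extend_z (h_scalar fps_X) * (fps_X ^ D * y))"
    by (rule maps_to_scalar) (use Suc in simp)
  then show ?case by (simp add: h_scalar_fps_X extend_z_fps_X mult.assoc)
qed simp

text \<open>A module map is \<open>h\<close>-adically continuous since it sends multiples of $h^D$ to multiples of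
  $h^D$ and its target is separated.\<close>

lemma maps_to_limit:
  assumes approx: "\<And>D. \<exists>x' y'. maps_to x' y' \<and>
    (\<forall>k<D. fps_nth x k = fps_nth x' k \<and> fps_nth y k = fps_nth y' k)"
  shows "maps_to x y"
proof -
  obtain y0 where y0: "maps_to x y0" using ex_maps_to by blast
  have "y0 - y \<in> VVz_kernel s"
  proof (rule closed_fps_approx)
    show "closed (VVz_kernel s)" by (intro closed_ideal_closed closed_ideal_VVz)
    fix D
    obtain x' y' where xy: "maps_to x' y'"
      "\<And>k. k < D \<Longrightarrow> fps_nth x k = fps_nth x' k \<and> fps_nth y k = fps_nth y' k"
      using approx[of D] by blast
    have x: "x = x' + fps_X ^ D * fps_shift D (x - x')"
      by (rule fps_ext) (auto simp: fps_X_power_mult_nth xy(2))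
    obtain y'' where "maps_to (fps_shift D (x - x')) y''" using ex_maps_to by blast
    then have "maps_to x (y' + fps_X ^ D * y'')"
      by (subst x) (intro maps_to_add xy(1) maps_to_fps_X_power)
    then have "y0 - (y' + fps_X ^ D * y'') \<in> VVz_kernel s" by (rule maps_to_unique[OF y0])
    moreover have "fps_nth (y0 - (y' + fps_X ^ D * y'')) k = fps_nth (y0 - y) k" if "k < D" for k
      using that xy(2)[OF that] by (simp add: fps_X_power_mult_nth)
    ultimately show "\<exists>z\<in>VVz_kernel s. \<forall>k<D. fps_nth z k = fps_nth (y0 - y) k" by blast
  qed
  with y0 show ?thesis by (rule maps_to_cong)
qed

lemma maps_to_lin_subst:
  assumes V: "finite V" and fg: "\<And>e. maps_to (mps_nth f e) (mps_nth g e)"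
  shows "maps_to (mps_nth (lin_subst V \<tau> c f) e) (mps_nth (lin_subst V \<tau> c g) e)"
proof (rule maps_to_limit)
  fix D
  have nth: "mps_nth (subst_sum V \<tau> c (size e + D) h) e =
      (\<Sum>e'\<in>msets_le V (size e + D). mps_nth (lin_monom \<tau> c e') e * mps_nth h e')"
          for h :: "'q::ring_1 fps mps"
    unfolding subst_sum_def mps_nth_sum
    by (intro sum.cong refl) (simp only: centralD[OF central_lin_monom, symmetric]
        mps_nth_mult_const)
  have "maps_to (mps_nth (lin_monom \<tau> c e') e * mps_nth f e') (mps_nth (lin_monom \<tau> c e') e *
      mps_nth g e')" for e'
  proof -
    obtain d where "mps_nth (lin_monom \<tau> c e') e = (h_scalar d :: ('n, complex) free_alg2)"
      "mps_nth (lin_monom \<tau> c e') e = extend_z (h_scalar d :: ('n, complex) free_alg2)"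
      using lin_monom_h_scalar by blast
    then show ?thesis using maps_to_scalar[OF fg] by simp
  qed
  then have "maps_to (mps_nth (subst_sum V \<tau> c (size e + D) f) e)
      (mps_nth (subst_sum V \<tau> c (size e + D) g) e)"
    unfolding nth by (intro maps_to_sum)
  then show "\<exists>x' y'. maps_to x' y' \<and> (\<forall>k<D. fps_nth (mps_nth (lin_subst V \<tau> c f) e) k =
      fps_nth x' k \<and>
      fps_nth (mps_nth (lin_subst V \<tau> c g) e) k = fps_nth y' k)"
    by (intro exI conjI allI impI) (assumption, (rule lin_subst_nth[OF V], simp)+)
qed

end


section \<open>The braiding fixes the traces\<close>

theorem proposition6p1:
  fixes S :: "('n::finite, complex) free_alg2 set \<Rightarrow> ('n, complex fls) free_alg2 set"
    and s :: int and m n :: nat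
  assumes "CARD('n) \<ge> 2"
    and "s = 1 \<or> s = -1"
    and "is_braiding s S"
    and "n \<in> {1..CARD('n)}"
    and "m \<in> {1..CARD('n)}"
  shows "\<forall>a b. S (VV_class s (tensor (fps_nth (L_trace s n) a) (fps_nth (L_trace s m) b))) =
    VVz_class s (extend_z (tensor (fps_nth (L_trace s n) a) (fps_nth (L_trace s m) b)))"
proof (intro allI)
  fix a b
  let ?x = "tensor (fps_nth (L_trace s n) a) (fps_nth (L_trace s m) b) :: ('n, complex) free_alg2"
  let ?k = "n + m" and ?e = "replicate_mset a 1 + replicate_mset b (n + 1)"
  define T where "T = (\<Sum>I\<in>midx ?k. tprod ?k [R_nm_bar s n m, LL n m, tinv ?k (R_nm s n m)] I
      (I :: nat \<Rightarrow> 'n))"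
  interpret module_map s S
    using assms(3) by unfold_locales (simp add: is_braiding_def)
  \<comment> \<open>For \<open>n = 0\<close> the variables \<open>u\<close> and \<open>v\<close> would coincide.\<close>
  have n: "1 \<noteq> n + 1" using assms(4) by simp
  have "maps_to (mps_nth (\<Sum>I\<in>midx ?k. LL n m I (I :: nat \<Rightarrow> 'n)) e) (mps_nth T e)" for e
    unfolding T_def mps_nth_sum using assms(3)
    by (intro maps_to_sum) (simp add: is_braiding_def maps_to_def)
  then have "maps_to (mps_nth (specialize s n m (\<Sum>I\<in>midx ?k. LL n m I (I :: nat \<Rightarrow> 'n))) ?e)
      (mps_nth (specialize s n m T) ?e)"
    unfolding specialize_def by (intro maps_to_lin_subst) simp_all
  moreover have "mps_nth (specialize s n m (\<Sum>I\<in>midx ?k. LL n m I (I :: nat \<Rightarrow> 'n))) ?e = ?x"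
    unfolding specialize_trace_LL[OF gen_embedding_tensor_left gen_embedding_tensor_right]
      mps_nth_series_mult_series[OF n] tensor_def ..
  ultimately have "maps_to ?x (mps_nth (specialize s n m T) ?e)" by simp
  moreover have "mps_nth (specialize s n m T) ?e - extend_z ?x \<in> VVz_kernel s"
  proof -
    have "mps_nth (specialize s n m (\<Sum>I\<in>midx ?k. LL n m I (I :: nat \<Rightarrow> 'n))) ?e = extend_z ?x"
      unfolding specialize_trace_LL[OF gen_embedding_extend_z[OF gen_embedding_tensor_left]
          gen_embedding_extend_z[OF gen_embedding_tensor_right]]
        mps_nth_series_mult_series[OF n] tensor_def ring_hom_funD(3)[OF ring_hom_fun_extend_z] ..
    then show ?thesis
      using trace_conjugated_LL[OF assms(2), of n m, where 'n = 'n]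
      unfolding T_def[symmetric] coeffs_in_def by (auto dest: spec[of _ ?e])
  qed
  ultimately show "S (VV_class s ?x) = VVz_class s (extend_z ?x)"
    unfolding maps_to_def[symmetric] by (rule maps_to_cong)
qed

end
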